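(* Let $l \ge 2$ be an integer, and let $X_l$ be the monoid of all symbols $(A_1,\dots,A_l,H)$ where $H$ is a complex Hilbert space and $A_1,\dots,A_l$ are pairwise commuting self-adjoint trace-class operators on $H$, with addition given by direct sum. Then there does not exist a nontrivial trace map $\psi: X_l \to \mathbb{R}$; that is, every trace map $\psi : X_l \to \mathbb{R}$ (in the sense defined in the context) satisfies $\psi(A_1,\dots,A_l,H)=0$ for every $(A_1,\dots,A_l,H)\in X_l$.
   Context: For an integer $l\ge 1$, $X_l$ denotes the collection of all symbols $(A_1,\dots,A_l,H)$, where $H$ is a complex Hilbert space and $A_1,\dots,A_l$ are pairwise commuting self-adjoint trace-class operators on $H$. (To avoid set-theoretic problems one may choose one Hilbert space from each isomorphism class.) $X_l$ is a monoid under $$(A_1,\dots,A_l,H_1)+(B_1,\dots,B_l,H_2)=(A_1\oplus B_1,\dots,A_l\oplus B_l,H_1\oplus H_2).$$ For a fixed $H$, the fibre $(X_l)_H$ is the set of all $l$-tuples of pairwise commuting self-adjoint trace-class operators on $H$, with the topology induced by the trace norm in each component (i.e. as a subset of the $l$-fold product of the real Banach space of self-adjoint trace-class operators on $H$). For a positive-definite real symmetric matrix $A = SDS^{-1}$, with $S$ real orthogonal and $D$ diagonal with positive real diagonal entries, $\log A := S(\log D)S^{-1}$, where $\log D$ is the diagonal matrix obtained by applying the usual real logarithm to the diagonal entries of $D$. It is a real symmetric matrix, regarded as a self-adjoint operator on $\mathbb{C}^n$. A trace map on $X_l$ is a monoid homomorphism $\psi$ from $X_l$ to the additive group $\mathbb{R}$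 satisfying the following conditions. (i) For each fixed Hilbert space $H$, the restriction of $\psi$ to the fibre $(X_l)_H$ is continuous. (ii) $\psi$ is additive in each coordinate: for every Hilbert space $H$, all pairwise commuting self-adjoint trace-class operators $A_1,\dots,A_l,B$ on $H$, and every $1\le i\le l$, $$\psi(A_1,\dots,A_{i-1},A_i+B,A_{i+1},\dots,A_l,H)=\psi(A_1,\dots,A_{i-1},A_i,A_{i+1},\dots,A_l,H)+\psi(A_1,\dots,A_{i-1},B,A_{i+1},\dots,A_l,H).$$ (iii) If $h:H_1\to H_2$ is an isomorphism of Hilbert spaces (a unitary map), then $\psi(A_1,\dots,A_l,H_1)=\psi(hA_1h^{-1},\dots,hA_lh^{-1},H_2)$ for all $(A_1,\dots,A_l,H_1)\in X_l$. (iv) For every $n\ge 1$, whenever $A_1(t),\dots,A_l(t)\in GL_n(\mathbb{R}[t])$ are pairwise commuting and $A_i(0)$ and $A_i(1)$ are positive-definite symmetric matrices for every $i$, one has $$\psi(\log A_1(0),\dots,\log A_l(0),\mathbb{C}^n)=\psi(\log A_1(1),\dots,\log A_l(1),\mathbb{C}^n).$$ *)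

theory Defs
  imports "Jordan_Normal_Form.VS_Connect" "HOL-Analysis.Infinite_Sum"
begin

hide_const (open) Multiset.mult Polynomial.smult Modules.module

section \<open>Complex Hilbert spaces\<close>

text \<open>A Hilbert space is a record on an explicit carrier set: a complex vector space in the sense of
  \<^locale>\<open>vectorspace\<close>, with an inner product that is linear in its first argument. (The fields
  \<^const>\<open>monoid.mult\<close> and \<^const>\<open>monoid.one\<close> inherited from \<^typ>\<open>('a, 'b) module\<close> are irrelevant.)\<close>

record 'v ip_space = "(complex, 'v) module" +
  ip :: "'v \<Rightarrow> 'v \<Rightarrow> complex"

definition hnorm :: "'v ip_space \<Rightarrow> 'v \<Rightarrow> real" where
  "hnorm H x = sqrt (Re (ip H x x))"

locale hilbert_space = vectorspace "class_ring :: complex ring" H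
  for H :: "'v ip_space" (structure) +
  assumes ip_add: "\<lbrakk>x \<in> carrier H; y \<in> carrier H; z \<in> carrier H\<rbrakk>
      \<Longrightarrow> ip H (x \<oplus> y) z = ip H x z + ip H y z"
    and ip_smult: "\<lbrakk>x \<in> carrier H; y \<in> carrier H\<rbrakk> \<Longrightarrow> ip H (c \<odot> x) y = c * ip H x y"
    and ip_cnj: "\<lbrakk>x \<in> carrier H; y \<in> carrier H\<rbrakk> \<Longrightarrow> ip H y x = cnj (ip H x y)"
    and ip_nonneg: "x \<in> carrier H \<Longrightarrow> 0 \<le> ip H x x"
    and ip_definite: "\<lbrakk>x \<in> carrier H; ip H x x = 0\<rbrakk> \<Longrightarrow> x = \<zero>"
    and complete: "\<lbrakk>\<And>n :: nat. X n \<in> carrier H;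
        \<And>e. 0 < e \<Longrightarrow> \<exists>N. \<forall>m\<ge>N. \<forall>n\<ge>N. hnorm H (X m \<ominus> X n) < e\<rbrakk>
      \<Longrightarrow> \<exists>x\<in>carrier H. (\<lambda>n. hnorm H (X n \<ominus> x)) \<longlonglongrightarrow> 0"

definition orthonormal_basis :: "'v ip_space \<Rightarrow> 'v set \<Rightarrow> bool" where
  "orthonormal_basis H E \<longleftrightarrow> E \<subseteq> carrier H
     \<and> (\<forall>e\<in>E. \<forall>f\<in>E. ip H e f = (if e = f then 1 else 0))
     \<and> (\<forall>x\<in>carrier H. (\<forall>e\<in>E. ip H x e = 0) \<longrightarrow> x = \<zero>\<^bsub>H\<^esub>)"

section \<open>Operators\<close>

text \<open>Operators are extensional functions on the carrier, so that operators that agree on the space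
  are equal.\<close>

definition bounded_op :: "'v ip_space \<Rightarrow> ('v \<Rightarrow> 'v) \<Rightarrow> bool" where
  "bounded_op H A \<longleftrightarrow> A \<in> carrier H \<rightarrow>\<^sub>E carrier H
     \<and> (\<forall>x\<in>carrier H. \<forall>y\<in>carrier H. A (x \<oplus>\<^bsub>H\<^esub> y) = A x \<oplus>\<^bsub>H\<^esub> A y)
     \<and> (\<forall>c. \<forall>x\<in>carrier H. A (c \<odot>\<^bsub>H\<^esub> x) = c \<odot>\<^bsub>H\<^esub> A x)
     \<and> (\<exists>K. \<forall>x\<in>carrier H. hnorm H (A x) \<le> K * hnorm H x)"

definition op_add :: "'v ip_space \<Rightarrow> ('v \<Rightarrow> 'v) \<Rightarrow> ('v \<Rightarrow> 'v) \<Rightarrow> 'v \<Rightarrow> 'v" where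
  "op_add H A B = (\<lambda>x\<in>carrier H. A x \<oplus>\<^bsub>H\<^esub> B x)"

definition op_diff :: "'v ip_space \<Rightarrow> ('v \<Rightarrow> 'v) \<Rightarrow> ('v \<Rightarrow> 'v) \<Rightarrow> 'v \<Rightarrow> 'v" where
  "op_diff H A B = (\<lambda>x\<in>carrier H. A x \<ominus>\<^bsub>H\<^esub> B x)"

definition self_adjoint :: "'v ip_space \<Rightarrow> ('v \<Rightarrow> 'v) \<Rightarrow> bool" where
  "self_adjoint H A \<longleftrightarrow> bounded_op H A
     \<and> (\<forall>x\<in>carrier H. \<forall>y\<in>carrier H. ip H (A x) y = ip H x (A y))"

definition positive_op :: "'v ip_space \<Rightarrow> ('v \<Rightarrow> 'v) \<Rightarrow> bool" where
  "positive_op H P \<longleftrightarrow> self_adjoint H P \<and> (\<forall>x\<in>carrier H. 0 \<le> ip H (P x) x)"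

definition commuting :: "'v ip_space \<Rightarrow> ('v \<Rightarrow> 'v) \<Rightarrow> ('v \<Rightarrow> 'v) \<Rightarrow> bool" where
  "commuting H A B \<longleftrightarrow> (\<forall>x\<in>carrier H. A (B x) = B (A x))"

text \<open>\<open>P = |T|\<close>, the positive operator with \<open>P\<^sup>2 = T\<^sup>* T\<close>.\<close>

definition is_abs_op :: "'v ip_space \<Rightarrow> ('v \<Rightarrow> 'v) \<Rightarrow> ('v \<Rightarrow> 'v) \<Rightarrow> bool" where
  "is_abs_op H T P \<longleftrightarrow> positive_op H P
     \<and> (\<forall>x\<in>carrier H. \<forall>y\<in>carrier H. ip H (P (P x)) y = ip H (T x) (T y))"

text \<open>\<open>r = tr |T|\<close>, the sum of \<open>\<langle>|T| e, e\<rangle>\<close> over an orthonormal basis. Since \<open>|T|\<close> is unique and the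
  sum does not depend on the basis, at most one \<open>r\<close> has this property.\<close>

definition has_trace_norm :: "'v ip_space \<Rightarrow> ('v \<Rightarrow> 'v) \<Rightarrow> real \<Rightarrow> bool" where
  "has_trace_norm H T r \<longleftrightarrow> (\<exists>P E. is_abs_op H T P \<and> orthonormal_basis H E
     \<and> ((\<lambda>e. Re (ip H (P e) e)) has_sum r) E)"

definition trace_norm :: "'v ip_space \<Rightarrow> ('v \<Rightarrow> 'v) \<Rightarrow> real" where
  "trace_norm H T = (THE r. has_trace_norm H T r)"

definition trace_class :: "'v ip_space \<Rightarrow> ('v \<Rightarrow> 'v) \<Rightarrow> bool" where
  "trace_class H T \<longleftrightarrow> bounded_op H T \<and> (\<exists>r. has_trace_norm H T r)"

section \<open>Unitary maps\<close>

definition unitary_iso :: "'v ip_space \<Rightarrow> 'w ip_space \<Rightarrow> ('v \<Rightarrow> 'w) \<Rightarrow> bool" where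
  "unitary_iso H K h \<longleftrightarrow> bij_betw h (carrier H) (carrier K)
     \<and> (\<forall>x\<in>carrier H. \<forall>y\<in>carrier H. h (x \<oplus>\<^bsub>H\<^esub> y) = h x \<oplus>\<^bsub>K\<^esub> h y)
     \<and> (\<forall>c. \<forall>x\<in>carrier H. h (c \<odot>\<^bsub>H\<^esub> x) = c \<odot>\<^bsub>K\<^esub> h x)
     \<and> (\<forall>x\<in>carrier H. \<forall>y\<in>carrier H. ip K (h x) (h y) = ip H x y)"

definition conj_op :: "'v ip_space \<Rightarrow> 'w ip_space \<Rightarrow> ('v \<Rightarrow> 'w) \<Rightarrow> ('v \<Rightarrow> 'v) \<Rightarrow> 'w \<Rightarrow> 'w" where
  "conj_op H K h A = (\<lambda>y\<in>carrier K. h (A (inv_into (carrier H) h y)))"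

section \<open>The collection of Hilbert spaces\<close>

text \<open>All Hilbert spaces together do not form a set, so we consider all Hilbert spaces whose elements
  are taken from a type \<open>'a univ\<close>, for an arbitrary type \<open>'a\<close>. It contains \<open>'a\<close>, the vectors of all
  \<open>\<complex>\<^sup>n\<close>, and is closed under pairing, hence the collection contains every \<open>\<complex>\<^sup>n\<close>, an isomorphic copy
  of every Hilbert space with carrier in \<open>'a\<close>, and is closed under direct sums and subspaces.\<close>

datatype 'a univ = Atom 'a | Coord (coord: "complex vec") | Tup (left: "'a univ") (right: "'a univ")

definition Cn :: "nat \<Rightarrow> 'a univ ip_space" where
  "Cn n = \<lparr>carrier = Coord ` carrier_vec n, mult = undefined, one = undefined,
     zero = Coord (0\<^sub>v n), add = (\<lambda>x y. Coord (coord x + coord y)),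
     smult = (\<lambda>c x. Coord (c \<cdot>\<^sub>v coord x)), ip = (\<lambda>x y. coord x \<bullet>c coord y)\<rparr>"

definition hsum :: "'a univ ip_space \<Rightarrow> 'a univ ip_space \<Rightarrow> 'a univ ip_space" where
  "hsum H K = \<lparr>carrier = {Tup x y | x y. x \<in> carrier H \<and> y \<in> carrier K},
     mult = undefined, one = undefined,
     zero = Tup \<zero>\<^bsub>H\<^esub> \<zero>\<^bsub>K\<^esub>,
     add = (\<lambda>u v. Tup (left u \<oplus>\<^bsub>H\<^esub> left v) (right u \<oplus>\<^bsub>K\<^esub> right v)),
     smult = (\<lambda>c u. Tup (c \<odot>\<^bsub>H\<^esub> left u) (c \<odot>\<^bsub>K\<^esub> right u)),
     ip = (\<lambda>u v. ip H (left u) (left v) + ip K (right u) (right v))\<rparr>"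

definition op_dsum :: "'a univ ip_space \<Rightarrow> 'a univ ip_space
    \<Rightarrow> ('a univ \<Rightarrow> 'a univ) \<Rightarrow> ('a univ \<Rightarrow> 'a univ) \<Rightarrow> 'a univ \<Rightarrow> 'a univ" where
  "op_dsum H K A B = (\<lambda>u\<in>carrier (hsum H K). Tup (A (left u)) (B (right u)))"

section \<open>The monoid of symbols\<close>

type_synonym 'a symbol = "('a univ \<Rightarrow> 'a univ) list \<times> 'a univ ip_space"

definition symbols :: "nat \<Rightarrow> 'a symbol set" where
  "symbols l = {(As, H). hilbert_space H \<and> length As = l
     \<and> (\<forall>A\<in>set As. self_adjoint H A \<and> trace_class H A)
     \<and> (\<forall>A\<in>set As. \<forall>B\<in>set As. commuting H A B)}"

definition fibre :: "nat \<Rightarrow> 'a univ ip_space \<Rightarrow> ('a univ \<Rightarrow> 'a univ) list set" where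
  "fibre l H = {As. (As, H) \<in> symbols l}"

fun symbol_add :: "'a symbol \<Rightarrow> 'a symbol \<Rightarrow> 'a symbol" where
  "symbol_add (As, H) (Bs, K) = (map2 (op_dsum H K) As Bs, hsum H K)"

section \<open>Logarithms of positive-definite matrices\<close>

definition pos_def_symmetric :: "nat \<Rightarrow> real mat \<Rightarrow> bool" where
  "pos_def_symmetric n A \<longleftrightarrow> A \<in> carrier_mat n n \<and> transpose_mat A = A
     \<and> (\<forall>v\<in>carrier_vec n. v \<noteq> 0\<^sub>v n \<longrightarrow> 0 < v \<bullet> (A *\<^sub>v v))"

text \<open>\<^const>\<open>orthogonal_mat\<close> only asks for orthogonal columns, so \<open>S\<^sup>-\<^sup>1 = S\<^sup>T\<close> is required explicitly.\<close>

definition mat_log :: "nat \<Rightarrow> real mat \<Rightarrow> real mat" where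
  "mat_log n A = (THE L. \<exists>S\<in>carrier_mat n n. \<exists>D\<in>carrier_mat n n.
     inverts_mat S (transpose_mat S) \<and> inverts_mat (transpose_mat S) S
     \<and> diagonal_mat D \<and> (\<forall>i<n. 0 < D $$ (i, i))
     \<and> A = S * D * transpose_mat S
     \<and> L = S * mat_diag n (\<lambda>i. ln (D $$ (i, i))) * transpose_mat S)"

definition mat_op :: "nat \<Rightarrow> real mat \<Rightarrow> 'a univ \<Rightarrow> 'a univ" where
  "mat_op n L = (\<lambda>x\<in>carrier (Cn n). Coord (map_mat complex_of_real L *\<^sub>v coord x))"

definition GL_poly :: "nat \<Rightarrow> real poly mat set" where
  "GL_poly n = {A \<in> carrier_mat n n. invertible_mat A}"

definition mat_eval :: "real poly mat \<Rightarrow> real \<Rightarrow> real mat" where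
  "mat_eval A t = map_mat (\<lambda>p. poly p t) A"

section \<open>Trace maps\<close>

text \<open>The neutral element of the monoid \<open>symbols l\<close> is the class of symbols on a zero-dimensional space.\<close>

definition monoid_hom :: "nat \<Rightarrow> ('a symbol \<Rightarrow> real) \<Rightarrow> bool" where
  "monoid_hom l \<psi> \<longleftrightarrow>
     (\<forall>s\<in>symbols l. \<forall>t\<in>symbols l. \<psi> (symbol_add s t) = \<psi> s + \<psi> t)
     \<and> (\<forall>(As, H)\<in>symbols l. carrier H = {\<zero>\<^bsub>H\<^esub>} \<longrightarrow> \<psi> (As, H) = 0)"

definition fibre_continuous :: "nat \<Rightarrow> ('a symbol \<Rightarrow> real) \<Rightarrow> bool" where
  "fibre_continuous l \<psi> \<longleftrightarrow> (\<forall>H. \<forall>As\<in>fibre l H. \<forall>e>0. \<exists>d>0. \<forall>Bs\<in>fibre l H.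
     (\<forall>i<l. trace_norm H (op_diff H (Bs ! i) (As ! i)) < d) \<longrightarrow> \<bar>\<psi> (Bs, H) - \<psi> (As, H)\<bar> < e)"

definition coordinatewise_additive :: "nat \<Rightarrow> ('a symbol \<Rightarrow> real) \<Rightarrow> bool" where
  "coordinatewise_additive l \<psi> \<longleftrightarrow> (\<forall>H As B. length As = l \<longrightarrow> As @ [B] \<in> fibre (Suc l) H \<longrightarrow>
     (\<forall>i<l. \<psi> (As[i := op_add H (As ! i) B], H) = \<psi> (As, H) + \<psi> (As[i := B], H)))"

definition unitarily_invariant :: "nat \<Rightarrow> ('a symbol \<Rightarrow> real) \<Rightarrow> bool" where
  "unitarily_invariant l \<psi> \<longleftrightarrow> (\<forall>H K h As. hilbert_space H \<longrightarrow> hilbert_space K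
     \<longrightarrow> unitary_iso H K h \<longrightarrow> As \<in> fibre l H \<longrightarrow> \<psi> (As, H) = \<psi> (map (conj_op H K h) As, K))"

definition poly_homotopy_invariant :: "nat \<Rightarrow> ('a symbol \<Rightarrow> real) \<Rightarrow> bool" where
  "poly_homotopy_invariant l \<psi> \<longleftrightarrow> (\<forall>n\<ge>1. \<forall>As. length As = l \<longrightarrow> set As \<subseteq> GL_poly n
     \<longrightarrow> (\<forall>A\<in>set As. \<forall>B\<in>set As. A * B = B * A)
     \<longrightarrow> (\<forall>A\<in>set As. pos_def_symmetric n (mat_eval A 0) \<and> pos_def_symmetric n (mat_eval A 1))
     \<longrightarrow> \<psi> (map (\<lambda>A. mat_op n (mat_log n (mat_eval A 0))) As, Cn n)
         = \<psi> (map (\<lambda>A. mat_op n (mat_log n (mat_eval A 1))) As, Cn n))"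

definition trace_map :: "nat \<Rightarrow> ('a symbol \<Rightarrow> real) \<Rightarrow> bool" where
  "trace_map l \<psi> \<longleftrightarrow> monoid_hom l \<psi> \<and> fibre_continuous l \<psi> \<and> coordinatewise_additive l \<psi>
     \<and> unitarily_invariant l \<psi> \<and> poly_homotopy_invariant l \<psi>"

end

theory Submission
  imports Defs "HOL-Analysis.Elementary_Metric_Spaces"
begin

text \<open>Commuting self-adjoint trace-class operators have a common orthonormal eigenbasis, and truncating them
  to finitely many basis vectors changes them little in trace norm. By continuity, additivity on direct
  sums and unitary invariance, \<open>\<psi>\<close> is therefore determined by the numbers
  \<open>g(a\<^sub>1, \<dots>, a\<^sub>l) = \<psi>(a\<^sub>1, \<dots>, a\<^sub>l, \<complex>)\<close>, and \<open>g\<close> is multilinear. An invertible polynomial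
  matrix \<open>A(t)\<close> with \<open>A(0) = 1\<close> and \<open>A(1) = diag(1/2, 2)\<close>, used in the first two coordinates,
  together with constant scalar matrices in the others yields
  \<open>g(-ln 2, -ln 2, a\<^sub>3, \<dots>) + g(ln 2, ln 2, a\<^sub>3, \<dots>) = 0\<close>. Both summands agree, because the two signs cancel;
  hence \<open>g = 0\<close>.\<close>

section \<open>Geometry of Hilbert spaces\<close>

text \<open>Having two coordinates is essential to the sign argument. With a single coordinate the
  same path gives only g(-ln 2) + g(ln 2) = 0, which additivity already implies. Indeed the
  determinant of an invertible polynomial matrix is a unit of R[t], hence constant, and tr log A =
  ln det A, so homotopy invariance never contradicts the ordinary trace when l = 1. "Multilinear" at
  first means additive in each variable. The homotopy yields the value 0 at ln 2 only; it spreads to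
  the rational multiples by additivity and to all reals by continuity. The trace norm is given
  through some |T| and some basis. It is therefore evaluated on operators that are diagonal in a
  known orthonormal basis; truncation errors and differences of scalars are of this kind. The
  eigenbasis has to exist in any dimension, nonseparable spaces included. Zorn's lemma and a
  variational construction of eigenvectors provide it, with the finiteness of the sum of ||A e||^2
  over a basis taking the place of compactness.\<close>

context hilbert_space
begin

lemma smult_carrier [simp, intro]: "x \<in> carrier H \<Longrightarrow> c \<odot> x \<in> carrier H"
  by (rule smult_closed) simp

lemma uminus_eq_smult: "x \<in> carrier H \<Longrightarrow> \<ominus> x = (-1) \<odot> x"
  using smult_l_minus[of 1 x] smult_one[of x] by (simp add: class_ring_simps)

lemma diff_eq: "x \<in> carrier H \<Longrightarrow> y \<in> carrier H \<Longrightarrow> x \<ominus> y = x \<oplus> (-1) \<odot> y"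
  by (simp add: a_minus_def uminus_eq_smult)

lemma zero_eq_smult: "x \<in> carrier H \<Longrightarrow> \<zero> = 0 \<odot> x"
  using smult_l_null[of x] by simp

lemma ip_add_right: "\<lbrakk>x \<in> carrier H; y \<in> carrier H; z \<in> carrier H\<rbrakk>
    \<Longrightarrow> ip H z (x \<oplus> y) = ip H z x + ip H z y"
  using ip_add[of x y z] ip_cnj[of "x \<oplus> y" z] ip_cnj[of x z] ip_cnj[of y z] by simp

lemma ip_smult_right: "\<lbrakk>x \<in> carrier H; y \<in> carrier H\<rbrakk> \<Longrightarrow> ip H x (c \<odot> y) = cnj c * ip H x y"
  using ip_smult[of y x c] ip_cnj[of "c \<odot> y" x] ip_cnj[of y x] by simp

lemma ip_diff: "\<lbrakk>x \<in> carrier H; y \<in> carrier H; z \<in> carrier H\<rbrakk>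
    \<Longrightarrow> ip H (x \<ominus> y) z = ip H x z - ip H y z"
  by (simp add: diff_eq ip_add ip_smult)

lemma ip_diff_right: "\<lbrakk>x \<in> carrier H; y \<in> carrier H; z \<in> carrier H\<rbrakk>
    \<Longrightarrow> ip H z (x \<ominus> y) = ip H z x - ip H z y"
  by (simp add: diff_eq ip_add_right ip_smult_right)

lemma ip_zero [simp]: "x \<in> carrier H \<Longrightarrow> ip H \<zero> x = 0"
  using zero_eq_smult[of x] ip_smult[of x x 0] by simp

lemma ip_zero_right [simp]: "x \<in> carrier H \<Longrightarrow> ip H x \<zero> = 0"
  using zero_eq_smult[of x] ip_smult_right[of x x 0] by simp

lemmas ip_linear = ip_add ip_smult ip_diff ip_add_right ip_smult_right ip_diff_right

lemma hnorm_square: "x \<in> carrier H \<Longrightarrow> (hnorm H x)\<^sup>2 = Re (ip H x x)"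
  using ip_nonneg[of x] by (simp add: hnorm_def less_eq_complex_def)

lemma ip_self: "x \<in> carrier H \<Longrightarrow> ip H x x = of_real ((hnorm H x)\<^sup>2)"
  using ip_nonneg[of x] by (simp add: hnorm_square complex_eq_iff less_eq_complex_def)

lemma hnorm_nonneg [simp]: "x \<in> carrier H \<Longrightarrow> 0 \<le> hnorm H x"
  using ip_nonneg[of x] by (simp add: hnorm_def less_eq_complex_def)

lemma hnorm_eq_0: "x \<in> carrier H \<Longrightarrow> hnorm H x = 0 \<longleftrightarrow> x = \<zero>"
  using ip_definite[of x] ip_self[of x] by (metis hnorm_square ip_zero of_real_0 power_zero_numeral zero_eq_power2 M.zero_closed complex.sel(1) zero_complex.code)

lemma hnorm_zero [simp]: "hnorm H \<zero> = 0"
  by (simp add: hnorm_eq_0)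

lemma hnorm_smult: "x \<in> carrier H \<Longrightarrow> hnorm H (c \<odot> x) = cmod c * hnorm H x"
proof -
  assume x: "x \<in> carrier H"
  have "ip H (c \<odot> x) (c \<odot> x) = of_real ((cmod c)\<^sup>2 * (hnorm H x)\<^sup>2)"
    using x complex_norm_square[of c] ip_self[of x] by (simp add: ip_linear)
  hence "(hnorm H (c \<odot> x))\<^sup>2 = (cmod c * hnorm H x)\<^sup>2"
    using x by (simp add: hnorm_square power_mult_distrib)
  thus ?thesis using x by (simp add: power2_eq_iff_nonneg)
qed

lemma eq_if_diff_zero: "\<lbrakk>x \<in> carrier H; y \<in> carrier H; x \<ominus> y = \<zero>\<rbrakk> \<Longrightarrow> x = y"
  by simp

text \<open>The standard device for vector identities below: pairing with an arbitrary
  \<open>z\<close> turns arithmetic in the module into arithmetic of complex numbers, done by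
  \<open>ip_linear\<close>.\<close>

lemma ip_eqI:
  assumes "x \<in> carrier H" "y \<in> carrier H" and "\<And>z. z \<in> carrier H \<Longrightarrow> ip H x z = ip H y z"
  shows "x = y"
proof -
  have "ip H (x \<ominus> y) (x \<ominus> y) = 0" using assms by (simp add: ip_diff)
  hence "x \<ominus> y = \<zero>" using assms ip_definite by blast
  thus ?thesis using assms eq_if_diff_zero by blast
qed

lemma cauchy_schwarz: 
  assumes x: "x \<in> carrier H" and y: "y \<in> carrier H"
  shows "cmod (ip H x y) \<le> hnorm H x * hnorm H y"
proof (cases "hnorm H y = 0")
  case True
  thus ?thesis using x y by (simp add: hnorm_eq_0)
next
  case False
  \<comment> \<open>The coefficient of the orthogonal projection of \<open>x\<close> onto the line
    through \<open>y\<close>; the squared norm of the remainder is nonnegative.\<close>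
  define c where "c = ip H x y / of_real ((hnorm H y)\<^sup>2)"
  have cy: "c * of_real ((hnorm H y)\<^sup>2) = ip H x y" using False by (simp add: c_def)
  have "ip H (x \<ominus> c \<odot> y) (x \<ominus> c \<odot> y) = ip H x x - cnj c * ip H x y - c * cnj (ip H x y) + c * cnj c * ip H y y"
    using x y ip_cnj[of x y] by (simp add: ip_linear algebra_simps)
  also have "\<dots> = ip H x x - cnj c * ip H x y"
    using ip_self[OF y] cy[symmetric] by (simp add: algebra_simps)
  also have "\<dots> = of_real ((hnorm H x)\<^sup>2 - (cmod (ip H x y))\<^sup>2 / (hnorm H y)\<^sup>2)"
    using ip_self[OF x] complex_norm_square[of "ip H x y"] by (simp add: c_def mult.commute)
  finally have "0 \<le> (hnorm H x)\<^sup>2 - (cmod (ip H x y))\<^sup>2 / (hnorm H y)\<^sup>2"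
    using ip_nonneg[of "x \<ominus> c \<odot> y"] x y by (simp add: less_eq_complex_def)
  hence "(cmod (ip H x y))\<^sup>2 \<le> (hnorm H x * hnorm H y)\<^sup>2"
    using False by (simp add: field_simps power_mult_distrib)
  thus ?thesis using x y by (meson hnorm_nonneg mult_nonneg_nonneg power2_le_imp_le)
qed

lemma hnorm_square_add: "\<lbrakk>x \<in> carrier H; y \<in> carrier H\<rbrakk>
    \<Longrightarrow> (hnorm H (x \<oplus> y))\<^sup>2 = (hnorm H x)\<^sup>2 + 2 * Re (ip H x y) + (hnorm H y)\<^sup>2"
  using ip_cnj[of x y] by (simp add: hnorm_square ip_linear)

lemma hnorm_square_diff: "\<lbrakk>x \<in> carrier H; y \<in> carrier H\<rbrakk>
    \<Longrightarrow> (hnorm H (x \<ominus> y))\<^sup>2 = (hnorm H x)\<^sup>2 - 2 * Re (ip H x y) + (hnorm H y)\<^sup>2"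
  using ip_cnj[of x y] by (simp add: hnorm_square ip_linear)

lemma hnorm_triangle:
  assumes x: "x \<in> carrier H" and y: "y \<in> carrier H"
  shows "hnorm H (x \<oplus> y) \<le> hnorm H x + hnorm H y"
proof -
  have "Re (ip H x y) \<le> hnorm H x * hnorm H y"
    using cauchy_schwarz[OF x y] complex_Re_le_cmod order_trans by blast
  hence "(hnorm H (x \<oplus> y))\<^sup>2 \<le> (hnorm H x + hnorm H y)\<^sup>2"
    using x y by (simp add: hnorm_square_add power2_sum)
  thus ?thesis using x y by (meson add_nonneg_nonneg hnorm_nonneg power2_le_imp_le)
qed

lemma hnorm_diff_commute: "\<lbrakk>x \<in> carrier H; y \<in> carrier H\<rbrakk> \<Longrightarrow> hnorm H (x \<ominus> y) = hnorm H (y \<ominus> x)"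
  by (rule power2_eq_imp_eq) (use ip_cnj[of x y] in \<open>auto simp: hnorm_square_diff\<close>)

lemma hnorm_triangle_diff:
  assumes x: "x \<in> carrier H" and y: "y \<in> carrier H"
  shows "hnorm H x \<le> hnorm H (x \<ominus> y) + hnorm H y"
proof -
  have "x = (x \<ominus> y) \<oplus> y" using x y by (intro ip_eqI) (auto simp: ip_linear)
  thus ?thesis using hnorm_triangle[of "x \<ominus> y" y] x y by simp
qed

text \<open>The vectors form a carrier inside a type without topology, so norm convergence is
  spelled out; membership in the carrier is part of it.\<close>

definition hlim :: "(nat \<Rightarrow> 'v) \<Rightarrow> 'v \<Rightarrow> bool" where
  "hlim X x \<longleftrightarrow> (\<forall>n. X n \<in> carrier H) \<and> x \<in> carrier H \<and> (\<lambda>n. hnorm H (X n \<ominus> x)) \<longlonglongrightarrow> 0"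

lemma hlim_carrier: "hlim X x \<Longrightarrow> X n \<in> carrier H" "hlim X x \<Longrightarrow> x \<in> carrier H"
  by (simp_all add: hlim_def)

lemma hlim_ip: assumes "hlim X x" and y: "y \<in> carrier H" shows "(\<lambda>n. ip H (X n) y) \<longlonglongrightarrow> ip H x y"
proof -
  have X: "\<And>n. X n \<in> carrier H" "x \<in> carrier H" and l: "(\<lambda>n. hnorm H (X n \<ominus> x)) \<longlonglongrightarrow> 0"
    using assms(1) by (auto simp: hlim_def)
  have l': "(\<lambda>n. hnorm H (X n \<ominus> x) * hnorm H y) \<longlonglongrightarrow> 0"
    using tendsto_mult_right[OF l, of "hnorm H y"] by simp
  have "(\<lambda>n. ip H (X n) y - ip H x y) \<longlonglongrightarrow> 0"
    by (rule tendsto_0_le[OF l', of _ 1])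
       (use cauchy_schwarz[of "X n \<ominus> x" y for n] X y in \<open>simp add: ip_diff\<close>)
  thus ?thesis by (simp add: LIM_zero_iff)
qed

lemma hlim_hnorm: assumes "hlim X x" shows "(\<lambda>n. hnorm H (X n)) \<longlonglongrightarrow> hnorm H x"
proof -
  have X: "\<And>n. X n \<in> carrier H" "x \<in> carrier H" and l: "(\<lambda>n. hnorm H (X n \<ominus> x)) \<longlonglongrightarrow> 0"
    using assms(1) by (auto simp: hlim_def)
  have "\<bar>hnorm H (X n) - hnorm H x\<bar> \<le> hnorm H (X n \<ominus> x)" for n
    using hnorm_triangle_diff[of "X n" x] hnorm_triangle_diff[of x "X n"] 
      hnorm_diff_commute[of x "X n"] X by auto
  hence "(\<lambda>n. hnorm H (X n) - hnorm H x) \<longlonglongrightarrow> 0"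
    by (intro tendsto_0_le[OF l, of _ 1]) (simp add: X)
  thus ?thesis by (simp add: LIM_zero_iff)
qed

text \<open>A Cauchy criterion whose bound splits into one error per index. The projections in
  \<open>parseval\<close> and the maximizing sequence in \<open>maximizer_exists\<close> both give
  estimates of this shape.\<close>

lemma hlim_exists:
  assumes X: "\<And>n. X n \<in> carrier H" and le: "\<And>m n. (hnorm H (X m \<ominus> X n))\<^sup>2 \<le> h m + h n"
    and h: "h \<longlonglongrightarrow> 0"
  shows "\<exists>x. hlim X x"
proof -
  have "\<exists>N. \<forall>m\<ge>N. \<forall>n\<ge>N. hnorm H (X m \<ominus> X n) < e" if e: "0 < e" for e
  proof -
    have "\<forall>\<^sub>F n in sequentially. h n < e\<^sup>2 / 2" using h e by (intro order_tendstoD) auto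
    then obtain N where N: "\<And>n. n \<ge> N \<Longrightarrow> h n < e\<^sup>2 / 2" by (auto simp: eventually_sequentially)
    have "hnorm H (X m \<ominus> X n) < e" if "m \<ge> N" "n \<ge> N" for m n
    proof -
      have "(hnorm H (X m \<ominus> X n))\<^sup>2 < e\<^sup>2" using le[of m n] N[OF that(1)] N[OF that(2)] by linarith
      thus ?thesis using e by (simp add: power_less_imp_less_base)
    qed
    thus ?thesis by blast
  qed
  thus ?thesis using complete[of X] X by (auto simp: hlim_def)
qed

section \<open>Orthonormal sets and Parseval's identity\<close>

definition orthonormal :: "'v set \<Rightarrow> bool" where
  "orthonormal E \<longleftrightarrow> E \<subseteq> carrier H \<and> (\<forall>e\<in>E. \<forall>f\<in>E. ip H e f = (if e = f then 1 else 0))"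

lemma orthonormal_subset: "orthonormal E \<Longrightarrow> F \<subseteq> E \<Longrightarrow> orthonormal F"
  unfolding orthonormal_def by blast

lemma orthonormal_carrier: "orthonormal E \<Longrightarrow> b \<in> E \<Longrightarrow> b \<in> carrier H"
  by (auto simp: orthonormal_def)

lemma orthonormal_ip: "\<lbrakk>orthonormal E; b \<in> E; c \<in> E\<rbrakk> \<Longrightarrow> ip H b c = (if b = c then 1 else 0)"
  unfolding orthonormal_def by blast

lemma orthonormal_basis_imp_orthonormal: "orthonormal_basis H E \<Longrightarrow> orthonormal E"
  by (simp add: orthonormal_def orthonormal_basis_def)

lemma ip_finsum:
  assumes "finite F" "\<And>b. b \<in> F \<Longrightarrow> f b \<in> carrier H" "z \<in> carrier H"
  shows "ip H (\<Oplus>b\<in>F. f b) z = (\<Sum>b\<in>F. ip H (f b) z)"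
  using assms by (induction F rule: finite_induct) (auto simp: ip_add Pi_iff M.finsum_closed)

definition proj :: "'v set \<Rightarrow> 'v \<Rightarrow> 'v" where
  "proj F x = (\<Oplus>b\<in>F. ip H x b \<odot> b)"

lemma proj_carrier: "F \<subseteq> carrier H \<Longrightarrow> x \<in> carrier H \<Longrightarrow> proj F x \<in> carrier H"
  by (auto simp: proj_def intro!: M.finsum_closed)

lemma ip_proj:
  assumes "finite F" "F \<subseteq> carrier H" "x \<in> carrier H" "z \<in> carrier H"
  shows "ip H (proj F x) z = (\<Sum>b\<in>F. ip H x b * ip H b z)"
  unfolding proj_def using assms by (subst ip_finsum) (auto simp: ip_linear subset_iff)

lemma ip_mult_cnj: "\<lbrakk>x \<in> carrier H; b \<in> carrier H\<rbrakk> \<Longrightarrow> ip H x b * ip H b x = of_real ((cmod (ip H x b))\<^sup>2)"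
  using ip_cnj[of x b] complex_norm_square[of "ip H x b"] by simp

lemma ip_proj_orthonormal:
  assumes "orthonormal E" "finite F" "F \<subseteq> E" "x \<in> carrier H" "e \<in> E"
  shows "ip H (proj F x) e = (if e \<in> F then ip H x e else 0)"
proof -
  have *: "ip H b e = (if b = e then 1 else 0)" if "b \<in> F" for b
    using orthonormal_ip[OF assms(1) _ assms(5)] assms(3) that by blast
  have "ip H (proj F x) e = (\<Sum>b\<in>F. ip H x b * ip H b e)"
    using assms orthonormal_carrier by (intro ip_proj) auto
  also have "\<dots> = (\<Sum>b\<in>F. ip H x b * (if b = e then 1 else 0))"
    using * by (intro sum.cong) auto
  also have "\<dots> = (\<Sum>b\<in>F. if b = e then ip H x b else 0)"
    by (intro sum.cong) auto
  finally show ?thesis using assms by simp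
qed

lemma hnorm_diff_proj:
  assumes F: "finite F" "orthonormal F" and x: "x \<in> carrier H"
  shows "(hnorm H (x \<ominus> proj F x))\<^sup>2 = (hnorm H x)\<^sup>2 - (\<Sum>b\<in>F. (cmod (ip H x b))\<^sup>2)"
    and "(hnorm H (proj F x))\<^sup>2 = (\<Sum>b\<in>F. (cmod (ip H x b))\<^sup>2)"
proof -
  have Fc: "F \<subseteq> carrier H" using F by (simp add: orthonormal_def)
  note c = proj_carrier[OF Fc x]
  have *: "ip H (proj F x) x = of_real (\<Sum>b\<in>F. (cmod (ip H x b))\<^sup>2)"
    unfolding of_real_sum using Fc F x by (subst ip_proj) (auto intro!: sum.cong ip_mult_cnj simp del: of_real_power)
  have "ip H (proj F x) (proj F x) = (\<Sum>b\<in>F. ip H x b * cnj (ip H (proj F x) b))"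
    using Fc F x c by (subst ip_proj) (auto intro!: sum.cong ip_cnj)
  also have "\<dots> = of_real (\<Sum>b\<in>F. (cmod (ip H x b))\<^sup>2)"
    unfolding of_real_sum using F x by (intro sum.cong refl) (simp add: ip_proj_orthonormal[OF F(2) F(1)] complex_norm_square del: of_real_power)
  finally have **: "ip H (proj F x) (proj F x) = of_real (\<Sum>b\<in>F. (cmod (ip H x b))\<^sup>2)" .
  show 1: "(hnorm H (proj F x))\<^sup>2 = (\<Sum>b\<in>F. (cmod (ip H x b))\<^sup>2)"
    using c ** by (simp add: hnorm_square)
  show "(hnorm H (x \<ominus> proj F x))\<^sup>2 = (hnorm H x)\<^sup>2 - (\<Sum>b\<in>F. (cmod (ip H x b))\<^sup>2)"
    using * 1 x c ip_cnj[of "proj F x" x] by (simp add: hnorm_square_diff)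
qed

lemma bessel:
  assumes "finite F" "orthonormal F" "x \<in> carrier H"
  shows "(\<Sum>b\<in>F. (cmod (ip H x b))\<^sup>2) \<le> (hnorm H x)\<^sup>2"
  using hnorm_diff_proj(1)[OF assms] zero_le_power2[of "hnorm H (x \<ominus> proj F x)"] by linarith

text \<open>The right-hand side is the sum of \<open>f\<close> over the symmetric difference.
  Written this way, an upper bound for the union and lower bounds for \<open>F\<close> and
  \<open>G\<close> make the two projections close.\<close>

lemma hnorm_proj_diff:
  assumes E: "orthonormal E" and F: "finite F" "F \<subseteq> E" and G: "finite G" "G \<subseteq> E" and x: "x \<in> carrier H"
  defines "f \<equiv> \<lambda>b. (cmod (ip H x b))\<^sup>2"
  shows "(hnorm H (proj F x \<ominus> proj G x))\<^sup>2 = 2 * sum f (F \<union> G) - sum f F - sum f G"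
proof -
  have Ec: "E \<subseteq> carrier H" using E by (simp add: orthonormal_def)
  have c: "proj F x \<in> carrier H" "proj G x \<in> carrier H"
    using F G x Ec by (auto intro!: proj_carrier)
  have "ip H (proj F x) (proj G x) = (\<Sum>b\<in>F. ip H x b * cnj (ip H (proj G x) b))"
    using Ec F x c by (subst ip_proj) (auto intro!: sum.cong ip_cnj)
  also have "\<dots> = (\<Sum>b\<in>F. if b \<in> G then of_real (f b) else 0)"
  proof (intro sum.cong refl)
    fix b assume "b \<in> F"
    hence "b \<in> E" using F by blast
    from ip_proj_orthonormal[OF E G x this]
    show "ip H x b * cnj (ip H (proj G x) b) = (if b \<in> G then of_real (f b) else 0)"
      by (simp add: f_def complex_norm_square del: of_real_power)
  qed
  also have "\<dots> = of_real (\<Sum>b\<in>F. if b \<in> G then f b else 0)"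
    unfolding of_real_sum by (intro sum.cong) auto
  also have "(\<Sum>b\<in>F. if b \<in> G then f b else 0) = sum f (F \<inter> G)"
    using F by (simp add: sum.inter_restrict)
  finally have *: "Re (ip H (proj F x) (proj G x)) = sum f (F \<inter> G)" by simp
  have n: "(hnorm H (proj F x))\<^sup>2 = sum f F" "(hnorm H (proj G x))\<^sup>2 = sum f G"
    using hnorm_diff_proj(2) orthonormal_subset[OF E] F G x by (auto simp: f_def)
  have "sum f (F \<union> G) + sum f (F \<inter> G) = sum f F + sum f G"
    using F G by (simp add: sum.union_inter)
  thus ?thesis using c * n by (simp add: hnorm_square_diff)
qed

text \<open>A basis is defined by maximality, so the expansion of \<open>x\<close> has to come from
  completeness. Finite subsets whose sums approach the supremum \<open>S\<close> give a Cauchy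
  sequence of projections; its limit has the same coefficients as \<open>x\<close>, hence is
  \<open>x\<close>. The set \<open>E\<close> may be uncountable.\<close>

theorem parseval:
  assumes basis: "orthonormal_basis H E" and x: "x \<in> carrier H"
  shows "((\<lambda>e. (cmod (ip H x e))\<^sup>2) has_sum (hnorm H x)\<^sup>2) E"
proof -
  note E = orthonormal_basis_imp_orthonormal[OF basis]
  define f where "f = (\<lambda>b. (cmod (ip H x b))\<^sup>2)"
  define S where "S = (SUP F\<in>{F. finite F \<and> F \<subseteq> E}. sum f F)"
  have bes: "sum f F \<le> (hnorm H x)\<^sup>2" if "finite F" "F \<subseteq> E" for F
    using bessel[of F x] orthonormal_subset[OF E] that x by (simp add: f_def)
  have bdd: "bdd_above (sum f ` {F. finite F \<and> F \<subseteq> E})"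
    using bes by (intro bdd_aboveI) auto
  have fS: "(f has_sum S) E" unfolding S_def
    by (rule nonneg_bdd_above_has_sum) (use bdd in \<open>auto simp: f_def conj_commute\<close>)
  have le: "sum f F \<le> S" if "finite F" "F \<subseteq> E" for F
    unfolding S_def by (rule cSUP_upper) (use that bdd in auto)
  have "\<exists>F. finite F \<and> F \<subseteq> E \<and> S - inverse (real (Suc n)) < sum f F" for n
  proof -
    have "S - inverse (real (Suc n)) < S" by simp
    thus ?thesis unfolding S_def by (subst (asm) less_cSUP_iff) (use bdd in \<open>auto simp: S_def\<close>)
  qed
  then obtain F where F: "\<And>n. finite (F n)" "\<And>n. F n \<subseteq> E"
      and lt: "\<And>n. S - inverse (real (Suc n)) < sum f (F n)" by metis
  have Fo: "orthonormal (F n)" for n using orthonormal_subset[OF E F(2)] .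
  have c: "proj (F n) x \<in> carrier H" for n
    using Fo[of n] x by (auto intro!: proj_carrier simp: orthonormal_def)
  have d: "(hnorm H (proj (F m) x \<ominus> proj (F n) x))\<^sup>2 < inverse (real (Suc m)) + inverse (real (Suc n))" for m n
    using hnorm_proj_diff[OF E F F x, of m n, folded f_def] le[of "F m \<union> F n"] F lt[of m] lt[of n]
    by force
  have inv0: "(\<lambda>n. inverse (real (Suc n))) \<longlonglongrightarrow> 0" by (rule LIMSEQ_inverse_real_of_nat)
  have "\<exists>y. hlim (\<lambda>n. proj (F n) x) y"
    by (rule hlim_exists[OF c less_imp_le[OF d] inv0])
  then obtain y where y: "hlim (\<lambda>n. proj (F n) x) y" by blast
  have yc: "y \<in> carrier H" using hlim_carrier(2)[OF y] .
  have "ip H (x \<ominus> y) e = 0" if e: "e \<in> E" for e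
  proof -
    have ec: "e \<in> carrier H" using E e orthonormal_carrier by blast
    have "(cmod (ip H x e - ip H (proj (F n) x) e))\<^sup>2 \<le> inverse (real (Suc n))" for n
    proof (cases "e \<in> F n")
      case False
      \<comment> \<open>Inserting a missing \<open>e\<close> cannot lift the sum above
        \<open>S\<close>, so its coefficient is at most the gap left by \<open>F n\<close>.\<close>
      have "sum f (insert e (F n)) \<le> S" using F e by (intro le) auto
      hence "f e \<le> inverse (real (Suc n))" using False F lt[of n] by simp
      thus ?thesis using ip_proj_orthonormal[OF E F x e, of n] False by (simp add: f_def)
    qed (use ip_proj_orthonormal[OF E F x e, of n] in simp)
    hence "(\<lambda>n. (cmod (ip H x e - ip H (proj (F n) x) e))\<^sup>2) \<longlonglongrightarrow> 0"
      by (intro tendsto_0_le[OF inv0, of _ 1]) auto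
    hence "(\<lambda>n. ip H x e - ip H (proj (F n) x) e) \<longlonglongrightarrow> 0"
      using tendsto_real_sqrt[of "\<lambda>n. (cmod (ip H x e - ip H (proj (F n) x) e))\<^sup>2" 0 sequentially]
      by (simp add: tendsto_norm_zero_iff)
    moreover have "(\<lambda>n. ip H x e - ip H (proj (F n) x) e) \<longlonglongrightarrow> ip H x e - ip H y e"
      by (intro tendsto_intros hlim_ip[OF y ec])
    ultimately have "ip H x e - ip H y e = 0" using LIMSEQ_unique by blast
    thus ?thesis using x yc ec by (simp add: ip_diff)
  qed
  hence "x \<ominus> y = \<zero>" using basis x yc by (simp add: orthonormal_basis_def)
  hence "x = y" using x yc eq_if_diff_zero by blast
  hence "(\<lambda>n. (hnorm H (proj (F n) x))\<^sup>2) \<longlonglongrightarrow> (hnorm H x)\<^sup>2"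
    using hlim_hnorm[OF y] by (intro tendsto_power) simp
  hence l1: "(\<lambda>n. sum f (F n)) \<longlonglongrightarrow> (hnorm H x)\<^sup>2"
    using hnorm_diff_proj(2)[OF F(1) Fo x] by (simp add: f_def)
  have "(\<lambda>n. S - inverse (real (Suc n))) \<longlonglongrightarrow> S"
    using tendsto_diff[OF tendsto_const inv0, of S] by simp
  hence "(\<lambda>n. sum f (F n)) \<longlonglongrightarrow> S"
    by (rule tendsto_sandwich[OF _ _ _ tendsto_const, rotated 2])
       (use lt le F in \<open>auto intro!: always_eventually less_imp_le simp del: of_nat_Suc\<close>)
  hence "S = (hnorm H x)\<^sup>2" using l1 LIMSEQ_unique by blast
  thus ?thesis using fS by (simp add: f_def)
qed

text \<open>The remainder after a finite \<open>F\<close> is the inner product of \<open>x\<close>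
  minus its projection with \<open>y\<close>; by Cauchy-Schwarz and \<open>parseval\<close> it
  vanishes along the finite subsets.\<close>

theorem parseval_ip:
  assumes basis: "orthonormal_basis H E" and x: "x \<in> carrier H" and y: "y \<in> carrier H"
  shows "((\<lambda>e. ip H x e * ip H e y) has_sum ip H x y) E"
proof -
  note E = orthonormal_basis_imp_orthonormal[OF basis]
  define f where "f = (\<lambda>b. (cmod (ip H x b))\<^sup>2)"
  let ?A = "finite_subsets_at_top E"
  have "(sum f \<longlongrightarrow> (hnorm H x)\<^sup>2) ?A"
    using parseval[OF basis x] by (simp add: f_def has_sum_def)
  hence "((\<lambda>F. sqrt ((hnorm H x)\<^sup>2 - sum f F) * hnorm H y) \<longlongrightarrow> sqrt ((hnorm H x)\<^sup>2 - (hnorm H x)\<^sup>2) * hnorm H y) ?A"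
    by (intro tendsto_intros)
  hence l: "((\<lambda>F. sqrt ((hnorm H x)\<^sup>2 - sum f F) * hnorm H y) \<longlongrightarrow> 0) ?A" by simp
  have "((\<lambda>F. ip H x y - (\<Sum>e\<in>F. ip H x e * ip H e y)) \<longlongrightarrow> 0) ?A"
  proof (rule tendsto_0_le[OF l, of _ 1], rule eventually_finite_subsets_at_top_weakI)
    fix F assume F: "finite F" "F \<subseteq> E"
    have Fo: "orthonormal F" using orthonormal_subset[OF E F(2)] .
    hence Fc: "F \<subseteq> carrier H" by (simp add: orthonormal_def)
    note c = proj_carrier[OF Fc x]
    have "hnorm H (x \<ominus> proj F x) = sqrt ((hnorm H x)\<^sup>2 - sum f F)"
      using hnorm_diff_proj(1)[OF F(1) Fo x] c x by (simp add: f_def real_sqrt_unique)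
    moreover have "ip H x y - (\<Sum>e\<in>F. ip H x e * ip H e y) = ip H (x \<ominus> proj F x) y"
      using x y c ip_proj[OF F(1) Fc x y] by (simp add: ip_diff)
    ultimately show "norm (ip H x y - (\<Sum>e\<in>F. ip H x e * ip H e y)) \<le> norm (sqrt ((hnorm H x)\<^sup>2 - sum f F) * hnorm H y) * 1"
      using cauchy_schwarz[of "x \<ominus> proj F x" y] x y c by simp
  qed
  hence "((\<lambda>F. ip H x y - (ip H x y - (\<Sum>e\<in>F. ip H x e * ip H e y))) \<longlongrightarrow> ip H x y - 0) ?A"
    by (intro tendsto_diff tendsto_const)
  thus ?thesis by (simp add: has_sum_def)
qed

section \<open>Bounded and self-adjoint operators\<close>

lemma bounded_opD:
  assumes "bounded_op H A"
  shows "x \<in> carrier H \<Longrightarrow> A x \<in> carrier H"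
    and "x \<in> carrier H \<Longrightarrow> y \<in> carrier H \<Longrightarrow> A (x \<oplus> y) = A x \<oplus> A y"
    and "x \<in> carrier H \<Longrightarrow> A (c \<odot> x) = c \<odot> A x"
    and "A \<in> extensional (carrier H)"
  using assms by (auto simp: bounded_op_def PiE_def)

lemma bounded_op_diff:
  assumes "bounded_op H A" "x \<in> carrier H" "y \<in> carrier H"
  shows "A (x \<ominus> y) = A x \<ominus> A y"
  using assms bounded_opD[OF assms(1)] by (simp add: diff_eq)

lemma bounded_op_zero: "bounded_op H A \<Longrightarrow> A \<zero> = \<zero>"
  by (metis bounded_opD(1,3) zero_eq_smult M.zero_closed)

lemma bounded_op_bound:
  assumes "bounded_op H A"
  obtains K where "0 < K" "\<And>x. x \<in> carrier H \<Longrightarrow> hnorm H (A x) \<le> K * hnorm H x"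
proof -
  obtain K where K: "\<And>x. x \<in> carrier H \<Longrightarrow> hnorm H (A x) \<le> K * hnorm H x"
    using assms unfolding bounded_op_def by blast
  have "hnorm H (A x) \<le> max K 1 * hnorm H x" if "x \<in> carrier H" for x
    using K[OF that] mult_right_mono[of K "max K 1" "hnorm H x"] that by force
  thus ?thesis using that[of "max K 1"] by simp
qed

lemma bounded_op_hlim:
  assumes "bounded_op H A" "hlim X x"
  shows "hlim (\<lambda>n. A (X n)) (A x)"
proof -
  note X = hlim_carrier[OF assms(2)]
  obtain K where K: "0 < K" "\<And>x. x \<in> carrier H \<Longrightarrow> hnorm H (A x) \<le> K * hnorm H x"
    using bounded_op_bound[OF assms(1)] by blast
  have "(\<lambda>n. hnorm H (A (X n) \<ominus> A x)) \<longlonglongrightarrow> 0"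
  proof (rule tendsto_0_le[of "\<lambda>n. hnorm H (X n \<ominus> x)" _ _ K])
    show "(\<lambda>n. hnorm H (X n \<ominus> x)) \<longlonglongrightarrow> 0" using assms(2) by (simp add: hlim_def)
    show "\<forall>\<^sub>F n in sequentially. norm (hnorm H (A (X n) \<ominus> A x)) \<le> norm (hnorm H (X n \<ominus> x)) * K"
      using K(2)[of "X n \<ominus> x" for n] X bounded_op_diff[OF assms(1), of "X n" x for n] 
        bounded_opD(1)[OF assms(1)]
      by (auto simp: mult.commute)
  qed
  thus ?thesis using X bounded_opD(1)[OF assms(1)] by (simp add: hlim_def)
qed

lemma self_adjointD:
  assumes "self_adjoint H A"
  shows "bounded_op H A"
    and "x \<in> carrier H \<Longrightarrow> A x \<in> carrier H"
    and "x \<in> carrier H \<Longrightarrow> y \<in> carrier H \<Longrightarrow> ip H (A x) y = ip H x (A y)"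
  using assms bounded_opD(1) by (auto simp: self_adjoint_def)

lemma self_adjoint_op_diff:
  assumes A: "self_adjoint H A" and B: "self_adjoint H B"
  shows "self_adjoint H (op_diff H A B)"
proof -
  note a = self_adjointD[OF A] and b = self_adjointD[OF B]
  obtain K L where K: "0 < K" "\<And>x. x \<in> carrier H \<Longrightarrow> hnorm H (A x) \<le> K * hnorm H x"
    and L: "0 < L" "\<And>x. x \<in> carrier H \<Longrightarrow> hnorm H (B x) \<le> L * hnorm H x"
    using bounded_op_bound a(1) b(1) by metis
  have n: "hnorm H (A x \<ominus> B x) \<le> (K + L) * hnorm H x" if x: "x \<in> carrier H" for x
    using hnorm_triangle[of "A x" "(-1) \<odot> B x"] a(2)[OF x] b(2)[OF x] K(2)[OF x] L(2)[OF x]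
    by (simp add: diff_eq hnorm_smult algebra_simps)
  have "A (x \<oplus> y) \<ominus> B (x \<oplus> y) = (A x \<ominus> B x) \<oplus> (A y \<ominus> B y)" if "x \<in> carrier H" "y \<in> carrier H" for x y
    using that a(2) b(2) bounded_opD(2)[OF a(1) that] bounded_opD(2)[OF b(1) that]
    by (intro ip_eqI) (auto simp: ip_linear)
  moreover have "A (c \<odot> x) \<ominus> B (c \<odot> x) = c \<odot> (A x \<ominus> B x)" if "x \<in> carrier H" for x c
    using that a(2) b(2) bounded_opD(3)[OF a(1) that] bounded_opD(3)[OF b(1) that]
    by (intro ip_eqI) (auto simp: ip_linear algebra_simps)
  ultimately show ?thesis unfolding self_adjoint_def bounded_op_def 
    using a(2,3) b(2,3) n by (auto simp: op_diff_def ip_linear intro!: exI[of _ "K + L"])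
qed

section \<open>Diagonal operators and their trace norm\<close>

definition diagonal_in :: "'v set \<Rightarrow> ('v \<Rightarrow> real) \<Rightarrow> ('v \<Rightarrow> 'v) \<Rightarrow> bool" where
  "diagonal_in B a A \<longleftrightarrow> self_adjoint H A \<and> orthonormal_basis H B
     \<and> (\<forall>b\<in>B. A b = complex_of_real (a b) \<odot> b)"

lemma diagonal_inD:
  assumes "diagonal_in B a A"
  shows "self_adjoint H A" "orthonormal_basis H B" "B \<subseteq> carrier H"
    and "b \<in> B \<Longrightarrow> A b = complex_of_real (a b) \<odot> b"
  using assms by (auto simp: diagonal_in_def orthonormal_basis_def)

text \<open>Self-adjointness moves \<open>A\<close> onto the eigenvector \<open>b\<close>; thus a
  condition on \<open>B\<close> alone controls \<open>A\<close> on all vectors.\<close>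

lemma diagonal_in_coeff:
  assumes "diagonal_in B a A" "x \<in> carrier H" "b \<in> B"
  shows "ip H (A x) b = a b * ip H x b"
  using self_adjointD(3)[OF diagonal_inD(1)[OF assms(1)], of x b] diagonal_inD(3,4)[OF assms(1)] assms(2,3)
  by (auto simp: ip_linear subset_iff)

lemma diagonal_in_ip:
  assumes "diagonal_in B a A" and x: "x \<in> carrier H" and y: "y \<in> carrier H"
  shows "((\<lambda>b. a b * (ip H x b * ip H b y)) has_sum ip H (A x) y) B"
proof -
  note d = diagonal_inD[OF assms(1)]
  have "((\<lambda>b. ip H (A x) b * ip H b y) has_sum ip H (A x) y) B"
    by (rule parseval_ip[OF d(2) self_adjointD(2)[OF d(1) x] y])
  thus ?thesis
    by (rule has_sum_cong[THEN iffD1, rotated]) (simp add: diagonal_in_coeff[OF assms(1) x])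
qed

lemma diagonal_in_ip_square:
  assumes "diagonal_in B a A" and x: "x \<in> carrier H" and y: "y \<in> carrier H"
  shows "((\<lambda>b. complex_of_real ((a b)\<^sup>2) * (ip H x b * ip H b y)) has_sum ip H (A x) (A y)) B"
proof -
  note d = diagonal_inD[OF assms(1)]
  have Ax: "A x \<in> carrier H" using self_adjointD(2)[OF d(1) x] .
  have "((\<lambda>b. a b * (ip H (A x) b * ip H b y)) has_sum ip H (A (A x)) y) B"
    by (rule diagonal_in_ip[OF assms(1) Ax y])
  hence "((\<lambda>b. complex_of_real ((a b)\<^sup>2) * (ip H x b * ip H b y)) has_sum ip H (A (A x)) y) B"
    by (rule has_sum_cong[THEN iffD1, rotated]) (simp add: diagonal_in_coeff[OF assms(1) x] power2_eq_square)
  thus ?thesis using self_adjointD(3)[OF d(1) Ax y] by simp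
qed

lemma diagonal_in_quadratic:
  assumes "diagonal_in B a A" and x: "x \<in> carrier H"
  shows "((\<lambda>b. a b * (cmod (ip H x b))\<^sup>2) has_sum Re (ip H (A x) x)) B"
proof -
  have "((\<lambda>b. Re (a b * (ip H x b * ip H b x))) has_sum Re (ip H (A x) x)) B"
    by (intro has_sum_Re diagonal_in_ip assms)
  thus ?thesis
  proof (rule has_sum_cong[THEN iffD1, rotated])
    fix b assume "b \<in> B"
    hence "b \<in> carrier H" using diagonal_inD(3)[OF assms(1)] by blast
    thus "Re (a b * (ip H x b * ip H b x)) = a b * (cmod (ip H x b))\<^sup>2"
      by (simp only: ip_mult_cnj[OF x] of_real_mult[symmetric] Re_complex_of_real)
  qed
qed

lemma diagonal_in_commuting:
  assumes A: "diagonal_in B a A" and A': "diagonal_in B a' A'"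
  shows "commuting H A A'"
  unfolding commuting_def
proof
  fix x assume x: "x \<in> carrier H"
  note d = diagonal_inD[OF A] and d' = diagonal_inD[OF A']
  note c = self_adjointD(2)[OF d(1)] self_adjointD(2)[OF d'(1)]
  show "A (A' x) = A' (A x)"
  proof (rule ip_eqI)
    fix z assume z: "z \<in> carrier H"
    have 1: "((\<lambda>b. a b * (ip H (A' x) b * ip H b z)) has_sum ip H (A (A' x)) z) B"
      by (rule diagonal_in_ip[OF A c(2)[OF x] z])
    have 2: "((\<lambda>b. a' b * (ip H (A x) b * ip H b z)) has_sum ip H (A' (A x)) z) B"
      by (rule diagonal_in_ip[OF A' c(1)[OF x] z])
    have "a b * (ip H (A' x) b * ip H b z) = a' b * (ip H (A x) b * ip H b z)" if "b \<in> B" for b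
      using that by (simp add: diagonal_in_coeff[OF A x] diagonal_in_coeff[OF A' x])
    from has_sum_cong[THEN iffD1, OF this 1] show "ip H (A (A' x)) z = ip H (A' (A x)) z"
      using 2 has_sum_unique by blast
  qed (use x c in auto)
qed

lemma diagonal_in_op_diff:
  assumes "diagonal_in B a A" "diagonal_in B a' A'"
  shows "diagonal_in B (\<lambda>b. a b - a' b) (op_diff H A A')"
proof -
  note d = diagonal_inD[OF assms(1)] and d' = diagonal_inD[OF assms(2)]
  have "complex_of_real (a b) \<odot> b \<ominus> complex_of_real (a' b) \<odot> b = complex_of_real (a b - a' b) \<odot> b" if "b \<in> B" for b
    using d(3) that by (intro ip_eqI) (auto simp: ip_linear algebra_simps)
  thus ?thesis using d d' self_adjoint_op_diff[OF d(1) d'(1)]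
    by (auto simp: diagonal_in_def op_diff_def)
qed

lemma diagonal_in_abs:
  assumes T: "diagonal_in B t T" and P: "diagonal_in B (\<lambda>b. \<bar>t b\<bar>) P"
  shows "is_abs_op H T P"
proof -
  note d = diagonal_inD[OF T] and d' = diagonal_inD[OF P]
  note c = self_adjointD(2)[OF d(1)] self_adjointD(2)[OF d'(1)]
  have "0 \<le> ip H (P x) x" if x: "x \<in> carrier H" for x
  proof -
    have "0 \<le> Re (ip H (P x) x)"
      by (rule has_sum_nonneg[OF diagonal_in_quadratic[OF P x]]) simp
    \<comment> \<open>The order on complex numbers requires a vanishing imaginary part, which
      self-adjointness supplies.\<close>
    moreover have "Im (ip H (P x) x) = Im (cnj (ip H (P x) x))"
      using ip_cnj[of "P x" x] self_adjointD(3)[OF d'(1) x x] c(2)[OF x] x by simp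
    ultimately show ?thesis by (simp add: less_eq_complex_def)
  qed
  moreover have "ip H (P (P x)) y = ip H (T x) (T y)" if x: "x \<in> carrier H" and y: "y \<in> carrier H" for x y
  proof -
    show ?thesis
      using diagonal_in_ip_square[OF P x y] diagonal_in_ip_square[OF T x y]
        self_adjointD(3)[OF d'(1) c(2)[OF x] y]
      by (simp add: has_sum_unique)
  qed
  ultimately show ?thesis using d'(1) by (simp add: is_abs_op_def positive_op_def)
qed

text \<open>This is the uniqueness of |T| on eigenvectors. With p = |t| one has P^2 x = p^2 x, so v
  = (P - p) x satisfies P v = -p v, and positivity forces p ||v||^2 = 0. If t = 0, then ||P x||^2 =
  <P^2 x, x> = 0.\<close>

lemma is_abs_op_eigenvector:
  assumes T: "self_adjoint H T" and P: "is_abs_op H T P" and x: "x \<in> carrier H" 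
    and Tx: "T x = complex_of_real t \<odot> x"
  shows "P x = complex_of_real \<bar>t\<bar> \<odot> x"
proof -
  let ?p = "complex_of_real \<bar>t\<bar>"
  have sP: "self_adjoint H P" and pos: "\<And>x. x \<in> carrier H \<Longrightarrow> 0 \<le> ip H (P x) x"
    and PP: "\<And>x y. x \<in> carrier H \<Longrightarrow> y \<in> carrier H \<Longrightarrow> ip H (P (P x)) y = ip H (T x) (T y)"
    using P by (auto simp: is_abs_op_def positive_op_def)
  note p = self_adjointD[OF sP] and q = self_adjointD[OF T]
  have sq: "?p * ?p = complex_of_real t * complex_of_real t"
    by (simp flip: of_real_mult)
  have PPx: "P (P x) = (?p * ?p) \<odot> x"
  proof (rule ip_eqI)
    fix y assume y: "y \<in> carrier H"
    have "ip H (P (P x)) y = complex_of_real t * ip H x (T y)"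
      using PP[OF x y] x y q(2) by (simp add: Tx ip_linear)
    also have "ip H x (T y) = complex_of_real t * ip H x y"
      using q(3)[OF x y] x y by (simp add: Tx ip_linear)
    finally show "ip H (P (P x)) y = ip H ((?p * ?p) \<odot> x) y" 
      unfolding sq using x y by (simp add: ip_linear mult.assoc)
  qed (use x p in auto)
  define v where "v = P x \<ominus> ?p \<odot> x"
  have v: "v \<in> carrier H" using x p by (simp add: v_def)
  have Pv: "P v = (- ?p) \<odot> v"
  proof -
    have "P v = (?p * ?p) \<odot> x \<ominus> ?p \<odot> P x"
      using x p(2) by (simp add: v_def bounded_op_diff[OF p(1)] bounded_opD(3)[OF p(1)] PPx)
    also have "\<dots> = (- ?p) \<odot> v"
      using x p(2) by (intro ip_eqI) (auto simp: v_def ip_linear algebra_simps)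
    finally show ?thesis .
  qed
  have "ip H (P v) v = of_real (- \<bar>t\<bar> * (hnorm H v)\<^sup>2)"
    using v ip_self[OF v] by (simp add: Pv ip_linear)
  hence "0 \<le> - \<bar>t\<bar> * (hnorm H v)\<^sup>2" using pos[OF v] by (simp add: less_eq_complex_def)
  moreover have "0 \<le> \<bar>t\<bar> * (hnorm H v)\<^sup>2" by simp
  ultimately have "\<bar>t\<bar> * (hnorm H v)\<^sup>2 = 0" by linarith
  hence "t = 0 \<or> v = \<zero>" using v by (simp add: hnorm_eq_0)
  thus ?thesis
  proof
    assume "v = \<zero>" thus ?thesis using x p by (simp add: v_def)
  next
    assume t: "t = 0"
    have "ip H (P x) (P x) = ip H (P (P x)) x" using p(3)[OF p(2)[OF x] x] by simp
    also have "\<dots> = 0" using t x by (simp add: PPx ip_linear)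
    finally have "P x = \<zero>" using x p ip_definite by blast
    thus ?thesis using t x zero_eq_smult[OF x, symmetric] by simp
  qed
qed

text \<open>The trace of a diagonal operator does not depend on the basis: expand
  \<open>\<langle>P e, e\<rangle>\<close> in the eigenbasis and interchange the summations.\<close>

lemma trace_eq_sum_eigenvalues:
  assumes P: "diagonal_in B p P" and p: "\<And>b. b \<in> B \<Longrightarrow> 0 \<le> p b" 
    and E: "orthonormal_basis H E" and r: "((\<lambda>e. Re (ip H (P e) e)) has_sum r) E"
  shows "(p has_sum r) B"
proof -
  let ?f = "\<lambda>(e, b). p b * (cmod (ip H e b))\<^sup>2"
  have Ec: "E \<subseteq> carrier H" "B \<subseteq> carrier H" using E P by (auto simp: diagonal_in_def orthonormal_basis_def)
  have 1: "((\<lambda>b. ?f (e, b)) has_sum Re (ip H (P e) e)) B" if "e \<in> E" for e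
    using diagonal_in_quadratic[OF P, of e] that Ec by auto
  have "?f summable_on E \<times> B"
    by (rule summable_on_SigmaI[OF 1]) (use r p in \<open>auto simp: summable_on_def\<close>)
  with 1 r have "(?f has_sum r) (E \<times> B)"
    by (intro has_sum_SigmaI[where f = ?f and g = "\<lambda>e. Re (ip H (P e) e)"])
  hence "((\<lambda>(b, e). p b * (cmod (ip H e b))\<^sup>2) has_sum r) (B \<times> E)"
    by (subst (asm) has_sum_swap) simp
  moreover have "((\<lambda>e. p b * (cmod (ip H e b))\<^sup>2) has_sum p b) E" if b: "b \<in> B" for b
  proof -
    have bc: "b \<in> carrier H" using b Ec by blast
    have "hnorm H b = 1" using P b by (auto simp: diagonal_in_def orthonormal_basis_def hnorm_def)
    hence "((\<lambda>e. p b * (cmod (ip H b e))\<^sup>2) has_sum p b) E"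
      using has_sum_cmult_right[OF parseval[OF E bc], of "p b"] by simp
    moreover have "cmod (ip H b e) = cmod (ip H e b)" if "e \<in> E" for e
      using ip_cnj[OF bc, of e] Ec that by auto
    ultimately show ?thesis by (simp cong: has_sum_cong)
  qed
  ultimately show ?thesis
    by (intro has_sum_SigmaD[where A = B and B = "\<lambda>_. E" and g = p
          and f = "\<lambda>(b, e). p b * (cmod (ip H e b))\<^sup>2"]) auto
qed

lemma is_abs_op_diagonal:
  assumes "diagonal_in B a A" "is_abs_op H A P"
  shows "diagonal_in B (\<lambda>b. \<bar>a b\<bar>) P"
  using is_abs_op_eigenvector[OF diagonal_inD(1)[OF assms(1)] assms(2)] diagonal_inD[OF assms(1)] assms(2)
  by (auto simp: diagonal_in_def is_abs_op_def positive_op_def)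

lemma has_trace_norm_diagonal:
  assumes T: "diagonal_in B t T" and r: "has_trace_norm H T r"
  shows "((\<lambda>b. \<bar>t b\<bar>) has_sum r) B"
proof -
  obtain P E where P: "is_abs_op H T P" and E: "orthonormal_basis H E"
    and s: "((\<lambda>e. Re (ip H (P e) e)) has_sum r) E"
    using r by (auto simp: has_trace_norm_def)
  have "diagonal_in B (\<lambda>b. \<bar>t b\<bar>) P" by (rule is_abs_op_diagonal[OF T P])
  thus ?thesis by (rule trace_eq_sum_eigenvalues[OF _ _ E s]) simp
qed

text \<open>That the entries |t b| come from a bounded operator \<open>P\<close> is left to the
  caller, who takes \<open>P\<close> from a finite-rank operator or from the |A| that trace class
  provides. The uniqueness demanded by the definite description is
  \<open>has_trace_norm_diagonal\<close>.\<close>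

lemma trace_norm_diagonal:
  assumes T: "diagonal_in B t T" and P: "diagonal_in B (\<lambda>b. \<bar>t b\<bar>) P" 
    and r: "((\<lambda>b. \<bar>t b\<bar>) has_sum r) B"
  shows "trace_class H T" "trace_norm H T = r"
proof -
  have B: "orthonormal_basis H B" using T by (simp add: diagonal_in_def)
  have "Re (ip H (P b) b) = \<bar>t b\<bar>" if "b \<in> B" for b
    using diagonal_inD[OF P] that B by (auto simp: orthonormal_basis_def ip_linear subset_iff)
  hence "((\<lambda>b. Re (ip H (P b) b)) has_sum r) B" using r by (simp cong: has_sum_cong)
  hence h: "has_trace_norm H T r" 
    unfolding has_trace_norm_def using diagonal_in_abs[OF T P] B by blast
  thus "trace_class H T"
    using T by (auto simp: trace_class_def diagonal_in_def self_adjoint_def)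
  show "trace_norm H T = r" unfolding trace_norm_def
    using h has_trace_norm_diagonal[OF T] r by (metis (no_types, lifting) has_sum_unique the_equality)
qed

end

section \<open>The spectral theorem for commuting trace-class operators\<close>

lemma finite_family_convergent_subseq:
  fixes f :: "'i \<Rightarrow> nat \<Rightarrow> 'b :: heine_borel"
  assumes "finite F" "\<And>e. e \<in> F \<Longrightarrow> bounded (range (f e))"
  shows "\<exists>r::nat\<Rightarrow>nat. strict_mono r \<and> (\<forall>e\<in>F. convergent (\<lambda>n. f e (r n)))"
  using assms
proof (induction F rule: finite_induct)
  case empty
  show ?case by (intro exI[of _ id]) (simp add: strict_mono_def)
next
  case (insert e F)
  then obtain r :: "nat \<Rightarrow> nat" where r: "strict_mono r" "\<And>e. e \<in> F \<Longrightarrow> convergent (\<lambda>n. f e (r n))" by auto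
  have "bounded (range (f e \<circ> r))"
    using insert.prems[of e] by (auto intro: bounded_subset)
  then obtain l s where s: "strict_mono s" "((f e \<circ> r) \<circ> s) \<longlonglongrightarrow> l"
    using bounded_imp_convergent_subsequence by blast
  have "convergent (\<lambda>n. f e' ((r \<circ> s) n))" if "e' \<in> insert e F" for e'
  proof (cases "e' = e")
    case True
    thus ?thesis using s(2) by (auto simp: convergent_def o_def)
  next
    case False
    thus ?thesis using that r(2)[of e'] convergent_subseq_convergent[OF _ s(1), of "\<lambda>n. f e' (r n)"]
      by (auto simp: o_def)
  qed
  thus ?case using strict_mono_o[OF r(1) s(1)] by blast
qed

lemma finite_family_convergent_subseq_complex:
  fixes f :: "'i \<Rightarrow> nat \<Rightarrow> complex"
  assumes "finite F" "\<And>e. e \<in> F \<Longrightarrow> bounded (range (f e))"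
  shows "\<exists>r::nat\<Rightarrow>nat. strict_mono r \<and> (\<forall>e\<in>F. convergent (\<lambda>n. f e (r n)))"
proof -
  \<comment> \<open>The Boolean selects real or imaginary part, so that one subsequence serves both
    for every index in \<open>F\<close>.\<close>
  define g where "g = (\<lambda>(e, i) n. if i then Re (f e n) else Im (f e n))"
  have "bounded (range (g p))" if p: "p \<in> F \<times> UNIV" for p
  proof -
    obtain e i where ei: "p = (e, i)" by (cases p)
    obtain K where K: "\<And>n. cmod (f e n) \<le> K"
      using assms(2)[of e] p ei by (auto simp: bounded_iff)
    have "\<bar>g p n\<bar> \<le> cmod (f e n)" for n
      using abs_Re_le_cmod[of "f e n"] abs_Im_le_cmod[of "f e n"] by (simp add: g_def ei)
    hence "\<bar>g p n\<bar> \<le> K" for n using K order_trans by blast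
    thus ?thesis by (auto simp: bounded_iff)
  qed
  then obtain r :: "nat \<Rightarrow> nat" where r: "strict_mono r" "\<forall>p\<in>F \<times> UNIV. convergent (\<lambda>n. g p (r n))"
    using finite_family_convergent_subseq[of "F \<times> UNIV" g] assms(1) by auto
  have "convergent (\<lambda>n. f e (r n))" if "e \<in> F" for e
  proof -
    have "convergent (\<lambda>n. g (e, True) (r n))" "convergent (\<lambda>n. g (e, False) (r n))"
      using r(2) that by auto
    then obtain a b where "(\<lambda>n. Re (f e (r n))) \<longlonglongrightarrow> a" "(\<lambda>n. Im (f e (r n))) \<longlonglongrightarrow> b"
      by (auto simp: convergent_def g_def)
    hence "(\<lambda>n. f e (r n)) \<longlonglongrightarrow> Complex a b"
      using tendsto_Complex by fastforce
    thus ?thesis by (auto simp: convergent_def)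
  qed
  thus ?thesis using r(1) by blast
qed

lemma norm_square_diff_le: "(norm (a - b))\<^sup>2 \<le> 2 * (norm (a - c))\<^sup>2 + 2 * (norm (b - c))\<^sup>2"
  for a b c :: "'b :: real_normed_vector"
proof -
  have "norm (a - b) \<le> norm (a - c) + norm (b - c)"
    using norm_triangle_ineq4[of "a - c" "b - c"] by simp
  hence "(norm (a - b))\<^sup>2 \<le> (norm (a - c) + norm (b - c))\<^sup>2" by (intro power_mono) auto
  also have "\<dots> \<le> 2 * (norm (a - c))\<^sup>2 + 2 * (norm (b - c))\<^sup>2"
    using zero_le_power2[of "norm (a - c) - norm (b - c)"] by (simp add: power2_sum power2_diff)
  finally show ?thesis .
qed

lemma summable_small_tail:
  fixes f :: "'i \<Rightarrow> real"
  assumes "f summable_on E" "0 < d"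
  obtains F where "finite F" "F \<subseteq> E" "\<bar>infsum f (E - F)\<bar> < d"
proof -
  have "(sum f \<longlongrightarrow> infsum f E) (finite_subsets_at_top E)" by (rule infsum_tendsto[OF assms(1)])
  hence "\<forall>\<^sub>F F in finite_subsets_at_top E. dist (sum f F) (infsum f E) < d"
    using assms(2) tendstoD by blast
  then obtain F where F: "finite F" "F \<subseteq> E" "dist (sum f F) (infsum f E) < d"
    by (auto simp: eventually_finite_subsets_at_top)
  have "infsum f (F \<union> (E - F)) = sum f F + infsum f (E - F)"
    using F summable_on_subset_banach[OF assms(1), of "E - F"] by (subst infsum_Un_disjoint) auto
  moreover have "F \<union> (E - F) = E" using F by blast
  ultimately show ?thesis using that F by (simp add: dist_real_def)
qed

context hilbert_space
begin

text \<open>For P = |A| with bound \<open>K\<close> one has P^2 <= K P, hence ||A x||^2 = <P^2 x, x>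
  <= K <P x, x>, and the right side is summable over the basis that witnesses the trace
  norm.\<close>

lemma trace_class_hilbert_schmidt:
  assumes A: "self_adjoint H A" "trace_class H A"
  obtains E where "orthonormal_basis H E" "(\<lambda>e. (hnorm H (A e))\<^sup>2) summable_on E"
proof -
  obtain P E r where P: "is_abs_op H A P" and E: "orthonormal_basis H E" 
    and r: "((\<lambda>e. Re (ip H (P e) e)) has_sum r) E"
    using A(2) by (auto simp: trace_class_def has_trace_norm_def)
  have sP: "self_adjoint H P" and pos: "\<And>x. x \<in> carrier H \<Longrightarrow> 0 \<le> ip H (P x) x"
    and PP: "\<And>x y. x \<in> carrier H \<Longrightarrow> y \<in> carrier H \<Longrightarrow> ip H (P (P x)) y = ip H (A x) (A y)"
    using P by (auto simp: is_abs_op_def positive_op_def)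
  note p = self_adjointD[OF sP] and a = self_adjointD[OF A(1)]
  obtain K where K: "0 < K" "\<And>x. x \<in> carrier H \<Longrightarrow> hnorm H (P x) \<le> K * hnorm H x"
    using bounded_op_bound[OF p(1)] by blast
  have le: "(hnorm H (A x))\<^sup>2 \<le> K * Re (ip H (P x) x)" if x: "x \<in> carrier H" for x
  proof -
    define n where "n = (hnorm H (P x))\<^sup>2"
    \<comment> \<open>Positivity of \<open>P\<close> at x - t P x gives 0 <= <P x, x> - 2 t n + t^2
      K n; the value 1 / K minimizes the right-hand side.\<close>
    define t where "t = 1 / K"
    define y where "y = x \<ominus> complex_of_real t \<odot> P x"
    have c: "P x \<in> carrier H" "P (P x) \<in> carrier H" "y \<in> carrier H" using x p by (auto simp: y_def)
    have n1: "Re (ip H (P x) (P x)) = n" using c by (simp add: n_def hnorm_square)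
    have n2: "Re (ip H (P (P x)) x) = n" using p(3)[OF c(1) x] n1 by simp
    have n3: "Re (ip H (P (P x)) (P x)) \<le> K * n"
    proof -
      have "Re (ip H (P (P x)) (P x)) \<le> hnorm H (P (P x)) * hnorm H (P x)"
        using cauchy_schwarz[OF c(2,1)] complex_Re_le_cmod order_trans by blast
      also have "\<dots> \<le> K * hnorm H (P x) * hnorm H (P x)"
        using K(2)[OF c(1)] c by (intro mult_right_mono) auto
      finally show ?thesis by (simp add: n_def power2_eq_square mult.assoc)
    qed
    have "P y = P x \<ominus> complex_of_real t \<odot> P (P x)"
      using x c by (simp add: y_def bounded_op_diff[OF p(1)] bounded_opD(3)[OF p(1)])
    hence "Re (ip H (P y) y) = Re (ip H (P x) x) - 2 * t * n + t * t * Re (ip H (P (P x)) (P x))"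
      using x c n1 n2 by (simp add: y_def ip_linear algebra_simps)
    moreover have "t * t * Re (ip H (P (P x)) (P x)) \<le> t * t * (K * n)"
      by (intro mult_left_mono n3) simp
    moreover have "t * t * (K * n) = t * n" using K(1) by (simp add: t_def)
    moreover have "0 \<le> Re (ip H (P y) y)" using pos[OF c(3)] by (simp add: less_eq_complex_def)
    ultimately have "t * n \<le> Re (ip H (P x) x)" by linarith
    hence "n \<le> K * Re (ip H (P x) x)" using K(1) by (simp add: t_def field_simps)
    moreover have "n = (hnorm H (A x))\<^sup>2"
      using PP[OF x x] n2 a(2)[OF x] by (simp add: hnorm_square)
    ultimately show ?thesis by simp
  qed
  have "(\<lambda>e. K * Re (ip H (P e) e)) summable_on E"
    using has_sum_cmult_right[OF r] summable_on_def by blast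
  hence "(\<lambda>e. (hnorm H (A e))\<^sup>2) summable_on E"
    by (rule summable_on_comparison_test) (use le E in \<open>auto simp: orthonormal_basis_def\<close>)
  thus ?thesis using that E by blast
qed

text \<open>The substitute for compactness: up to a small multiple of ||y||^2, finitely many
  functionals y |-> <y, A e> control ||A y||. It is Parseval for A y together with <A y, e> = <y, A
  e>, the tail being estimated by Cauchy-Schwarz.\<close>

lemma hilbert_schmidt_tail_bound:
  assumes A: "self_adjoint H A" and E: "orthonormal_basis H E" 
    and s: "(\<lambda>e. (hnorm H (A e))\<^sup>2) summable_on E" and F: "finite F" "F \<subseteq> E" and y: "y \<in> carrier H"
  shows "(hnorm H (A y))\<^sup>2 \<le> (\<Sum>e\<in>F. (cmod (ip H y (A e)))\<^sup>2)
           + (hnorm H y)\<^sup>2 * infsum (\<lambda>e. (hnorm H (A e))\<^sup>2) (E - F)"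
proof -
  note a = self_adjointD[OF A]
  have Ec: "E \<subseteq> carrier H" using E by (simp add: orthonormal_basis_def)
  let ?f = "\<lambda>e. (cmod (ip H y (A e)))\<^sup>2"
  have "((\<lambda>e. (cmod (ip H (A y) e))\<^sup>2) has_sum (hnorm H (A y))\<^sup>2) E"
    by (rule parseval[OF E a(2)[OF y]])
  hence p: "(?f has_sum (hnorm H (A y))\<^sup>2) E"
    by (rule has_sum_cong[THEN iffD1, rotated]) (use a(3)[OF y] Ec in auto)
  have sf: "?f summable_on E" using p by (auto simp: summable_on_def)
  have s1: "?f summable_on (E - F)" "(\<lambda>e. (hnorm H (A e))\<^sup>2) summable_on (E - F)"
    by (rule summable_on_subset_banach[OF sf] summable_on_subset_banach[OF s], blast)+
  have "(hnorm H (A y))\<^sup>2 = infsum ?f E" using p infsumI by metis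
  also have "E = F \<union> (E - F)" using F by blast
  also have "infsum ?f (F \<union> (E - F)) = sum ?f F + infsum ?f (E - F)"
    using F s1 by (subst infsum_Un_disjoint) auto
  also have "infsum ?f (E - F) \<le> infsum (\<lambda>e. (hnorm H y)\<^sup>2 * (hnorm H (A e))\<^sup>2) (E - F)"
  proof (rule infsum_mono[OF s1(1)])
    show "(\<lambda>e. (hnorm H y)\<^sup>2 * (hnorm H (A e))\<^sup>2) summable_on (E - F)"
      using summable_on_cmult_right[OF s1(2)] .
    fix e assume "e \<in> E - F"
    hence "A e \<in> carrier H" using Ec a(2) by blast
    from power_mono[OF cauchy_schwarz[OF y this], of 2]
    show "?f e \<le> (hnorm H y)\<^sup>2 * (hnorm H (A e))\<^sup>2" by (simp add: power_mult_distrib)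
  qed
  also have "\<dots> = (hnorm H y)\<^sup>2 * infsum (\<lambda>e. (hnorm H (A e))\<^sup>2) (E - F)"
    by (rule infsum_cmult_right) (use s1 in auto)
  finally show ?thesis by simp
qed

section \<open>Closed invariant subspaces and eigenvectors\<close>

definition closed_subspace :: "'v set \<Rightarrow> bool" where
  "closed_subspace V \<longleftrightarrow> V \<subseteq> carrier H \<and> (\<forall>x\<in>V. \<forall>y\<in>V. x \<oplus> y \<in> V) \<and> (\<forall>c. \<forall>x\<in>V. c \<odot> x \<in> V)
     \<and> (\<forall>X x. hlim X x \<longrightarrow> (\<forall>n. X n \<in> V) \<longrightarrow> x \<in> V)"

lemma closed_subspaceD:
  assumes "closed_subspace V"
  shows "x \<in> V \<Longrightarrow> x \<in> carrier H"
    and "x \<in> V \<Longrightarrow> y \<in> V \<Longrightarrow> x \<oplus> y \<in> V"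
    and "x \<in> V \<Longrightarrow> c \<odot> x \<in> V"
    and "hlim X x \<Longrightarrow> (\<And>n. X n \<in> V) \<Longrightarrow> x \<in> V"
    and "x \<in> V \<Longrightarrow> y \<in> V \<Longrightarrow> x \<ominus> y \<in> V"
proof -
  show 1: "\<And>x. x \<in> V \<Longrightarrow> x \<in> carrier H" and 2: "\<And>x y. x \<in> V \<Longrightarrow> y \<in> V \<Longrightarrow> x \<oplus> y \<in> V"
    and 3: "\<And>x c. x \<in> V \<Longrightarrow> c \<odot> x \<in> V" and "\<And>X x. hlim X x \<Longrightarrow> (\<And>n. X n \<in> V) \<Longrightarrow> x \<in> V"
    using assms unfolding closed_subspace_def by (simp_all add: subset_iff)
  show "x \<in> V \<Longrightarrow> y \<in> V \<Longrightarrow> x \<ominus> y \<in> V" using 1 2 3 by (simp add: diff_eq)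
qed

lemma hlim_unique: 
  assumes "hlim X x" "hlim X y"
  shows "x = y"
proof (rule ip_eqI)
  show "ip H x z = ip H y z" if "z \<in> carrier H" for z
    using LIMSEQ_unique[OF hlim_ip[OF assms(1) that] hlim_ip[OF assms(2) that]] .
qed (use assms hlim_carrier in auto)

lemma hlim_smult:
  assumes "hlim X x"
  shows "hlim (\<lambda>n. c \<odot> X n) (c \<odot> x)"
proof -
  have X: "\<And>n. X n \<in> carrier H" "x \<in> carrier H" and l: "(\<lambda>n. hnorm H (X n \<ominus> x)) \<longlonglongrightarrow> 0"
    using assms by (auto simp: hlim_def)
  have "c \<odot> X n \<ominus> c \<odot> x = c \<odot> (X n \<ominus> x)" for n
    using X by (intro ip_eqI) (auto simp: ip_linear algebra_simps)
  hence "hnorm H (c \<odot> X n \<ominus> c \<odot> x) = cmod c * hnorm H (X n \<ominus> x)" for n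
    using X by (simp add: hnorm_smult)
  thus ?thesis using X tendsto_mult_left[OF l, of "cmod c"] by (simp add: hlim_def)
qed

lemma closed_subspace_eigenspace:
  assumes V: "closed_subspace V" and A: "bounded_op H A"
  shows "closed_subspace {x \<in> V. A x = c \<odot> x}"
  unfolding closed_subspace_def
proof (intro conjI ballI allI impI)
  note v = closed_subspaceD[OF V] and a = bounded_opD[OF A]
  show "{x \<in> V. A x = c \<odot> x} \<subseteq> carrier H" using v by blast
  fix x assume x: "x \<in> {x \<in> V. A x = c \<odot> x}"
  show "d \<odot> x \<in> {x \<in> V. A x = c \<odot> x}" for d
    using x v(1,3) a(3) by (auto intro!: ip_eqI simp: ip_linear mult.left_commute)
  fix y assume y: "y \<in> {x \<in> V. A x = c \<odot> x}"
  show "x \<oplus> y \<in> {x \<in> V. A x = c \<odot> x}"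
    using x y v(1,2) a(2) by (auto intro!: ip_eqI simp: ip_linear algebra_simps)
next
  fix X x assume X: "hlim X x" "\<forall>n. X n \<in> {x \<in> V. A x = c \<odot> x}"
  have "x \<in> V" using closed_subspaceD(4)[OF V X(1)] X(2) by blast
  moreover have "A x = c \<odot> x"
    using hlim_unique[OF bounded_op_hlim[OF A X(1)]] hlim_smult[OF X(1), of c] X(2) by simp
  ultimately show "x \<in> {x \<in> V. A x = c \<odot> x}" by blast
qed

lemma closed_subspace_orthogonal:
  assumes "B \<subseteq> carrier H"
  shows "closed_subspace {x \<in> carrier H. \<forall>b\<in>B. ip H x b = 0}"
  unfolding closed_subspace_def
proof (intro conjI ballI allI impI)
  fix X x assume X: "hlim X x" "\<forall>n. X n \<in> {x \<in> carrier H. \<forall>b\<in>B. ip H x b = 0}"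
  have "ip H x b = 0" if "b \<in> B" for b
  proof -
    have "(\<lambda>n. ip H (X n) b) \<longlonglongrightarrow> ip H x b" using hlim_ip[OF X(1)] that assms by blast
    thus ?thesis using X(2) that by (simp add: LIMSEQ_const_iff)
  qed
  thus "x \<in> {x \<in> carrier H. \<forall>b\<in>B. ip H x b = 0}" using hlim_carrier(2)[OF X(1)] by blast
qed (use assms in \<open>auto simp: ip_linear subset_iff\<close>)

lemma normalize:
  assumes "x \<in> carrier H" "x \<noteq> \<zero>"
  shows "hnorm H (complex_of_real (1 / hnorm H x) \<odot> x) = 1"
  using assms by (simp add: hnorm_smult hnorm_eq_0 norm_divide)

text \<open>A maximizing sequence for \<open>\<parallel>A x\<parallel>\<close> on the unit sphere of \<open>V\<close> has a Cauchy subsequence: by the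
  parallelogram law \<open>s \<parallel>x\<^sub>m - x\<^sub>n\<parallel>\<^sup>2\<close> is at most \<open>\<parallel>A (x\<^sub>m - x\<^sub>n)\<parallel>\<^sup>2\<close> up to a vanishing error, and the
  latter is controlled by finitely many coordinates.\<close>

lemma maximizer_exists:
  assumes A: "self_adjoint H A" "trace_class H A" and V: "closed_subspace V"
    and x0: "x0 \<in> V" "A x0 \<noteq> \<zero>"
  obtains x s where "x \<in> V" "hnorm H x = 1" "0 < s" "(hnorm H (A x))\<^sup>2 = s"
    "\<And>y. y \<in> V \<Longrightarrow> (hnorm H (A y))\<^sup>2 \<le> s * (hnorm H y)\<^sup>2"
proof -
  note a = self_adjointD[OF A(1)] and v = closed_subspaceD[OF V]
  define U where "U = {x \<in> V. hnorm H x = 1}"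
  have Uc: "x \<in> carrier H" "A x \<in> carrier H" if "x \<in> U" for x using that v a by (auto simp: U_def)
  define q where "q = (\<lambda>x. (hnorm H (A x))\<^sup>2)"
  define s where "s = (SUP x\<in>U. q x)"
  obtain K where K: "0 < K" "\<And>x. x \<in> carrier H \<Longrightarrow> hnorm H (A x) \<le> K * hnorm H x"
    using bounded_op_bound[OF a(1)] by blast
  have "q x \<le> K\<^sup>2" if "x \<in> U" for x
    using K(2)[OF Uc(1)[OF that]] Uc[OF that] that unfolding q_def U_def by (intro power_mono) auto
  hence bdd: "bdd_above (q ` U)" by (intro bdd_aboveI) auto
  have q_le: "q x \<le> s" if "x \<in> U" for x unfolding s_def using bdd that by (intro cSUP_upper)
  have q_le_V: "q y \<le> s * (hnorm H y)\<^sup>2" if y: "y \<in> V" for y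
  proof (cases "y = \<zero>")
    case True
    thus ?thesis using bounded_op_zero[OF a(1)] by (simp add: q_def)
  next
    case False
    let ?c = "complex_of_real (1 / hnorm H y)"
    have n: "0 < hnorm H y" using y v(1) False hnorm_eq_0[of y] hnorm_nonneg[of y] by fastforce
    have "?c \<odot> y \<in> U" using y v normalize False by (auto simp: U_def)
    from q_le[OF this] have "(1 / hnorm H y)\<^sup>2 * q y \<le> s"
      using y v(1) a(2) n by (simp add: q_def bounded_opD(3)[OF a(1)] hnorm_smult norm_divide power_mult_distrib power_divide)
    thus ?thesis using n by (simp add: field_simps)
  qed
  have "x0 \<noteq> \<zero>" using x0 bounded_op_zero[OF a(1)] by blast
  hence x1: "complex_of_real (1 / hnorm H x0) \<odot> x0 \<in> U" 
    using normalize x0 v by (auto simp: U_def)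
  have "0 < q x0" using x0 v(1) a(2) hnorm_eq_0 by (simp add: q_def)
  hence "0 < s * (hnorm H x0)\<^sup>2" using q_le_V[OF x0(1)] by linarith
  hence s0: "0 < s" by (simp add: zero_less_mult_iff)
  have "\<exists>x\<in>U. s - inverse (real (Suc n)) < q x" for n
  proof -
    have "s - inverse (real (Suc n)) < (SUP x\<in>U. q x)" by (simp add: s_def[symmetric])
    thus ?thesis by (subst (asm) less_cSUP_iff) (use bdd x1 in auto)
  qed
  then obtain X where X: "\<And>n. X n \<in> U" "\<And>n. s - inverse (real (Suc n)) < q (X n)" by metis
  obtain E where E: "orthonormal_basis H E" and sE: "(\<lambda>e. (hnorm H (A e))\<^sup>2) summable_on E"
    using trace_class_hilbert_schmidt[OF A] .
  have Ec: "E \<subseteq> carrier H" using E by (simp add: orthonormal_basis_def)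
  \<comment> \<open>A tail below \<open>s / 2\<close> costs at most half of the term s ||x_m -
    x_n||^2. The other half stays on the left, which explains the factor \<open>2 / s\<close> in
    \<open>h\<close>.\<close>
  obtain F where F: "finite F" "F \<subseteq> E" "\<bar>infsum (\<lambda>e. (hnorm H (A e))\<^sup>2) (E - F)\<bar> < s / 2"
    using summable_small_tail[OF sE, of "s / 2"] s0 by auto
  have "bounded (range (\<lambda>n. ip H (X n) (A e)))" if "e \<in> F" for e
  proof -
    have "A e \<in> carrier H" using that F Ec a(2) by blast
    hence "cmod (ip H (X n) (A e)) \<le> hnorm H (A e)" for n
      using cauchy_schwarz[OF Uc(1)[OF X(1)], of "A e" n] X(1)[of n] by (simp add: U_def)
    thus ?thesis by (auto simp: bounded_iff)
  qed
  then obtain r :: "nat \<Rightarrow> nat" where r: "strict_mono r"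
    and conv: "\<And>e. e \<in> F \<Longrightarrow> convergent (\<lambda>n. ip H (X (r n)) (A e))"
    using finite_family_convergent_subseq_complex[OF F(1), of "\<lambda>e n. ip H (X n) (A e)"] by blast
  define Y where "Y = (\<lambda>n. X (r n))"
  have Y: "Y n \<in> U" for n using X by (simp add: Y_def)
  note Yc = Uc[OF Y]
  define z where "z = (\<lambda>e. lim (\<lambda>n. ip H (Y n) (A e)))"
  have z: "(\<lambda>n. ip H (Y n) (A e)) \<longlonglongrightarrow> z e" if "e \<in> F" for e
    using conv[OF that] unfolding z_def Y_def by (simp add: convergent_LIMSEQ_iff)
  define g where "g = (\<lambda>n. \<Sum>e\<in>F. (cmod (ip H (Y n) (A e) - z e))\<^sup>2)"
  have "g \<longlonglongrightarrow> (\<Sum>e\<in>F. (cmod (z e - z e))\<^sup>2)" unfolding g_def by (intro tendsto_intros z)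
  hence g: "g \<longlonglongrightarrow> 0" by simp
  have qY: "(\<lambda>n. q (Y n)) \<longlonglongrightarrow> s"
  proof (rule tendsto_sandwich[OF _ _ _ tendsto_const])
    show "(\<lambda>n. s - inverse (real (Suc (r n)))) \<longlonglongrightarrow> s"
      using tendsto_diff[OF tendsto_const LIMSEQ_subseq_LIMSEQ[OF LIMSEQ_inverse_real_of_nat r], of s]
      by (simp add: o_def)
    show "\<forall>\<^sub>F n in sequentially. s - inverse (real (Suc (r n))) \<le> q (Y n)"
      using X(2) by (auto simp: Y_def intro!: always_eventually less_imp_le simp del: of_nat_Suc)
    show "\<forall>\<^sub>F n in sequentially. q (Y n) \<le> s" using q_le[OF Y] by simp
  qed
  define h where "h = (\<lambda>n. (2 * g n + 2 * (s - q (Y n))) * (2 / s))"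
  have "h \<longlonglongrightarrow> (2 * 0 + 2 * (s - s)) * (2 / s)" unfolding h_def by (intro tendsto_intros g qY)
  hence h: "h \<longlonglongrightarrow> 0" by simp
  have "\<exists>x. hlim Y x"
  proof (rule hlim_exists[OF Yc(1) _ h])
    fix m n
    let ?y = "Y m \<ominus> Y n"
    have yV: "?y \<in> V" "Y m \<oplus> Y n \<in> V" using Y[of m] Y[of n] v by (auto simp: U_def)
    have yc: "?y \<in> carrier H" using yV v by blast
    have n1: "hnorm H (Y m) = 1" "hnorm H (Y n) = 1" using Y by (auto simp: U_def)
    have par: "q ?y = 2 * q (Y m) + 2 * q (Y n) - q (Y m \<oplus> Y n)"
      using Yc by (simp add: q_def bounded_op_diff[OF a(1)] bounded_opD(2)[OF a(1)] hnorm_square_add hnorm_square_diff)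
    have "q (Y m \<oplus> Y n) \<le> s * (hnorm H (Y m \<oplus> Y n))\<^sup>2" by (rule q_le_V[OF yV(2)])
    also have "(hnorm H (Y m \<oplus> Y n))\<^sup>2 = 4 - (hnorm H ?y)\<^sup>2"
      using Yc n1 by (simp add: hnorm_square_add hnorm_square_diff)
    finally have 1: "s * (hnorm H ?y)\<^sup>2 \<le> q ?y + 2 * (s - q (Y m)) + 2 * (s - q (Y n))"
      using par by (simp add: algebra_simps)
    have "(\<Sum>e\<in>F. (cmod (ip H ?y (A e)))\<^sup>2) \<le> (\<Sum>e\<in>F. 2 * (cmod (ip H (Y m) (A e) - z e))\<^sup>2 + 2 * (cmod (ip H (Y n) (A e) - z e))\<^sup>2)"
    proof (rule sum_mono)
      fix e assume "e \<in> F"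
      hence "A e \<in> carrier H" using F Ec a(2) by blast
      thus "(cmod (ip H ?y (A e)))\<^sup>2 \<le> 2 * (cmod (ip H (Y m) (A e) - z e))\<^sup>2 + 2 * (cmod (ip H (Y n) (A e) - z e))\<^sup>2"
        using norm_square_diff_le Yc by (simp add: ip_diff)
    qed
    also have "\<dots> = 2 * g m + 2 * g n"
      by (simp add: g_def sum.distrib sum_distrib_left)
    finally have 2: "q ?y \<le> 2 * g m + 2 * g n + (hnorm H ?y)\<^sup>2 * infsum (\<lambda>e. (hnorm H (A e))\<^sup>2) (E - F)"
      using hilbert_schmidt_tail_bound[OF A(1) E sE F(1,2) yc] by (simp add: q_def)
    have 3: "(hnorm H ?y)\<^sup>2 * infsum (\<lambda>e. (hnorm H (A e))\<^sup>2) (E - F) \<le> (hnorm H ?y)\<^sup>2 * (s / 2)"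
      using F(3) by (intro mult_left_mono) auto
    have 4: "(hnorm H ?y)\<^sup>2 * (s / 2) \<le> 2 * g m + 2 * g n + 2 * (s - q (Y m)) + 2 * (s - q (Y n))"
      using 1 2 3 by (simp add: algebra_simps)
    have "(hnorm H ?y)\<^sup>2 = (hnorm H ?y)\<^sup>2 * (s / 2) * (2 / s)" using s0 by simp
    also have "\<dots> \<le> (2 * g m + 2 * g n + 2 * (s - q (Y m)) + 2 * (s - q (Y n))) * (2 / s)"
      using 4 s0 by (intro mult_right_mono) auto
    also have "\<dots> = h m + h n" by (simp only: h_def distrib_right[symmetric] add_ac)
    finally show "(hnorm H ?y)\<^sup>2 \<le> h m + h n" .
  qed
  then obtain x where x: "hlim Y x" by blast
  have "x \<in> V" using v(4)[OF x] Y by (auto simp: U_def)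
  moreover have "hnorm H x = 1"
    using LIMSEQ_unique[OF hlim_hnorm[OF x]] Y by (simp add: U_def)
  moreover have "(\<lambda>n. q (Y n)) \<longlonglongrightarrow> q x"
    unfolding q_def by (intro tendsto_power hlim_hnorm bounded_op_hlim[OF a(1)] x)
  hence "q x = s" using LIMSEQ_unique[OF qY] by simp
  ultimately show ?thesis using that[of x s] s0 q_le_V by (simp add: q_def)
qed

text \<open>If \<open>A\<close> vanishes on \<open>V\<close>, the given vector serves, with
  eigenvalue 0. Otherwise let \<open>x\<close> maximize ||A x||^2 on the unit sphere of
  \<open>V\<close>, with value \<open>s\<close>. Since A x lies in \<open>V\<close>, maximality
  gives ||A^2 x||^2 <= s^2, and therefore ||A^2 x - s x||^2 <= s^2 - 2 s^2 + s^2 = 0. Now factor A^2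
  - s: the vector u = (A + sqrt s) x is either zero, and then \<open>x\<close> has eigenvalue -sqrt
  s, or it is an eigenvector for sqrt s.\<close>

lemma eigenvector_exists:
  assumes A: "self_adjoint H A" "trace_class H A" and V: "closed_subspace V" and inv: "A ` V \<subseteq> V"
    and ne: "v \<in> V" "v \<noteq> \<zero>"
  obtains x and c :: real where "x \<in> V" "x \<noteq> \<zero>" "A x = complex_of_real c \<odot> x"
proof (cases "\<exists>x0\<in>V. A x0 \<noteq> \<zero>")
  case False
  thus ?thesis using that[of v 0] ne closed_subspaceD(1)[OF V] zero_eq_smult by auto
next
  case True
  note a = self_adjointD[OF A(1)] and w = closed_subspaceD[OF V]
  obtain x s where x: "x \<in> V" "hnorm H x = 1" and s: "0 < s" "(hnorm H (A x))\<^sup>2 = s"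
    and max: "\<And>y. y \<in> V \<Longrightarrow> (hnorm H (A y))\<^sup>2 \<le> s * (hnorm H y)\<^sup>2"
    using maximizer_exists[OF A V] True by metis
  have c: "x \<in> carrier H" "A x \<in> carrier H" "A (A x) \<in> carrier H" using x w a by auto
  have r: "Re (ip H (A (A x)) x) = s" using a(3)[OF c(2,1)] c(2) s(2) by (simp add: hnorm_square)
  have "(hnorm H (A (A x) \<ominus> of_real s \<odot> x))\<^sup>2 = (hnorm H (A (A x)))\<^sup>2 - 2 * (s * s) + s * s"
    using c x(2) by (subst hnorm_square_diff) (simp_all add: hnorm_smult ip_linear r power2_eq_square)
  also have "\<dots> \<le> 0" using max[of "A x"] x inv s(2) by auto
  finally have "hnorm H (A (A x) \<ominus> of_real s \<odot> x) = 0" by simp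
  hence "A (A x) \<ominus> of_real s \<odot> x = \<zero>"
    by (rule hnorm_eq_0[THEN iffD1, rotated]) (use c in simp)
  hence AA: "A (A x) = of_real s \<odot> x"
    by (rule eq_if_diff_zero[rotated 2]) (use c in simp_all)
  define t where "t = complex_of_real (sqrt s)"
  have tt: "complex_of_real s = t * t" using s(1) by (simp add: t_def flip: of_real_mult)
  define u where "u = A x \<oplus> t \<odot> x"
  have uc: "u \<in> carrier H" and uV: "u \<in> V" using c w x inv by (auto simp: u_def)
  have x0: "x \<noteq> \<zero>" using x by auto
  show ?thesis
  proof (cases "u = \<zero>")
    case True
    have "A x = complex_of_real (- sqrt s) \<odot> x"
    proof (rule ip_eqI)
      fix z assume z: "z \<in> carrier H"
      have "ip H u z = 0" using True z by simp
      thus "ip H (A x) z = ip H (complex_of_real (- sqrt s) \<odot> x) z"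
        using z c by (simp add: u_def ip_linear t_def add_eq_0_iff2)
    qed (use c in auto)
    thus ?thesis using that x x0 by blast
  next
    case False
    have "A u = t \<odot> u"
    proof (rule ip_eqI)
      have "A u = A (A x) \<oplus> t \<odot> A x"
        using c by (simp add: u_def bounded_opD(2,3)[OF a(1)])
      thus "ip H (A u) z = ip H (t \<odot> u) z" if "z \<in> carrier H" for z
        using that c by (simp add: AA tt u_def ip_linear algebra_simps)
    qed (use uc a in auto)
    thus ?thesis using that uV False by (simp add: t_def)
  qed
qed

text \<open>Induction over the operators: an eigenspace of \<open>A\<close> inside \<open>V\<close>
  is closed, and the remaining operators map it to itself because they commute with
  \<open>A\<close>. This is why \<open>V\<close> has to vary.\<close>

lemma common_eigenvector_exists:
  assumes "\<And>A. A \<in> set As \<Longrightarrow> self_adjoint H A \<and> trace_class H A"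
    and "\<And>A B. A \<in> set As \<Longrightarrow> B \<in> set As \<Longrightarrow> commuting H A B"
    and "closed_subspace V" "\<And>A. A \<in> set As \<Longrightarrow> A ` V \<subseteq> V" "v \<in> V" "v \<noteq> \<zero>"
  shows "\<exists>x\<in>V. x \<noteq> \<zero> \<and> (\<forall>A\<in>set As. \<exists>c::real. A x = complex_of_real c \<odot> x)"
  using assms
proof (induction As arbitrary: V v)
  case Nil
  thus ?case by auto
next
  case (Cons A As)
  have A: "self_adjoint H A" "trace_class H A" using Cons.prems by auto
  obtain x c where x: "x \<in> V" "x \<noteq> \<zero>" "A x = complex_of_real c \<odot> x"
    using eigenvector_exists[OF A Cons.prems(3) _ Cons.prems(5,6)] Cons.prems(4) by (metis list.set_intros(1))
  let ?W = "{x \<in> V. A x = complex_of_real c \<odot> x}"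
  have "\<exists>x\<in>?W. x \<noteq> \<zero> \<and> (\<forall>A\<in>set As. \<exists>c::real. A x = complex_of_real c \<odot> x)"
  proof (rule Cons.IH[OF _ _ _ _ _ x(2)])
    show "closed_subspace ?W"
      by (rule closed_subspace_eigenspace[OF Cons.prems(3) self_adjointD(1)[OF A(1)]])
    show "B ` ?W \<subseteq> ?W" if B: "B \<in> set As" for B
    proof
      fix y assume "y \<in> B ` ?W"
      then obtain w where w: "w \<in> V" "A w = complex_of_real c \<odot> w" "y = B w" by blast
      have wc: "w \<in> carrier H" using w closed_subspaceD(1)[OF Cons.prems(3)] by blast
      have "A (B w) = B (A w)" using Cons.prems(2)[of A B] B wc by (simp add: commuting_def)
      also have "\<dots> = complex_of_real c \<odot> B w"
        using Cons.prems(1)[of B] B w wc bounded_opD(3) self_adjointD(1) by (metis list.set_intros(2))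
      finally show "y \<in> ?W" using Cons.prems(4)[of B] B w by auto
    qed
  qed (use Cons.prems x in auto)
  thus ?case by auto
qed

text \<open>Zorn's lemma gives a maximal orthonormal set of common eigenvectors. Its orthogonal
  complement is closed and, by self-adjointness, invariant. A nonzero vector there would yield
  another common eigenvector, and its normalization would enlarge the set.\<close>

theorem common_eigenbasis_exists:
  assumes As: "\<And>A. A \<in> set As \<Longrightarrow> self_adjoint H A \<and> trace_class H A"
    and comm: "\<And>A B. A \<in> set As \<Longrightarrow> B \<in> set As \<Longrightarrow> commuting H A B"
  obtains B a where "orthonormal_basis H B" "\<And>A. A \<in> set As \<Longrightarrow> diagonal_in B (a A) A"
proof -
  define \<B> where "\<B> = {B. orthonormal B \<and> (\<forall>b\<in>B. \<forall>A\<in>set As. \<exists>c::real. A b = complex_of_real c \<odot> b)}"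
  have "\<exists>M\<in>\<B>. \<forall>X\<in>\<B>. M \<subseteq> X \<longrightarrow> X = M"
  proof (rule subset_Zorn')
    fix C assume C: "subset.chain \<B> C"
    have "orthonormal (\<Union>C)" unfolding orthonormal_def
    proof (intro conjI ballI)
      show "\<Union>C \<subseteq> carrier H" using C by (auto simp: subset.chain_def \<B>_def orthonormal_def)
      fix e f assume "e \<in> \<Union>C" "f \<in> \<Union>C"
      then obtain X Y where "X \<in> C" "e \<in> X" "Y \<in> C" "f \<in> Y" by blast
      moreover have "X \<subseteq> Y \<or> Y \<subseteq> X" using C calculation by (auto simp: subset_chain_def)
      ultimately obtain Z where "Z \<in> C" "e \<in> Z" "f \<in> Z" by blast
      moreover have "orthonormal Z" using C calculation by (auto simp: subset_chain_def \<B>_def)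
      ultimately show "ip H e f = (if e = f then 1 else 0)" using orthonormal_ip by blast
    qed
    thus "\<Union>C \<in> \<B>" using C by (auto simp: subset_chain_def \<B>_def)
  qed
  then obtain B where B: "B \<in> \<B>" and max: "\<And>X. X \<in> \<B> \<Longrightarrow> B \<subseteq> X \<Longrightarrow> X = B" by blast
  have on: "orthonormal B" and eig: "\<And>b A. b \<in> B \<Longrightarrow> A \<in> set As \<Longrightarrow> \<exists>c::real. A b = complex_of_real c \<odot> b"
    using B by (auto simp: \<B>_def)
  have Bc: "B \<subseteq> carrier H" using on by (simp add: orthonormal_def)
  let ?V = "{x \<in> carrier H. \<forall>b\<in>B. ip H x b = 0}"
  have "x = \<zero>" if x: "x \<in> carrier H" "\<forall>e\<in>B. ip H x e = 0" for x
  proof (rule ccontr)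
    assume "x \<noteq> \<zero>"
    have "\<exists>x\<in>?V. x \<noteq> \<zero> \<and> (\<forall>A\<in>set As. \<exists>c::real. A x = complex_of_real c \<odot> x)"
    proof (rule common_eigenvector_exists[OF As comm closed_subspace_orthogonal[OF Bc] _ _ \<open>x \<noteq> \<zero>\<close>])
      fix A assume A: "A \<in> set As"
      have "ip H (A y) b = 0" if y: "y \<in> ?V" and b: "b \<in> B" for y b
        using eig[OF b A] self_adjointD(3)[of A y b] As[OF A] y b Bc by (auto simp: ip_linear)
      thus "A ` ?V \<subseteq> ?V" using As[OF A] self_adjointD(2) by blast
    qed (use x in auto)
    then obtain y where y: "y \<in> ?V" "y \<noteq> \<zero>" "\<And>A. A \<in> set As \<Longrightarrow> \<exists>c::real. A y = complex_of_real c \<odot> y"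
      by blast
    define w where "w = complex_of_real (1 / hnorm H y) \<odot> y"
    have wc: "w \<in> carrier H" and ww: "ip H w w = 1"
      using y normalize[of y] ip_self[of w] by (auto simp: w_def)
    have wb: "ip H w b = 0" "ip H b w = 0" if "b \<in> B" for b
      using y that Bc ip_cnj[of w b] wc by (auto simp: w_def ip_linear)
    have "orthonormal (insert w B)"
      using on ww wb wc by (auto simp: orthonormal_def)
    moreover have "\<exists>c::real. A w = complex_of_real c \<odot> w" if "A \<in> set As" for A
    proof -
      obtain c :: real where c: "A y = complex_of_real c \<odot> y" using y(3) \<open>A \<in> set As\<close> by blast
      have "A w = complex_of_real (1 / hnorm H y) \<odot> A y"
        unfolding w_def using bounded_opD(3) self_adjointD(1) As[OF that] y by blast
      also have "\<dots> = complex_of_real c \<odot> w"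
        unfolding c w_def using y by (intro ip_eqI) (auto simp: ip_linear)
      finally show ?thesis by blast
    qed
    ultimately have "insert w B \<in> \<B>" using eig by (auto simp: \<B>_def)
    hence "w \<in> B" using max[of "insert w B"] by blast
    from wb(1)[OF this] show False using ww by simp
  qed
  hence basis: "orthonormal_basis H B" using on by (simp add: orthonormal_def orthonormal_basis_def)
  define a where "a = (\<lambda>A b. SOME c::real. A b = complex_of_real c \<odot> b)"
  have "A b = complex_of_real (a A b) \<odot> b" if "A \<in> set As" "b \<in> B" for A b
    unfolding a_def using someI_ex[OF eig[OF that(2,1)]] .
  hence "diagonal_in B (a A) A" if "A \<in> set As" for A
    using basis As that by (simp add: diagonal_in_def)
  thus ?thesis using that basis by blast
qed

end

section \<open>Finite-rank truncations\<close>

text \<open>A combination of the rank-one operators x |-> <x, b> b. The coefficients are a function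
  of vectors rather than of indices, so the same \<open>a\<close> keeps its meaning when
  \<open>F\<close> shrinks or when the space is replaced by an orthogonal complement.\<close>

definition rank_op :: "'v ip_space \<Rightarrow> 'v set \<Rightarrow> ('v \<Rightarrow> real) \<Rightarrow> 'v \<Rightarrow> 'v" where
  "rank_op H F a = (\<lambda>x\<in>carrier H. \<Oplus>\<^bsub>H\<^esub>b\<in>F. (complex_of_real (a b) * ip H x b) \<odot>\<^bsub>H\<^esub> b)"

context hilbert_space
begin

lemma rank_op_carrier: "F \<subseteq> carrier H \<Longrightarrow> x \<in> carrier H \<Longrightarrow> rank_op H F a x \<in> carrier H"
  by (auto simp: rank_op_def intro!: M.finsum_closed)

lemma ip_rank_op:
  assumes "finite F" "F \<subseteq> carrier H" "x \<in> carrier H" "z \<in> carrier H"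
  shows "ip H (rank_op H F a x) z = (\<Sum>b\<in>F. a b * ip H x b * ip H b z)"
  unfolding rank_op_def using assms by (simp, subst ip_finsum) (auto simp: ip_linear subset_iff intro!: sum.cong)

lemma rank_op_singleton:
  assumes "b \<in> carrier H" "x \<in> carrier H"
  shows "rank_op H {b} a x = (complex_of_real (a b) * ip H x b) \<odot> b"
proof (rule ip_eqI)
  show "rank_op H {b} a x \<in> carrier H" using assms by (intro rank_op_carrier) auto
  show "ip H (rank_op H {b} a x) z = ip H ((complex_of_real (a b) * ip H x b) \<odot> b) z" if "z \<in> carrier H" for z
    using assms that by (simp add: ip_rank_op ip_smult)
qed (use assms in auto)

lemma rank_op_add:
  assumes "finite F" "F \<subseteq> carrier H"
  shows "op_add H (rank_op H F a) (rank_op H F a') = rank_op H F (\<lambda>b. a b + a' b)"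
proof
  fix x show "op_add H (rank_op H F a) (rank_op H F a') x = rank_op H F (\<lambda>b. a b + a' b) x"
  proof (cases "x \<in> carrier H")
    case True
    have "rank_op H F a x \<oplus> rank_op H F a' x = rank_op H F (\<lambda>b. a b + a' b) x"
      using True assms by (intro ip_eqI)
        (simp_all add: rank_op_carrier ip_rank_op ip_add distrib_right sum.distrib)
    thus ?thesis using True by (simp add: op_add_def)
  qed (simp add: op_add_def rank_op_def)
qed

lemma self_adjoint_rank_op:
  assumes F: "finite F" "F \<subseteq> carrier H"
  shows "self_adjoint H (rank_op H F a)"
proof -
  let ?R = "rank_op H F a"
  note c = rank_op_carrier[OF F(2)]
  \<comment> \<open>Cauchy-Schwarz applied to each summand of <R x, R x> gives ||R x||^2 <= K ||x||
    ||R x||; it remains to divide by ||R x||.\<close>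
  define K where "K = (\<Sum>b\<in>F. \<bar>a b\<bar> * hnorm H b * hnorm H b)"
  have K0: "0 \<le> K" unfolding K_def using F by (intro sum_nonneg mult_nonneg_nonneg) (auto simp: subset_iff)
  have "hnorm H (?R x) \<le> K * hnorm H x" if x: "x \<in> carrier H" for x
  proof (cases "hnorm H (?R x) = 0")
    case True
    thus ?thesis using K0 x by simp
  next
    case False
    have "(hnorm H (?R x))\<^sup>2 = Re (\<Sum>b\<in>F. a b * ip H x b * ip H b (?R x))"
      using F x c by (simp add: hnorm_square ip_rank_op)
    also have "\<dots> \<le> (\<Sum>b\<in>F. cmod (a b * ip H x b * ip H b (?R x)))"
      using complex_Re_le_cmod norm_sum order_trans by blast
    also have "\<dots> \<le> (\<Sum>b\<in>F. \<bar>a b\<bar> * (hnorm H x * hnorm H b) * (hnorm H b * hnorm H (?R x)))"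
      unfolding norm_mult norm_of_real using F x c
      by (intro sum_mono mult_mono cauchy_schwarz) (auto intro!: mult_nonneg_nonneg simp: subset_iff)
    also have "\<dots> = K * hnorm H x * hnorm H (?R x)"
      unfolding K_def sum_distrib_right by (intro sum.cong refl) (simp only: mult_ac)
    finally have "hnorm H (?R x) * hnorm H (?R x) \<le> K * hnorm H x * hnorm H (?R x)"
      by (simp add: power2_eq_square)
    moreover have "0 < hnorm H (?R x)" using False hnorm_nonneg[OF c[OF x, of a]] by linarith
    ultimately show ?thesis by simp
  qed
  moreover have "?R (x \<oplus> y) = ?R x \<oplus> ?R y" if "x \<in> carrier H" "y \<in> carrier H" for x y
    using that c F by (intro ip_eqI)
      (simp_all add: ip_rank_op ip_add subset_iff distrib_left distrib_right sum.distrib)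
  moreover have "?R (d \<odot> x) = d \<odot> ?R x" if "x \<in> carrier H" for x d
    using that c F by (intro ip_eqI)
      (simp_all add: ip_rank_op ip_smult subset_iff sum_distrib_left mult_ac)
  moreover have "ip H (?R x) y = ip H x (?R y)" if "x \<in> carrier H" "y \<in> carrier H" for x y
  proof -
    have "ip H x (?R y) = cnj (ip H (?R y) x)" by (rule ip_cnj) (use that c in auto)
    also have "\<dots> = (\<Sum>b\<in>F. cnj (a b * ip H y b * ip H b x))"
      using that F by (simp add: ip_rank_op)
    also have "\<dots> = (\<Sum>b\<in>F. a b * ip H x b * ip H b y)"
    proof (intro sum.cong refl)
      fix b assume "b \<in> F"
      hence "b \<in> carrier H" using F by blast
      thus "cnj (a b * ip H y b * ip H b x) = a b * ip H x b * ip H b y"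
        using ip_cnj[of y b] ip_cnj[of b x] that by simp
    qed
    finally show ?thesis using that F by (simp add: ip_rank_op)
  qed
  ultimately show ?thesis unfolding self_adjoint_def bounded_op_def
    using c by (auto simp: rank_op_def)
qed

lemma diagonal_in_rank_op:
  assumes B: "orthonormal_basis H B" and F: "finite F" "F \<subseteq> B"
  shows "diagonal_in B (\<lambda>b. if b \<in> F then a b else 0) (rank_op H F a)"
proof -
  have Bc: "B \<subseteq> carrier H" using B by (simp add: orthonormal_basis_def)
  hence Fc: "F \<subseteq> carrier H" using F by blast
  have "rank_op H F a e = complex_of_real (if e \<in> F then a e else 0) \<odot> e" if e: "e \<in> B" for e
  proof (rule ip_eqI)
    fix z assume z: "z \<in> carrier H"
    have "ip H (rank_op H F a e) z = (\<Sum>b\<in>F. a b * ip H e b * ip H b z)"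
      using F Fc Bc e z by (intro ip_rank_op) auto
    also have "\<dots> = (\<Sum>b\<in>F. if b = e then a e * ip H e z else 0)"
      using B F e by (intro sum.cong) (auto simp: orthonormal_basis_def)
    also have "\<dots> = ip H (complex_of_real (if e \<in> F then a e else 0) \<odot> e) z"
      using F e Bc z by (auto simp: ip_smult)
    finally show "ip H (rank_op H F a e) z = ip H (complex_of_real (if e \<in> F then a e else 0) \<odot> e) z" .
  qed (use e Bc Fc rank_op_carrier in auto)
  thus ?thesis using B self_adjoint_rank_op[OF F(1) Fc] by (simp add: diagonal_in_def)
qed

lemma trace_norm_rank_op:
  assumes B: "orthonormal_basis H B" and F: "finite F" "F \<subseteq> B"
  shows "trace_class H (rank_op H F a)" "trace_norm H (rank_op H F a) = (\<Sum>b\<in>F. \<bar>a b\<bar>)"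
proof -
  let ?t = "\<lambda>b. if b \<in> F then a b else 0"
  have T: "diagonal_in B ?t (rank_op H F a)" by (rule diagonal_in_rank_op[OF assms])
  have P: "diagonal_in B (\<lambda>b. \<bar>?t b\<bar>) (rank_op H F (\<lambda>b. \<bar>a b\<bar>))"
    using diagonal_in_rank_op[OF assms, of "\<lambda>b. \<bar>a b\<bar>"] by (simp add: if_distrib cong: if_cong)
  have "((\<lambda>b. \<bar>?t b\<bar>) has_sum (\<Sum>b\<in>F. \<bar>a b\<bar>)) F"
    using has_sum_finite[OF F(1), of "\<lambda>b. \<bar>?t b\<bar>"] by simp
  hence "((\<lambda>b. \<bar>?t b\<bar>) has_sum (\<Sum>b\<in>F. \<bar>a b\<bar>)) B"
    by (rule has_sum_cong_neutral[THEN iffD1, rotated -1]) (use F in auto)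
  from trace_norm_diagonal[OF T P this]
  show "trace_class H (rank_op H F a)" "trace_norm H (rank_op H F a) = (\<Sum>b\<in>F. \<bar>a b\<bar>)" .
qed

text \<open>The absolute value of the truncation error is exhibited explicitly: it is |A| minus the
  truncation of |A| to \<open>F\<close>, where |A| is the operator that trace class provides. Both
  are diagonal in \<open>B\<close>, and the entries on \<open>F\<close> cancel.\<close>

lemma trace_norm_truncation_error:
  assumes A: "diagonal_in B a A" "trace_class H A" and F: "finite F" "F \<subseteq> B"
  shows "(\<lambda>b. \<bar>a b\<bar>) summable_on B"
    and "trace_norm H (op_diff H (rank_op H F a) A) = infsum (\<lambda>b. \<bar>a b\<bar>) (B - F)"
proof -
  have B: "orthonormal_basis H B" using A by (simp add: diagonal_in_def)
  obtain r where r: "has_trace_norm H A r" using A(2) by (auto simp: trace_class_def)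
  then obtain P where P: "is_abs_op H A P" by (auto simp: has_trace_norm_def)
  show s: "(\<lambda>b. \<bar>a b\<bar>) summable_on B"
    using has_trace_norm_diagonal[OF A(1) r] by (auto simp: summable_on_def)
  let ?t = "\<lambda>b. (if b \<in> F then a b else 0) - a b"
  have T: "diagonal_in B ?t (op_diff H (rank_op H F a) A)"
    by (intro diagonal_in_op_diff diagonal_in_rank_op A B F)
  have "diagonal_in B (\<lambda>b. \<bar>a b\<bar> - (if b \<in> F then \<bar>a b\<bar> else 0)) (op_diff H P (rank_op H F (\<lambda>b. \<bar>a b\<bar>)))"
    by (intro diagonal_in_op_diff diagonal_in_rank_op is_abs_op_diagonal[OF A(1) P] B F)
  moreover have "(\<lambda>b. \<bar>a b\<bar> - (if b \<in> F then \<bar>a b\<bar> else 0)) = (\<lambda>b. \<bar>?t b\<bar>)" by auto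
  ultimately have P': "diagonal_in B (\<lambda>b. \<bar>?t b\<bar>) (op_diff H P (rank_op H F (\<lambda>b. \<bar>a b\<bar>)))" by simp
  have "((\<lambda>b. \<bar>a b\<bar>) has_sum infsum (\<lambda>b. \<bar>a b\<bar>) (B - F)) (B - F)"
    using summable_on_subset_banach[OF s, of "B - F"] by simp
  hence "((\<lambda>b. \<bar>?t b\<bar>) has_sum infsum (\<lambda>b. \<bar>a b\<bar>) (B - F)) B"
    by (rule has_sum_cong_neutral[THEN iffD1, rotated -1]) auto
  from trace_norm_diagonal(2)[OF T P' this]
  show "trace_norm H (op_diff H (rank_op H F a) A) = infsum (\<lambda>b. \<bar>a b\<bar>) (B - F)" .
qed

lemma rank_op_symbol:
  assumes B: "orthonormal_basis H B" and F: "finite F" "F \<subseteq> B"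
  shows "self_adjoint H (rank_op H F a)" "trace_class H (rank_op H F a)"
    "commuting H (rank_op H F a) (rank_op H F a')"
  using diagonal_inD(1)[OF diagonal_in_rank_op[OF assms]] trace_norm_rank_op[OF assms]
    diagonal_in_commuting[OF diagonal_in_rank_op[OF assms] diagonal_in_rank_op[OF assms]] by auto

lemma trace_class_truncation:
  assumes As: "\<And>A. A \<in> set As \<Longrightarrow> self_adjoint H A \<and> trace_class H A"
    and comm: "\<And>A B. A \<in> set As \<Longrightarrow> B \<in> set As \<Longrightarrow> commuting H A B" and d: "0 < d"
  obtains B F as where "orthonormal_basis H B" "finite F" "F \<subseteq> B" "length as = length As"
    "\<And>i. i < length As \<Longrightarrow> trace_norm H (op_diff H (rank_op H F (as ! i)) (As ! i)) < d"
proof -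
  obtain B a where B: "orthonormal_basis H B" and a: "\<And>A. A \<in> set As \<Longrightarrow> diagonal_in B (a A) A"
    using common_eigenbasis_exists[OF As comm] by blast
  have s: "(\<lambda>b. \<bar>a A b\<bar>) summable_on B" if "A \<in> set As" for A
    using trace_norm_truncation_error(1)[OF a[OF that], of "{}"] As[OF that] by simp
  have "\<exists>F. finite F \<and> F \<subseteq> B \<and> \<bar>infsum (\<lambda>b. \<bar>a A b\<bar>) (B - F)\<bar> < d" if "A \<in> set As" for A
    by (rule summable_small_tail[OF s[OF that] d]) blast
  hence "\<forall>A\<in>set As. \<exists>F. finite F \<and> F \<subseteq> B \<and> \<bar>infsum (\<lambda>b. \<bar>a A b\<bar>) (B - F)\<bar> < d" by blast
  from bchoice[OF this] obtain G
    where G: "\<And>A. A \<in> set As \<Longrightarrow> finite (G A) \<and> G A \<subseteq> B \<and> \<bar>infsum (\<lambda>b. \<bar>a A b\<bar>) (B - G A)\<bar> < d"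
    by blast
  \<comment> \<open>One finite set serves all coordinates, since enlarging it only shrinks the tails
    of nonnegative sums.\<close>
  define F where "F = (\<Union>A\<in>set As. G A)"
  have F: "finite F" "F \<subseteq> B" using G by (auto simp: F_def)
  have "trace_norm H (op_diff H (rank_op H F (map a As ! i)) (As ! i)) < d" if i: "i < length As" for i
  proof -
    have A: "As ! i \<in> set As" using i by simp
    have "infsum (\<lambda>b. \<bar>a (As ! i) b\<bar>) (B - F) \<le> infsum (\<lambda>b. \<bar>a (As ! i) b\<bar>) (B - G (As ! i))"
      using A by (intro infsum_mono2 summable_on_subset_banach[OF s[OF A]]) (auto simp: F_def)
    also have "\<dots> < d" using G[OF A] by linarith
    finally show ?thesis
      using trace_norm_truncation_error(2)[OF a[OF A] _ F] As[OF A] i by simp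
  qed
  thus ?thesis using that[of B F "map a As"] B F by simp
qed

end

section \<open>Splitting off a line\<close>

text \<open>Completeness is phrased with addition of a multiple by -1, because subtraction in the
  record goes through additive inverses, about which nothing is known before the group axioms
  hold.\<close>

lemma hilbert_spaceI:
  fixes H :: "'v ip_space" (structure)
  assumes add: "\<And>x y. x \<in> carrier H \<Longrightarrow> y \<in> carrier H \<Longrightarrow> x \<oplus> y \<in> carrier H"
    and zero: "\<zero> \<in> carrier H"
    and smult: "\<And>c x. x \<in> carrier H \<Longrightarrow> c \<odot> x \<in> carrier H"
    and assoc: "\<And>x y z. x \<in> carrier H \<Longrightarrow> y \<in> carrier H \<Longrightarrow> z \<in> carrier H \<Longrightarrow> (x \<oplus> y) \<oplus> z = x \<oplus> (y \<oplus> z)"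
    and commute: "\<And>x y. x \<in> carrier H \<Longrightarrow> y \<in> carrier H \<Longrightarrow> x \<oplus> y = y \<oplus> x"
    and zero_add: "\<And>x. x \<in> carrier H \<Longrightarrow> \<zero> \<oplus> x = x"
    and zero_smult: "\<And>x. x \<in> carrier H \<Longrightarrow> 0 \<odot> x = \<zero>"
    and one_smult: "\<And>x. x \<in> carrier H \<Longrightarrow> 1 \<odot> x = x"
    and smult_assoc: "\<And>c d x. x \<in> carrier H \<Longrightarrow> (c * d) \<odot> x = c \<odot> (d \<odot> x)"
    and distr_left: "\<And>c d x. x \<in> carrier H \<Longrightarrow> (c + d) \<odot> x = c \<odot> x \<oplus> d \<odot> x"
    and distr_right: "\<And>c x y. x \<in> carrier H \<Longrightarrow> y \<in> carrier H \<Longrightarrow> c \<odot> (x \<oplus> y) = c \<odot> x \<oplus> c \<odot> y"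
    and ip: "\<And>x y z. x \<in> carrier H \<Longrightarrow> y \<in> carrier H \<Longrightarrow> z \<in> carrier H \<Longrightarrow> ip H (x \<oplus> y) z = ip H x z + ip H y z"
      "\<And>c x y. x \<in> carrier H \<Longrightarrow> y \<in> carrier H \<Longrightarrow> ip H (c \<odot> x) y = c * ip H x y"
      "\<And>x y. x \<in> carrier H \<Longrightarrow> y \<in> carrier H \<Longrightarrow> ip H y x = cnj (ip H x y)"
      "\<And>x. x \<in> carrier H \<Longrightarrow> 0 \<le> ip H x x"
      "\<And>x. x \<in> carrier H \<Longrightarrow> ip H x x = 0 \<Longrightarrow> x = \<zero>"
    and complete: "\<And>X. (\<And>n::nat. X n \<in> carrier H) \<Longrightarrow>
        (\<And>e. 0 < e \<Longrightarrow> \<exists>N. \<forall>m\<ge>N. \<forall>n\<ge>N. hnorm H (X m \<oplus> (-1) \<odot> X n) < e) \<Longrightarrow>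
        \<exists>x\<in>carrier H. (\<lambda>n. hnorm H (X n \<oplus> (-1) \<odot> x)) \<longlonglongrightarrow> 0"
  shows "hilbert_space H"
proof -
  have "\<exists>y\<in>carrier H. y \<oplus> x = \<zero>" if x: "x \<in> carrier H" for x
    using distr_left[OF x, of "-1" 1] one_smult[OF x] zero_smult[OF x] smult[OF x, of "-1"] by auto
  hence ab: "abelian_group H" using add zero assoc commute zero_add by (intro abelian_groupI) auto
  have cring: "cring (class_ring :: complex ring)" by unfold_locales
  have mod: "Module.module (class_ring :: complex ring) H"
    by (rule moduleI[OF cring ab])
       (use smult distr_left distr_right smult_assoc one_smult in auto)
  interpret vectorspace "class_ring :: complex ring" H
    by (intro vectorspace.intro mod class_field)
  have diff: "x \<ominus> y = x \<oplus> (-1) \<odot> y" if "x \<in> carrier H" "y \<in> carrier H" for x y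
    using smult_l_minus[of 1 y] one_smult[OF that(2)] that by (simp add: class_ring_simps a_minus_def)
  have lim: "\<exists>x\<in>carrier H. (\<lambda>n. hnorm H (X n \<ominus> x)) \<longlonglongrightarrow> 0"
    if X: "\<And>n::nat. X n \<in> carrier H"
      and cau: "\<And>e. 0 < e \<Longrightarrow> \<exists>N. \<forall>m\<ge>N. \<forall>n\<ge>N. hnorm H (X m \<ominus> X n) < e" for X
  proof -
    have "\<exists>N. \<forall>m\<ge>N. \<forall>n\<ge>N. hnorm H (X m \<oplus> (-1) \<odot> X n) < e" if "0 < e" for e
      using cau[OF that] unfolding diff[OF X X] .
    from complete[OF X this] obtain x
      where x: "x \<in> carrier H" "(\<lambda>n. hnorm H (X n \<oplus> (-1) \<odot> x)) \<longlonglongrightarrow> 0" by blast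
    from x(2) have "(\<lambda>n. hnorm H (X n \<ominus> x)) \<longlonglongrightarrow> 0" unfolding diff[OF X x(1)] .
    thus ?thesis using x(1) by blast
  qed
  show ?thesis
    by (intro hilbert_space.intro hilbert_space_axioms.intro vectorspace_axioms ip lim) assumption+
qed

text \<open>Transport of structure; it shows that the direct sum of a line and its complement is a
  Hilbert space. The image of zero is a separate hypothesis: \<open>K\<close> is not yet known to be
  a group, and \<open>unitary_iso\<close> does not mention its zero field.\<close>

lemma unitary_iso_hilbert_space:
  fixes H :: "'v ip_space" (structure) and K :: "'w ip_space"
  assumes "hilbert_space H" and h: "unitary_iso H K h" and h0: "h \<zero>\<^bsub>H\<^esub> = \<zero>\<^bsub>K\<^esub>"
  shows "hilbert_space K"
proof -
  interpret hilbert_space H by fact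
  define g where "g = inv_into (carrier H) h"
  have hc: "\<And>x. x \<in> carrier H \<Longrightarrow> h x \<in> carrier K" and gh: "\<And>x. x \<in> carrier H \<Longrightarrow> g (h x) = x"
    and gc: "\<And>y. y \<in> carrier K \<Longrightarrow> g y \<in> carrier H" and hg: "\<And>y. y \<in> carrier K \<Longrightarrow> h (g y) = y"
    using h unfolding unitary_iso_def g_def bij_betw_def
    by (auto simp: inv_into_into f_inv_into_f)
  have hadd: "\<And>x y. x \<in> carrier H \<Longrightarrow> y \<in> carrier H \<Longrightarrow> h (x \<oplus> y) = h x \<oplus>\<^bsub>K\<^esub> h y"
    and hsm: "\<And>c x. x \<in> carrier H \<Longrightarrow> h (c \<odot> x) = c \<odot>\<^bsub>K\<^esub> h x"
    and hip: "\<And>x y. x \<in> carrier H \<Longrightarrow> y \<in> carrier H \<Longrightarrow> ip K (h x) (h y) = ip H x y"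
    using h by (auto simp: unitary_iso_def)
  have add: "x \<oplus>\<^bsub>K\<^esub> y = h (g x \<oplus> g y)" if "x \<in> carrier K" "y \<in> carrier K" for x y
    using hadd[of "g x" "g y"] that by (simp add: gc hg)
  have sm: "c \<odot>\<^bsub>K\<^esub> x = h (c \<odot> g x)" if "x \<in> carrier K" for c x
    using hsm[of "g x" c] that by (simp add: gc hg)
  have ip: "ip K x y = ip H (g x) (g y)" if "x \<in> carrier K" "y \<in> carrier K" for x y
    using hip[of "g x" "g y"] that by (simp add: gc hg)
  note t = add sm ip h0[symmetric] hc gh gc hg
  show ?thesis
  proof (rule hilbert_spaceI)
    fix X assume X: "\<And>n::nat. X n \<in> carrier K"
      and cau: "\<And>e. 0 < e \<Longrightarrow> \<exists>N. \<forall>m\<ge>N. \<forall>n\<ge>N. hnorm K (X m \<oplus>\<^bsub>K\<^esub> (-1) \<odot>\<^bsub>K\<^esub> X n) < e"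
    have e: "hnorm K (x \<oplus>\<^bsub>K\<^esub> (-1) \<odot>\<^bsub>K\<^esub> y) = hnorm H (g x \<ominus> g y)" if "x \<in> carrier K" "y \<in> carrier K" for x y
      using that by (simp add: t hnorm_def diff_eq)
    have "\<exists>x\<in>carrier H. (\<lambda>n. hnorm H (g (X n) \<ominus> x)) \<longlonglongrightarrow> 0"
      by (rule complete) (use X cau in \<open>simp_all add: gc e\<close>)
    then obtain x where "x \<in> carrier H" "(\<lambda>n. hnorm H (g (X n) \<ominus> x)) \<longlonglongrightarrow> 0" by blast
    thus "\<exists>x\<in>carrier K. (\<lambda>n. hnorm K (X n \<oplus>\<^bsub>K\<^esub> (-1) \<odot>\<^bsub>K\<^esub> x)) \<longlonglongrightarrow> 0"
      using X by (intro bexI[of _ "h x"]) (simp_all add: e hc gh)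
  next
    fix x y assume xy: "x \<in> carrier K" "y \<in> carrier K"
    show "x \<oplus>\<^bsub>K\<^esub> y = y \<oplus>\<^bsub>K\<^esub> x" using xy M.a_comm[of "g x" "g y"] by (simp add: t)
    show "ip K y x = cnj (ip K x y)" using xy ip_cnj[of "g x" "g y"] by (simp add: t)
  next
    fix x assume x: "x \<in> carrier K"
    show "0 \<odot>\<^bsub>K\<^esub> x = \<zero>\<^bsub>K\<^esub>" using x zero_eq_smult[of "g x", symmetric] by (simp add: sm gc h0)
    show "1 \<odot>\<^bsub>K\<^esub> x = x" using x smult_one[of "g x"] by (simp add: t)
    show "0 \<le> ip K x x" using x ip_nonneg[of "g x"] by (simp add: t)
    show "x = \<zero>\<^bsub>K\<^esub>" if "ip K x x = 0"
      using x that ip_definite[of "g x"] hg[OF x] by (simp add: ip gc h0)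
    show "(c * d) \<odot>\<^bsub>K\<^esub> x = c \<odot>\<^bsub>K\<^esub> (d \<odot>\<^bsub>K\<^esub> x)" for c d
      using x smult_assoc1[of c d "g x"] by (simp add: t)
    show "(c + d) \<odot>\<^bsub>K\<^esub> x = c \<odot>\<^bsub>K\<^esub> x \<oplus>\<^bsub>K\<^esub> d \<odot>\<^bsub>K\<^esub> x" for c d
      using x smult_l_distr[of c d "g x"] by (simp add: t)
  next
    fix c x y assume xy: "x \<in> carrier K" "y \<in> carrier K"
    show "c \<odot>\<^bsub>K\<^esub> (x \<oplus>\<^bsub>K\<^esub> y) = c \<odot>\<^bsub>K\<^esub> x \<oplus>\<^bsub>K\<^esub> c \<odot>\<^bsub>K\<^esub> y"
      using xy smult_r_distr[of c "g x" "g y"] by (simp add: t)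
  next
    show "\<zero>\<^bsub>K\<^esub> \<in> carrier K" using hc[of \<zero>] h0 by simp
  next
    fix x y z assume xyz: "x \<in> carrier K" "y \<in> carrier K" "z \<in> carrier K"
    show "(x \<oplus>\<^bsub>K\<^esub> y) \<oplus>\<^bsub>K\<^esub> z = x \<oplus>\<^bsub>K\<^esub> (y \<oplus>\<^bsub>K\<^esub> z)"
      using xyz by (simp add: t M.a_assoc)
    show "ip K (x \<oplus>\<^bsub>K\<^esub> y) z = ip K x z + ip K y z" using xyz by (simp add: t ip_add)
  qed (simp_all add: t ip_smult)
qed

section \<open>Coordinate spaces and orthogonal complements of a vector\<close>

lemma Cn_simps [simp]:
  "carrier (Cn n) = Coord ` carrier_vec n" "zero (Cn n) = Coord (0\<^sub>v n)"
  "add (Cn n) (Coord u) (Coord v) = Coord (u + v)" "smult (Cn n) c (Coord u) = Coord (c \<cdot>\<^sub>v u)"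
  "ip (Cn n) (Coord u) (Coord v) = u \<bullet>c v"
  by (simp_all add: Cn_def)

lemma inner_vec_eq_sum:
  assumes "u \<in> carrier_vec n" "v \<in> carrier_vec n"
  shows "u \<bullet>c v = (\<Sum>i<n. u $ i * cnj (v $ i))"
  using assms by (simp add: scalar_prod_def lessThan_atLeast0)

lemma inner_vec_self:
  assumes "u \<in> carrier_vec n"
  shows "u \<bullet>c u = of_real (\<Sum>i<n. (cmod (u $ i))\<^sup>2)"
  unfolding inner_vec_eq_sum[OF assms assms] of_real_sum
  by (intro sum.cong refl) (metis complex_norm_square)

lemma hnorm_Cn:
  assumes "u \<in> carrier_vec n"
  shows "hnorm (Cn n) (Coord u) = sqrt (\<Sum>i<n. (cmod (u $ i))\<^sup>2)"
  unfolding hnorm_def by (simp add: inner_vec_self[OF assms] del: of_real_sum)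

lemma hilbert_space_Cn: "hilbert_space (Cn n)"
proof (rule hilbert_spaceI)
  fix X :: "nat \<Rightarrow> 'a univ"
  assume X: "\<And>k. X k \<in> carrier (Cn n)"
    and cau: "\<And>e. 0 < e \<Longrightarrow> \<exists>N. \<forall>j\<ge>N. \<forall>k\<ge>N. hnorm (Cn n) (X j \<oplus>\<^bsub>Cn n\<^esub> (-1) \<odot>\<^bsub>Cn n\<^esub> X k) < e"
  have "\<forall>k. \<exists>v\<in>carrier_vec n. X k = Coord v" using X by auto
  then obtain v where v: "\<And>k. v k \<in> carrier_vec n" "\<And>k. X k = Coord (v k)" by metis
  have n: "hnorm (Cn n) (X j \<oplus>\<^bsub>Cn n\<^esub> (-1) \<odot>\<^bsub>Cn n\<^esub> Coord w) = sqrt (\<Sum>i<n. (cmod (v j $ i - w $ i))\<^sup>2)"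
    if w: "w \<in> carrier_vec n" for j w
  proof -
    have "v j + (-1) \<cdot>\<^sub>v w \<in> carrier_vec n" using v w by auto
    from hnorm_Cn[OF this] show ?thesis using v(1)[of j] w by (simp add: v(2))
  qed
  have "Cauchy (\<lambda>k. v k $ i)" if i: "i < n" for i
  proof (rule metric_CauchyI)
    fix e :: real assume "0 < e"
    from cau[OF this] obtain N where
      N: "\<And>j k. j \<ge> N \<Longrightarrow> k \<ge> N \<Longrightarrow> hnorm (Cn n) (X j \<oplus>\<^bsub>Cn n\<^esub> (-1) \<odot>\<^bsub>Cn n\<^esub> Coord (v k)) < e"
      unfolding v(2)[symmetric] by blast
    have "dist (v j $ i) (v k $ i) < e" if jk: "j \<ge> N" "k \<ge> N" for j k
    proof -
      have "cmod (v j $ i - v k $ i) \<le> sqrt (\<Sum>i<n. (cmod (v j $ i - v k $ i))\<^sup>2)"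
        using i by (intro real_le_rsqrt member_le_sum) auto
      thus ?thesis using N[OF jk] unfolding n[OF v(1)] dist_norm by linarith
    qed
    thus "\<exists>N. \<forall>j\<ge>N. \<forall>k\<ge>N. dist (v j $ i) (v k $ i) < e" by blast
  qed
  hence "\<exists>l. (\<lambda>k. v k $ i) \<longlonglongrightarrow> l" if "i < n" for i
    using that Cauchy_convergent convergent_def by blast
  then obtain l where l: "\<And>i. i < n \<Longrightarrow> (\<lambda>k. v k $ i) \<longlonglongrightarrow> l i" by metis
  have "(\<lambda>k. sqrt (\<Sum>i<n. (cmod (v k $ i - l i))\<^sup>2)) \<longlonglongrightarrow> sqrt (\<Sum>i<n. (cmod (l i - l i))\<^sup>2)"
    by (intro tendsto_intros l) auto
  moreover have "hnorm (Cn n) (X k \<oplus>\<^bsub>Cn n\<^esub> (-1) \<odot>\<^bsub>Cn n\<^esub> Coord (vec n l)) = sqrt (\<Sum>i<n. (cmod (v k $ i - l i))\<^sup>2)" for k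
    by (subst n) auto
  ultimately have "(\<lambda>k. hnorm (Cn n) (X k \<oplus>\<^bsub>Cn n\<^esub> (-1) \<odot>\<^bsub>Cn n\<^esub> Coord (vec n l))) \<longlonglongrightarrow> 0"
    by (simp del: Cn_simps)
  thus "\<exists>x\<in>carrier (Cn n). (\<lambda>k. hnorm (Cn n) (X k \<oplus>\<^bsub>Cn n\<^esub> (-1) \<odot>\<^bsub>Cn n\<^esub> x)) \<longlonglongrightarrow> 0"
    by (intro bexI[of _ "Coord (vec n l)"]) auto
next
  fix x :: "'a univ" assume "x \<in> carrier (Cn n)"
  then obtain u where u: "u \<in> carrier_vec n" "x = Coord u" by auto
  show "0 \<le> ip (Cn n) x x" using u by (simp add: inner_vec_self less_eq_complex_def sum_nonneg del: of_real_sum)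
  show "x = \<zero>\<^bsub>Cn n\<^esub>" if "ip (Cn n) x x = 0"
  proof -
    have "(\<Sum>i<n. (cmod (u $ i))\<^sup>2) = 0" using that u by (simp add: inner_vec_self del: of_real_sum)
    hence "\<forall>i<n. u $ i = 0" by (subst (asm) sum_nonneg_eq_0_iff) auto
    thus ?thesis using u by (auto intro!: eq_vecI)
  qed
next
  fix x y :: "'a univ" assume "x \<in> carrier (Cn n)" "y \<in> carrier (Cn n)"
  then obtain u w where u: "u \<in> carrier_vec n" "x = Coord u" and w: "w \<in> carrier_vec n" "y = Coord w" by auto
  show "ip (Cn n) y x = cnj (ip (Cn n) x y)" using u w by (simp add: inner_vec_eq_sum[of _ n] mult.commute)
  show "ip (Cn n) (c \<odot>\<^bsub>Cn n\<^esub> x) y = c * ip (Cn n) x y" for c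
    using u w by (simp add: inner_vec_eq_sum[of _ n] sum_distrib_left mult.assoc)
next
  fix x y z :: "'a univ" assume "x \<in> carrier (Cn n)" "y \<in> carrier (Cn n)" "z \<in> carrier (Cn n)"
  then obtain u w t where u: "u \<in> carrier_vec n" "x = Coord u" and w: "w \<in> carrier_vec n" "y = Coord w"
    and t: "t \<in> carrier_vec n" "z = Coord t" by auto
  show "ip (Cn n) (x \<oplus>\<^bsub>Cn n\<^esub> y) z = ip (Cn n) x z + ip (Cn n) y z" 
    using u w t by (simp add: inner_vec_eq_sum[of _ n] sum.distrib distrib_right)
  show "(x \<oplus>\<^bsub>Cn n\<^esub> y) \<oplus>\<^bsub>Cn n\<^esub> z = x \<oplus>\<^bsub>Cn n\<^esub> (y \<oplus>\<^bsub>Cn n\<^esub> z)"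
    using u w t by (auto intro!: eq_vecI)
qed (auto simp: smult_add_distrib_vec add_smult_distrib_vec smult_smult_assoc comm_add_vec[of _ n] intro!: eq_vecI)

text \<open>Only the carrier changes, so vectors of a basis of \<open>H\<close> and coefficient
  functions on them can be reused in the complement without renaming.\<close>

definition perp :: "'v ip_space \<Rightarrow> 'v \<Rightarrow> 'v ip_space" where
  "perp H b = H\<lparr>carrier := {x \<in> carrier H. ip H x b = 0}\<rparr>"

lemma perp_simps [simp]:
  "carrier (perp H b) = {x \<in> carrier H. ip H x b = 0}" "zero (perp H b) = zero H" "add (perp H b) = add H"
  "smult (perp H b) = smult H" "ip (perp H b) = ip H"
  by (simp_all add: perp_def)

lemma hnorm_perp [simp]: "hnorm (perp H b) = hnorm H"
  by (simp add: hnorm_def fun_eq_iff)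

context hilbert_space
begin

lemma hilbert_space_perp:
  assumes b: "b \<in> carrier H"
  shows "hilbert_space (perp H b)"
proof (rule hilbert_spaceI)
  let ?K = "perp H b"
  have cl: "closed_subspace (carrier ?K)"
    using closed_subspace_orthogonal[of "{b}"] b by simp
  fix X assume X: "\<And>n::nat. X n \<in> carrier ?K"
    and cau: "\<And>e. 0 < e \<Longrightarrow> \<exists>N. \<forall>m\<ge>N. \<forall>n\<ge>N. hnorm ?K (X m \<oplus>\<^bsub>?K\<^esub> (-1) \<odot>\<^bsub>?K\<^esub> X n) < e"
  have Xc: "X n \<in> carrier H" for n using X[of n] by simp
  have "\<exists>x\<in>carrier H. (\<lambda>n. hnorm H (X n \<ominus> x)) \<longlonglongrightarrow> 0"
    by (rule complete) (use Xc cau in \<open>simp_all add: diff_eq\<close>)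
  then obtain x where x: "hlim X x" using Xc by (auto simp: hlim_def)
  hence "x \<in> carrier ?K" using closed_subspaceD(4)[OF cl] X by blast
  thus "\<exists>x\<in>carrier ?K. (\<lambda>n. hnorm ?K (X n \<oplus>\<^bsub>?K\<^esub> (-1) \<odot>\<^bsub>?K\<^esub> x)) \<longlonglongrightarrow> 0"
    using x Xc by (auto simp: hlim_def diff_eq)
next
  fix x y assume "x \<in> carrier (perp H b)" "y \<in> carrier (perp H b)"
  thus "x \<oplus>\<^bsub>perp H b\<^esub> y = y \<oplus>\<^bsub>perp H b\<^esub> x" by (simp add: M.a_comm)
  show "ip (perp H b) y x = cnj (ip (perp H b) x y)" 
    using \<open>x \<in> carrier (perp H b)\<close> \<open>y \<in> carrier (perp H b)\<close> ip_cnj[of x y] by simp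
next
  fix x assume "x \<in> carrier (perp H b)"
  hence x: "x \<in> carrier H" by simp
  show "0 \<odot>\<^bsub>perp H b\<^esub> x = \<zero>\<^bsub>perp H b\<^esub>" using zero_eq_smult[OF x, symmetric] by simp
  show "1 \<odot>\<^bsub>perp H b\<^esub> x = x" using smult_one[of x] x by simp
  show "0 \<le> ip (perp H b) x x" using x ip_nonneg by simp
  show "(c * d) \<odot>\<^bsub>perp H b\<^esub> x = c \<odot>\<^bsub>perp H b\<^esub> (d \<odot>\<^bsub>perp H b\<^esub> x)" for c d
    using x smult_assoc1[of c d x] by simp
  show "(c + d) \<odot>\<^bsub>perp H b\<^esub> x = c \<odot>\<^bsub>perp H b\<^esub> x \<oplus>\<^bsub>perp H b\<^esub> d \<odot>\<^bsub>perp H b\<^esub> x" for c d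
    using x smult_l_distr[of c d x] by simp
  show "ip (perp H b) x x = 0 \<Longrightarrow> x = \<zero>\<^bsub>perp H b\<^esub>" using ip_definite[OF x] by simp
next
  fix c x y assume "x \<in> carrier (perp H b)" "y \<in> carrier (perp H b)"
  thus "c \<odot>\<^bsub>perp H b\<^esub> (x \<oplus>\<^bsub>perp H b\<^esub> y) = c \<odot>\<^bsub>perp H b\<^esub> x \<oplus>\<^bsub>perp H b\<^esub> c \<odot>\<^bsub>perp H b\<^esub> y"
    using smult_r_distr[of c x y] by simp
qed (use b in \<open>simp_all add: ip_add ip_smult M.a_assoc\<close>)

lemma orthonormal_basis_perp:
  assumes B: "orthonormal_basis H B" and b: "b \<in> B"
  shows "orthonormal_basis (perp H b) (B - {b})"
  using assms by (auto simp: orthonormal_basis_def)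

end

lemma (in hilbert_space) rank_op_cong:
  assumes "finite F" "F \<subseteq> carrier H" "\<And>b. b \<in> F \<Longrightarrow> a b = a' b"
  shows "rank_op H F a = rank_op H F a'"
proof
  fix x show "rank_op H F a x = rank_op H F a' x"
  proof (cases "x \<in> carrier H")
    case True
    thus ?thesis using assms by (intro ip_eqI) (simp_all add: rank_op_carrier ip_rank_op)
  qed (simp add: rank_op_def)
qed

section \<open>The standard basis and diagonal matrices\<close>

definition std_basis :: "nat \<Rightarrow> 'a univ set" where
  "std_basis n = (\<lambda>i. Coord (unit_vec n i)) ` {..<n}"

lemma unit_vec_eq_iff: "i < n \<Longrightarrow> j < n \<Longrightarrow> unit_vec n i = (unit_vec n j :: complex vec) \<longleftrightarrow> i = j"
  by (metis index_unit_vec(1) zero_neq_one)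

lemma inj_std_basis: "inj_on (\<lambda>i. Coord (unit_vec n i) :: 'a univ) {..<n}"
  by (auto simp: inj_on_def unit_vec_eq_iff)

lemma inner_unit_vec:
  fixes u :: "complex vec"
  assumes "u \<in> carrier_vec n" "i < n"
  shows "u \<bullet>c unit_vec n i = u $ i"
proof -
  have "u \<bullet>c unit_vec n i = (\<Sum>j<n. u $ j * cnj (if j = i then 1 else 0))"
    using assms by (subst inner_vec_eq_sum[of _ n]) auto
  also have "\<dots> = (\<Sum>j<n. if j = i then u $ j else 0)" by (intro sum.cong) auto
  finally show ?thesis using assms by simp
qed

lemma orthonormal_basis_std_basis: "orthonormal_basis (Cn n) (std_basis n)"
  unfolding orthonormal_basis_def
proof (intro conjI ballI impI)
  show "std_basis n \<subseteq> carrier (Cn n)" by (auto simp: std_basis_def)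
  show "ip (Cn n) e f = (if e = f then 1 else 0)" if "e \<in> std_basis n" "f \<in> std_basis n" for e f :: "'a univ"
    using that by (auto simp: std_basis_def inner_unit_vec unit_vec_eq_iff split: if_splits)
  fix x :: "'a univ" assume x: "x \<in> carrier (Cn n)" "\<forall>e\<in>std_basis n. ip (Cn n) x e = 0"
  then obtain u where u: "u \<in> carrier_vec n" "x = Coord u" by auto
  have "u $ i = 0" if "i < n" for i
    using x(2) u that inner_unit_vec[OF u(1) that] by (auto simp: std_basis_def)
  thus "x = \<zero>\<^bsub>Cn n\<^esub>" using u by (auto intro!: eq_vecI)
qed

lemma finite_std_basis [simp]: "finite (std_basis n)"
  by (simp add: std_basis_def)

text \<open>Converts coefficients indexed by positions into the coefficients indexed by vectors that
  \<open>rank_op\<close> expects.\<close>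

definition std_coeff :: "nat \<Rightarrow> (nat \<Rightarrow> real) \<Rightarrow> 'a univ \<Rightarrow> real" where
  "std_coeff n d = d \<circ> inv_into {..<n} (\<lambda>i. Coord (unit_vec n i))"

lemma std_coeff: "i < n \<Longrightarrow> std_coeff n d (Coord (unit_vec n i)) = d i"
  unfolding std_coeff_def o_def by (subst inv_into_f_f[OF inj_std_basis]) simp_all

text \<open>The bridge from homotopy invariance, which speaks of matrices, to the finite-rank
  operators on which a trace map is computed.\<close>

lemma mat_op_diag: "mat_op n (mat_diag n d) = rank_op (Cn n) (std_basis n) (std_coeff n d)"
proof
  interpret C: hilbert_space "Cn n :: 'a univ ip_space" by (rule hilbert_space_Cn)
  have sub: "std_basis n \<subseteq> carrier (Cn n)" by (auto simp: std_basis_def)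
  fix x :: "'a univ"
  show "mat_op n (mat_diag n d) x = rank_op (Cn n) (std_basis n) (std_coeff n d) x"
  proof (cases "x \<in> carrier (Cn n)")
    case True
    then obtain u where u: "u \<in> carrier_vec n" "x = Coord u" by auto
    obtain w where w: "w \<in> carrier_vec n" "rank_op (Cn n) (std_basis n) (std_coeff n d) x = Coord w"
      using C.rank_op_carrier[OF sub True] by auto
    have "w $ i = complex_of_real (d i) * u $ i" if i: "i < n" for i
    proof -
      have "w $ i = ip (Cn n :: 'a univ ip_space) (Coord w) (Coord (unit_vec n i))" using inner_unit_vec[OF w(1) i] by simp
      also have "\<dots> = (\<Sum>b\<in>std_basis n. complex_of_real (std_coeff n d b) * ip (Cn n) x b * ip (Cn n) b (Coord (unit_vec n i)))"
        unfolding w(2)[symmetric] by (rule C.ip_rank_op[OF finite_std_basis sub True]) simp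
      also have "\<dots> = (\<Sum>j<n. if j = i then complex_of_real (d j) * u $ j else 0)"
        unfolding std_basis_def sum.reindex[OF inj_std_basis] o_def
        using u i by (intro sum.cong refl) (simp add: std_coeff inner_unit_vec)
      finally show ?thesis using i by simp
    qed
    moreover have "map_mat complex_of_real (mat_diag n d) *\<^sub>v u = vec n (\<lambda>i. complex_of_real (d i) * u $ i)"
    proof (rule eq_vecI)
      fix i assume i: "i < dim_vec (vec n (\<lambda>i. complex_of_real (d i) * u $ i))"
      have "(map_mat complex_of_real (mat_diag n d) *\<^sub>v u) $ i = (\<Sum>j<n. complex_of_real (if i = j then d j else 0) * u $ j)"
        using u i by (simp add: scalar_prod_def mat_diag_def lessThan_atLeast0)
      also have "\<dots> = (\<Sum>j<n. if j = i then complex_of_real (d j) * u $ j else 0)"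
        by (intro sum.cong) auto
      finally have "(map_mat complex_of_real (mat_diag n d) *\<^sub>v u) $ i = complex_of_real (d i) * u $ i"
        using i by simp
      thus "(map_mat complex_of_real (mat_diag n d) *\<^sub>v u) $ i = vec n (\<lambda>i. complex_of_real (d i) * u $ i) $ i"
        using i by simp
    qed (simp add: mat_diag_def)
    ultimately show ?thesis using w u by (auto simp: mat_op_def intro!: eq_vecI)
  qed (simp add: mat_op_def rank_op_def)
qed

text \<open>Conjugation reduces to the intertwining relation h A = C h, with no inverse to compute;
  extensionality settles the points outside the carrier.\<close>

lemma conj_op_eqI:
  assumes h: "unitary_iso H K h" and C: "C \<in> extensional (carrier K)"
    and eq: "\<And>x. x \<in> carrier H \<Longrightarrow> h (A x) = C (h x)"
  shows "conj_op H K h A = C"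
proof
  fix y show "conj_op H K h A y = C y"
  proof (cases "y \<in> carrier K")
    case True
    moreover have "h ` carrier H = carrier K" using h by (simp add: unitary_iso_def bij_betw_def)
    ultimately obtain x where x: "x \<in> carrier H" "y = h x" by blast
    have "inv_into (carrier H) h (h x) = x"
      using h x by (auto simp: unitary_iso_def bij_betw_def)
    thus ?thesis using True x eq by (simp add: conj_op_def)
  qed (use C in \<open>simp add: conj_op_def extensional_def\<close>)
qed

text \<open>The isomorphism \<open>H \<cong> \<complex> \<oplus> b\<^sup>\<bottom>\<close> for a unit vector \<open>b\<close>.\<close>

definition split_map :: "'a univ ip_space \<Rightarrow> 'a univ \<Rightarrow> 'a univ \<Rightarrow> 'a univ" where
  "split_map H b x = Tup (Coord (vec 1 (\<lambda>_. ip H x b))) (x \<ominus>\<^bsub>H\<^esub> ip H x b \<odot>\<^bsub>H\<^esub> b)"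

lemma hsum_simps [simp]:
  "carrier (hsum H K) = {Tup x y | x y. x \<in> carrier H \<and> y \<in> carrier K}"
  "zero (hsum H K) = Tup \<zero>\<^bsub>H\<^esub> \<zero>\<^bsub>K\<^esub>"
  "add (hsum H K) (Tup x y) (Tup x' y') = Tup (x \<oplus>\<^bsub>H\<^esub> x') (y \<oplus>\<^bsub>K\<^esub> y')"
  "smult (hsum H K) c (Tup x y) = Tup (c \<odot>\<^bsub>H\<^esub> x) (c \<odot>\<^bsub>K\<^esub> y)"
  "ip (hsum H K) (Tup x y) (Tup x' y') = ip H x x' + ip K y y'"
  by (simp_all add: hsum_def)

lemma vec1_eq: "u \<in> carrier_vec 1 \<Longrightarrow> u = vec 1 (\<lambda>_. u $ 0)"
  by (auto intro!: eq_vecI)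

lemma inner_vec1: "vec 1 (\<lambda>_. x) \<bullet>c vec 1 (\<lambda>_. y) = x * cnj y"
  by (subst inner_vec_eq_sum[of _ 1]) auto

lemma
  fixes H :: "'a univ ip_space" (structure)
  assumes "hilbert_space H" and b: "b \<in> carrier H" "ip H b b = 1"
  shows unitary_iso_split_map: "unitary_iso H (hsum (Cn 1) (perp H b)) (split_map H b)"
    and split_map_zero: "split_map H b \<zero> = \<zero>\<^bsub>hsum (Cn 1) (perp H b)\<^esub>"
proof -
  interpret hilbert_space H by fact
  let ?K = "hsum (Cn 1) (perp H b)" and ?h = "split_map H b"
  \<comment> \<open>The inverse: the scalar coordinate times \<open>b\<close>, plus the component
    orthogonal to \<open>b\<close>.\<close>
  let ?g = "\<lambda>u. (coord (left u) $ 0) \<odot> b \<oplus> right u"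
  have hc: "?h x \<in> carrier ?K" if "x \<in> carrier H" for x
    using that b by (simp add: split_map_def ip_linear)
  have gh: "?g (?h x) = x" if "x \<in> carrier H" for x
    using that b by (intro ip_eqI) (auto simp: split_map_def ip_linear)
  have g: "?g y \<in> carrier H \<and> ?h (?g y) = y" if y: "y \<in> carrier ?K" for y
  proof -
    obtain u x where ux: "y = Tup (Coord u) x" "u \<in> carrier_vec 1" "x \<in> carrier H" "ip H x b = 0"
      using y by auto
    have "ip H (?g y) b = u $ 0" using ux b by (simp add: ip_linear)
    moreover have "(u $ 0 \<odot> b \<oplus> x) \<ominus> u $ 0 \<odot> b = x"
      using ux b by (intro ip_eqI) (auto simp: ip_linear)
    ultimately show ?thesis using ux b vec1_eq[OF ux(2)] by (simp add: split_map_def)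
  qed
  have bij: "bij_betw ?h (carrier H) (carrier ?K)"
    by (rule bij_betw_byWitness[where f' = ?g]) (use hc gh g in blast)+
  have "?h (x \<oplus> y) = ?h x \<oplus>\<^bsub>?K\<^esub> ?h y" if "x \<in> carrier H" "y \<in> carrier H" for x y
  proof -
    have "(x \<oplus> y) \<ominus> (ip H x b + ip H y b) \<odot> b = (x \<ominus> ip H x b \<odot> b) \<oplus> (y \<ominus> ip H y b \<odot> b)"
      using that b by (intro ip_eqI) (auto simp: ip_linear algebra_simps)
    thus ?thesis using that b by (auto simp: split_map_def ip_add intro!: eq_vecI)
  qed
  moreover have "?h (c \<odot> x) = c \<odot>\<^bsub>?K\<^esub> ?h x" if "x \<in> carrier H" for x c
  proof -
    have "c \<odot> x \<ominus> (c * ip H x b) \<odot> b = c \<odot> (x \<ominus> ip H x b \<odot> b)"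
      using that b by (intro ip_eqI) (auto simp: ip_linear algebra_simps)
    thus ?thesis using that b by (auto simp: split_map_def ip_smult intro!: eq_vecI)
  qed
  moreover have "ip ?K (?h x) (?h y) = ip H x y" if "x \<in> carrier H" "y \<in> carrier H" for x y
    using that b ip_cnj[of y b] by (simp add: split_map_def inner_vec1 ip_linear del: One_nat_def)
  ultimately show "unitary_iso H ?K ?h" using bij unfolding unitary_iso_def by blast
  have z: "\<zero> \<ominus> 0 \<odot> b = \<zero>" using b by (intro ip_eqI) (auto simp: ip_linear)
  show "?h \<zero> = \<zero>\<^bsub>?K\<^esub>"
    unfolding split_map_def ip_zero[OF b(1)] z by (auto intro!: eq_vecI)
qed

text \<open>As \<open>b\<close> is orthogonal to \<open>F\<close>, the operator is block diagonal
  with respect to the line of \<open>b\<close> and its complement: the scalar \<open>a b\<close> on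
  the former, the truncation to \<open>F\<close> on the latter.\<close>

lemma conj_op_split_map:
  fixes H :: "'a univ ip_space" (structure)
  assumes "hilbert_space H" and B: "orthonormal_basis H B" and F: "finite F" "insert b F \<subseteq> B" "b \<notin> F"
  shows "conj_op H (hsum (Cn 1) (perp H b)) (split_map H b) (rank_op H (insert b F) a)
    = op_dsum (Cn 1) (perp H b) (rank_op (Cn 1) (std_basis 1) (\<lambda>_. a b)) (rank_op (perp H b) F a)"
proof -
  interpret hilbert_space H by fact
  interpret C: hilbert_space "Cn 1 :: 'a univ ip_space" by (rule hilbert_space_Cn)
  have Bc: "B \<subseteq> carrier H" using B by (simp add: orthonormal_basis_def)
  have b: "b \<in> carrier H" "ip H b b = 1" using B F by (auto simp: orthonormal_basis_def)
  interpret P: hilbert_space "perp H b" by (rule hilbert_space_perp[OF b(1)])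
  have Fb: "ip H c b = 0" "ip H b c = 0" if "c \<in> F" for c using B F that by (auto simp: orthonormal_basis_def)
  have Fc: "F \<subseteq> carrier H" and FP: "F \<subseteq> carrier (perp H b)" using F Bc Fb by auto
  let ?A = "rank_op H (insert b F) a" and ?L = "rank_op (Cn 1 :: 'a univ ip_space) (std_basis 1) (\<lambda>_. a b)"
    and ?R = "rank_op (perp H b) F a"
  show ?thesis
  proof (rule conj_op_eqI[OF unitary_iso_split_map[OF assms(1) b]])
    fix x assume x: "x \<in> carrier H"
    let ?y = "x \<ominus> ip H x b \<odot> b"
    have y: "?y \<in> carrier (perp H b)" using x b by (simp add: ip_linear)
    have A: "ip H (?A x) z = a b * ip H x b * ip H b z + (\<Sum>c\<in>F. a c * ip H x c * ip H c z)" if "z \<in> carrier H" for z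
      using ip_rank_op[of "insert b F" x z a] F Fc b x that by simp
    have Ac: "?A x \<in> carrier H" using rank_op_carrier[of "insert b F"] Fc b x by simp
    have Ab: "ip H (?A x) b = a b * ip H x b"
      using A[OF b(1)] b Fb by simp
    have "?L (Coord (vec 1 (\<lambda>_. ip H x b))) = Coord (vec 1 (\<lambda>_. a b * ip H x b))"
    proof -
      have s: "std_basis 1 = {Coord (unit_vec 1 0) :: 'a univ}" by (auto simp: std_basis_def)
      have "vec 1 (\<lambda>_. ip H x b) \<bullet>c unit_vec 1 0 = ip H x b"
        by (subst inner_unit_vec) auto
      thus ?thesis
        unfolding s by (subst C.rank_op_singleton) (auto intro!: eq_vecI)
    qed
    moreover have "?A x \<ominus> (a b * ip H x b) \<odot> b = ?R ?y"
    proof (rule P.ip_eqI)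
      show 1: "?A x \<ominus> (a b * ip H x b) \<odot> b \<in> carrier (perp H b)"
        using Ac b Ab by (simp add: ip_linear)
      show 2: "?R ?y \<in> carrier (perp H b)" by (rule P.rank_op_carrier[OF FP y])
      fix z assume z: "z \<in> carrier (perp H b)"
      have "ip H (?R ?y) z = (\<Sum>c\<in>F. a c * ip H ?y c * ip H c z)"
        using P.ip_rank_op[OF F(1) FP y z] by simp
      also have "\<dots> = (\<Sum>c\<in>F. a c * ip H x c * ip H c z)"
        using x b Fc Fb by (intro sum.cong refl) (auto simp: ip_linear subset_iff)
      also have "\<dots> = ip H (?A x \<ominus> (a b * ip H x b) \<odot> b) z"
        using A[of z] Ac b z by (simp add: ip_linear)
      finally show "ip (perp H b) (?A x \<ominus> (a b * ip H x b) \<odot> b) z = ip (perp H b) (?R ?y) z" by simp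
    qed
    ultimately show "split_map H b (?A x) = op_dsum (Cn 1) (perp H b) ?L ?R (split_map H b x)"
      using x b y by (simp add: split_map_def Ab op_dsum_def)
  qed (simp add: op_dsum_def)
qed

section \<open>A polynomial homotopy of matrices\<close>

text \<open>The definite description requires that every orthogonal diagonalization give the same
  logarithm. From d_i S_ij = S_ij e_j, each entry has S_ij = 0 or d_i = e_j, so the relation
  survives taking logarithms. Thus ln(d) S = S ln(e), and multiplying by the transpose of S leaves
  ln(d).\<close>

lemma mat_log_diag:
  assumes d: "\<And>i. i < n \<Longrightarrow> 0 < d i"
  shows "mat_log n (mat_diag n d) = mat_diag n (\<lambda>i. ln (d i))"
  unfolding mat_log_def
proof (rule the_equality)
  show "\<exists>S\<in>carrier_mat n n. \<exists>D\<in>carrier_mat n n. inverts_mat S (transpose_mat S) \<and> inverts_mat (transpose_mat S) S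
     \<and> diagonal_mat D \<and> (\<forall>i<n. 0 < D $$ (i, i)) \<and> mat_diag n d = S * D * transpose_mat S
     \<and> mat_diag n (\<lambda>i. ln (d i)) = S * mat_diag n (\<lambda>i. ln (D $$ (i, i))) * transpose_mat S"
  proof (rule bexI[of _ "1\<^sub>m n"], rule bexI[of _ "mat_diag n d"], intro conjI)
    have D: "mat_diag n d \<in> carrier_mat n n" "mat_diag n (\<lambda>i. ln (mat_diag n d $$ (i, i))) \<in> carrier_mat n n"
      by (auto simp: mat_diag_def)
    show "mat_diag n (\<lambda>i. ln (d i)) = 1\<^sub>m n * mat_diag n (\<lambda>i. ln (mat_diag n d $$ (i, i))) * transpose_mat (1\<^sub>m n)"
      using D by (auto simp: mat_diag_def intro!: eq_matI)
  qed (use d in \<open>auto simp: mat_diag_def inverts_mat_def diagonal_mat_def\<close>)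
next
  fix L assume "\<exists>S\<in>carrier_mat n n. \<exists>D\<in>carrier_mat n n. inverts_mat S (transpose_mat S) \<and> inverts_mat (transpose_mat S) S
     \<and> diagonal_mat D \<and> (\<forall>i<n. 0 < D $$ (i, i)) \<and> mat_diag n d = S * D * transpose_mat S
     \<and> L = S * mat_diag n (\<lambda>i. ln (D $$ (i, i))) * transpose_mat S"
  then obtain S D where S: "S \<in> carrier_mat n n" and D: "D \<in> carrier_mat n n" 
    and inv: "S * transpose_mat S = 1\<^sub>m n" "transpose_mat S * S = 1\<^sub>m n" and "diagonal_mat D"
    and eq: "mat_diag n d = S * D * transpose_mat S"
    and L: "L = S * mat_diag n (\<lambda>i. ln (D $$ (i, i))) * transpose_mat S"
    by (auto simp: inverts_mat_def)
  define e where "e = (\<lambda>i. D $$ (i, i))"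
  have De: "D = mat_diag n e" using D \<open>diagonal_mat D\<close>
    by (auto simp: e_def mat_diag_def diagonal_mat_def intro!: eq_matI)
  have "mat_diag n d * S = S * D * (transpose_mat S * S)"
    unfolding eq using S D by (simp add: assoc_mult_mat[of _ n n _ n _ n])
  also have "\<dots> = S * mat_diag n e"
    unfolding inv De using S by (intro right_mult_one_mat[of _ n n] mult_carrier_mat[of _ n n]) simp_all
  finally have "mat_diag n d * S = S * mat_diag n e" .
  hence eig: "d i * S $$ (i, j) = S $$ (i, j) * e j" if "i < n" "j < n" for i j
    using that S by (simp add: mat_diag_mult_left[OF S] mat_diag_mult_right[OF S] mat_eq_iff)
  have "ln (d i) * S $$ (i, j) = S $$ (i, j) * ln (e j)" if "i < n" "j < n" for i j
    using eig[OF that] by (cases "S $$ (i, j) = 0") auto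
  hence "mat_diag n (\<lambda>i. ln (d i)) * S = S * mat_diag n (\<lambda>i. ln (e i))"
    using S by (auto simp: mat_diag_mult_left[OF S] mat_diag_mult_right[OF S] intro!: eq_matI)
  hence "L = mat_diag n (\<lambda>i. ln (d i)) * S * transpose_mat S"
    by (simp add: L e_def)
  also have "\<dots> = mat_diag n (\<lambda>i. ln (d i)) * (S * transpose_mat S)"
    using S by (intro assoc_mult_mat[of _ n n _ n _ n]) (auto simp: mat_diag_def)
  finally show "L = mat_diag n (\<lambda>i. ln (d i))" using inv by (simp add: mat_diag_def)
qed

lemma pos_def_symmetric_mat_diag:
  assumes d: "\<And>i. i < n \<Longrightarrow> 0 < d i"
  shows "pos_def_symmetric n (mat_diag n d)"
  unfolding pos_def_symmetric_def
proof (intro conjI ballI impI)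
  show "transpose_mat (mat_diag n d) = mat_diag n d" by (auto simp: mat_diag_def intro!: eq_matI)
  fix v :: "real vec" assume v: "v \<in> carrier_vec n" "v \<noteq> 0\<^sub>v n"
  then obtain k where k: "k < n" "v $ k \<noteq> 0" by (metis carrier_vecD eq_vecI index_zero_vec)
  have mv: "(mat_diag n d *\<^sub>v v) $ i = d i * v $ i" if i: "i < n" for i
  proof -
    have "(mat_diag n d *\<^sub>v v) $ i = (\<Sum>j<n. (if i = j then d j else 0) * v $ j)"
      using v i by (simp add: scalar_prod_def mat_diag_def lessThan_atLeast0)
    also have "\<dots> = (\<Sum>j<n. if j = i then d j * v $ j else 0)"
      by (intro sum.cong) auto
    finally show ?thesis using i by simp
  qed
  have "v \<bullet> (mat_diag n d *\<^sub>v v) = (\<Sum>i<n. v $ i * (mat_diag n d *\<^sub>v v) $ i)"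
    by (simp add: scalar_prod_def mat_diag_def lessThan_atLeast0)
  also have "\<dots> = (\<Sum>i<n. d i * (v $ i)\<^sup>2)"
    by (intro sum.cong refl) (simp add: mv power2_eq_square)
  also have "\<dots> > 0" using d k by (intro sum_pos2[of _ k]) (auto simp: less_imp_le)
  finally show "0 < v \<bullet> (mat_diag n d *\<^sub>v v)" .
qed (simp add: mat_diag_def)

text \<open>A path in \<open>SL\<^sub>2(\<real>[t])\<close> from the identity to \<open>diag(1/2, 2)\<close>, the product of the elementary matrices
  \<open>E\<^sub>1\<^sub>2(-t/2)\<close>, \<open>E\<^sub>2\<^sub>1(t)\<close>, \<open>E\<^sub>1\<^sub>2(t)\<close>, \<open>E\<^sub>2\<^sub>1(-t/2)\<close>.\<close>

definition homotopy_mat :: "real poly mat" where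
  "homotopy_mat = mat 2 2 (\<lambda>(i, j). if i \<noteq> j then [:0, 1/2, 0, -1/2:]
     else if i = 0 then [:1, 0, -3/4, 0, 1/4:] else [:1, 0, 1:])"

lemma homotopy_mat_carrier [simp]: "homotopy_mat \<in> carrier_mat 2 2"
  by (simp add: homotopy_mat_def)

lemma homotopy_mat_GL: "homotopy_mat \<in> GL_poly 2"
proof -
  \<comment> \<open>The adjugate, which is the inverse because the determinant is 1.\<close>
  define B :: "real poly mat" where "B = mat 2 2 (\<lambda>(i, j). if i \<noteq> j then [:0, -1/2, 0, 1/2:]
     else if i = 0 then [:1, 0, 1:] else [:1, 0, -3/4, 0, 1/4:])"
  have "homotopy_mat * B = 1\<^sub>m 2" "B * homotopy_mat = 1\<^sub>m 2"
    by (auto simp: homotopy_mat_def B_def scalar_prod_def less_2_cases_iff numeral_2_eq_2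
          one_pCons intro!: eq_matI)
  moreover have "B \<in> carrier_mat 2 2" by (simp add: B_def)
  ultimately have "invertible_mat homotopy_mat" unfolding invertible_mat_def inverts_mat_def
    using carrier_matD[OF homotopy_mat_carrier] by (auto intro!: exI[of _ B])
  thus ?thesis by (simp add: GL_poly_def)
qed

lemma mat_eval_homotopy_mat:
  "mat_eval homotopy_mat 0 = mat_diag 2 (\<lambda>_. 1)"
  "mat_eval homotopy_mat 1 = mat_diag 2 (\<lambda>i. if i = 0 then 1/2 else 2)"
  by (auto simp: mat_eval_def homotopy_mat_def mat_diag_def less_2_cases_iff
        intro!: eq_matI)

lemma mat_diag_const_commute:
  fixes c :: "'b :: comm_ring_1"
  assumes "A \<in> carrier_mat n n"
  shows "mat_diag n (\<lambda>_. c) * A = A * mat_diag n (\<lambda>_. c)"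
  using assms by (auto simp: mat_diag_mult_left mat_diag_mult_right mult.commute intro!: eq_matI)

text \<open>The logarithm of this scalar matrix is \<open>a\<close> times the identity, so arbitrary
  real scalars can be put into the coordinates that the homotopy leaves alone.\<close>

lemma const_GL_poly: "mat_diag n (\<lambda>_. [:exp a:]) \<in> GL_poly n"
proof -
  have "mat_diag n (\<lambda>_. [:exp a:]) * mat_diag n (\<lambda>_. [:exp (-a):]) = 1\<^sub>m n" for a :: real
    by (subst mat_diag_diag) (auto simp: mat_diag_def one_pCons exp_minus intro!: eq_matI)
  from this[of a] this[of "-a"] show ?thesis
    unfolding GL_poly_def invertible_mat_def inverts_mat_def
    by (auto simp: mat_diag_def intro!: exI[of _ "mat_diag n (\<lambda>_. [:exp (-a):])"])
qed

lemma mat_eval_mat_diag: "mat_eval (mat_diag n p) t = mat_diag n (\<lambda>i. poly (p i) t)"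
  by (auto simp: mat_eval_def mat_diag_def intro!: eq_matI)

text \<open>Additivity makes \<open>h\<close> vanish on all integer multiples of p / n. Some such
  multiple lies within p / n of \<open>x\<close>, and \<open>h\<close> takes the same value at
  \<open>x\<close> as at the difference, which is small by continuity at 0.\<close>

lemma additive_eq_zero:
  fixes h :: "real \<Rightarrow> real"
  assumes add: "\<And>x y. h (x + y) = h x + h y" and "h p = 0" "0 < p"
    and cont: "\<And>e. 0 < e \<Longrightarrow> \<exists>d>0. \<forall>x. \<bar>x\<bar> < d \<longrightarrow> \<bar>h x\<bar> < e"
  shows "h x = 0"
proof (rule ccontr)
  assume "h x \<noteq> 0"
  then obtain d where d: "0 < d" "\<And>x'. \<bar>x'\<bar> < d \<Longrightarrow> \<bar>h x'\<bar> < \<bar>h x\<bar>"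
    using cont[of "\<bar>h x\<bar>"] by auto
  have h0: "h 0 = 0" using add[of 0 0] by simp
  have hn: "h (real n * y) = real n * h y" for n y
    by (induction n) (simp_all add: h0 add distrib_right)
  have hm: "h (- y) = - h y" for y using add[of y "-y"] h0 by simp
  have hi: "h (of_int m * y) = of_int m * h y" for m y
    by (cases m rule: int_cases2) (simp_all add: hn hm)
  obtain n :: nat where n: "0 < n" "p / real n < d"
  proof -
    obtain n :: nat where "p / d < real n" using reals_Archimedean2 by blast
    moreover have "0 < p / d" using d assms by simp
    ultimately show ?thesis using that[of n] d(1) by (cases "n = 0") (simp_all add: field_simps)
  qed
  define m where "m = \<lfloor>x * real n / p\<rfloor>"
  have m: "of_int m \<le> x * real n / p" "x * real n / p < of_int m + 1" unfolding m_def by linarith+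
  \<comment> \<open>The largest multiple of p / n not above \<open>x\<close>, so that 0 <= x - y < p
    / n < d.\<close>
  define y where "y = of_int m * p / real n"
  have "real n * h y = h (of_int m * p)" using hn[of n y] n by (simp add: y_def)
  hence hy: "h y = 0" using hi[of m p] assms n by simp
  have xy: "x - y = (x * real n / p - of_int m) * (p / real n)"
    using n assms by (simp add: y_def field_simps)
  have "0 \<le> x - y" unfolding xy using m n assms by (intro mult_nonneg_nonneg) auto
  moreover have "x - y < 1 * (p / real n)"
    unfolding xy using m n assms by (intro mult_strict_right_mono) auto
  ultimately have "\<bar>h (x - y)\<bar> < \<bar>h x\<bar>" using n by (intro d) auto
  moreover have "h x = h (x - y) + h y" using add[of "x - y" y] by simp
  ultimately show False using hy by simp
qed

section \<open>Trace maps\<close>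

lemma rank_op_in_symbols:
  assumes "hilbert_space H" "orthonormal_basis H B" "finite F" "F \<subseteq> B"
  shows "(map (rank_op H F) as, H) \<in> symbols (length as)"
  using hilbert_space.rank_op_symbol[OF assms] assms(1) by (auto simp: symbols_def)

lemma (in hilbert_space) rank_op_diff:
  assumes "finite F" "F \<subseteq> carrier H"
  shows "op_diff H (rank_op H F a) (rank_op H F a') = rank_op H F (\<lambda>b. a b - a' b)"
proof
  fix x show "op_diff H (rank_op H F a) (rank_op H F a') x = rank_op H F (\<lambda>b. a b - a' b) x"
  proof (cases "x \<in> carrier H")
    case True
    have "rank_op H F a x \<ominus> rank_op H F a' x = rank_op H F (\<lambda>b. a b - a' b) x"
      using True assms by (intro ip_eqI)
        (simp_all add: rank_op_carrier ip_rank_op ip_diff left_diff_distrib sum_subtractf)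
    thus ?thesis using True by (simp add: op_diff_def)
  qed (simp add: op_diff_def rank_op_def)
qed

locale hilbert_trace_map =
  fixes l :: nat and \<psi> :: "'a symbol \<Rightarrow> real"
  assumes trace_map: "trace_map l \<psi>"
begin

lemma rank_op_additive:
  assumes H: "hilbert_space H" and B: "orthonormal_basis H B" and F: "finite F" "F \<subseteq> B"
    and as: "length as = l" "i < l"
  shows "\<psi> (map (rank_op H F) (as[i := \<lambda>b. (as ! i) b + a b]), H)
    = \<psi> (map (rank_op H F) as, H) + \<psi> (map (rank_op H F) (as[i := a]), H)"
proof -
  have Fc: "F \<subseteq> carrier H" using B F by (auto simp: orthonormal_basis_def)
  \<comment> \<open>\<open>coordinatewise_additive\<close> expresses that the added operator
    commutes with all others through a symbol of length \<open>Suc l\<close>; here every entry is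
    diagonal in \<open>B\<close>.\<close>
  have fib: "map (rank_op H F) as @ [rank_op H F a] \<in> fibre (Suc l) H"
    using rank_op_in_symbols[OF H B F, of "as @ [a]"] as by (simp add: fibre_def)
  have "coordinatewise_additive l \<psi>" using trace_map by (simp add: trace_map_def)
  hence "\<psi> ((map (rank_op H F) as)[i := op_add H (map (rank_op H F) as ! i) (rank_op H F a)], H)
    = \<psi> (map (rank_op H F) as, H) + \<psi> ((map (rank_op H F) as)[i := rank_op H F a], H)"
    unfolding coordinatewise_additive_def using as fib by (metis length_map)
  thus ?thesis using as hilbert_space.rank_op_add[OF H F(1) Fc]
    by (simp add: map_update)
qed

text \<open>Additivity for 0 + 0 in coordinate \<open>i\<close> makes the value equal to its double.
  With \<open>F\<close> empty it starts the induction in \<open>rank_op_value\<close>.\<close>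

lemma rank_op_zero:
  assumes H: "hilbert_space H" and B: "orthonormal_basis H B" and F: "finite F" "F \<subseteq> B"
    and as: "length as = l" "i < l" and z: "\<And>b. b \<in> F \<Longrightarrow> (as ! i) b = 0"
  shows "\<psi> (map (rank_op H F) as, H) = 0"
proof -
  have Fc: "F \<subseteq> carrier H" using B F by (auto simp: orthonormal_basis_def)
  have "rank_op H F (\<lambda>b. (as ! i) b + (as ! i) b) = rank_op H F (as ! i)"
    by (rule hilbert_space.rank_op_cong[OF H F(1) Fc]) (simp add: z)
  hence "map (rank_op H F) (as[i := \<lambda>b. (as ! i) b + (as ! i) b]) = map (rank_op H F) as"
    using as by (simp add: map_update list_update_same_conv)
  thus ?thesis using rank_op_additive[OF H B F as, of "as ! i"] as by simp
qed

text \<open>The function g of the overview, with its arguments as a list.\<close>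

definition scalar_value :: "real list \<Rightarrow> real" where
  "scalar_value xs = \<psi> (map (\<lambda>x. rank_op (Cn 1) (std_basis 1) (\<lambda>_. x)) xs, Cn 1)"

text \<open>Unitary invariance along \<open>split_map\<close> replaces \<open>H\<close> by the sum
  of a line and its complement; the homomorphism property then separates the two.\<close>

lemma split_off_line:
  assumes H: "hilbert_space H" and B: "orthonormal_basis H B" and F: "finite F" "insert b F \<subseteq> B" "b \<notin> F"
    and as: "length as = l"
  shows "\<psi> (map (rank_op H (insert b F)) as, H)
    = scalar_value (map (\<lambda>a. a b) as) + \<psi> (map (rank_op (perp H b) F) as, perp H b)"
proof -
  interpret hilbert_space H by fact
  have b: "b \<in> carrier H" "ip H b b = 1" using B F by (auto simp: orthonormal_basis_def)
  let ?L = "Cn 1 :: 'a univ ip_space" and ?P = "perp H b" and ?h = "split_map H b"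
  let ?K = "hsum ?L ?P"
  note u = unitary_iso_split_map[OF H b] and P = hilbert_space_perp[OF b(1)]
  have "\<psi> (map (rank_op H (insert b F)) as, H) = \<psi> (map (conj_op H ?K ?h) (map (rank_op H (insert b F)) as), ?K)"
  proof -
    have "hilbert_space ?K" by (rule unitary_iso_hilbert_space[OF H u split_map_zero[OF H b]])
    moreover have "map (rank_op H (insert b F)) as \<in> fibre l H"
      using rank_op_in_symbols[OF H B _ F(2), of as] F as by (simp add: fibre_def)
    ultimately show ?thesis
      using trace_map H u unfolding trace_map_def unitarily_invariant_def by blast
  qed
  also have "(map (conj_op H ?K ?h) (map (rank_op H (insert b F)) as), ?K)
    = symbol_add (map (\<lambda>a. rank_op ?L (std_basis 1) (\<lambda>_. a b)) as, ?L) (map (rank_op ?P F) as, ?P)"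
    using conj_op_split_map[OF H B F] by (auto simp: comp_def intro!: nth_equalityI)
  also have "\<psi> \<dots> = scalar_value (map (\<lambda>a. a b) as) + \<psi> (map (rank_op ?P F) as, ?P)"
  proof -
    have "(map (rank_op ?P F) as, ?P) \<in> symbols l"
      using rank_op_in_symbols[OF P orthonormal_basis_perp[OF B, of b] F(1), of as] F as by auto
    moreover have "(map (\<lambda>a. rank_op ?L (std_basis 1) (\<lambda>_. a b)) as, ?L) \<in> symbols l"
      using rank_op_in_symbols[OF hilbert_space_Cn orthonormal_basis_std_basis finite_std_basis subset_refl,
          where as = "map (\<lambda>a _. a b) as"] as by (simp add: comp_def)
    moreover have "\<forall>s\<in>symbols l. \<forall>t\<in>symbols l. \<psi> (symbol_add s t) = \<psi> s + \<psi> t"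
      using trace_map by (simp add: trace_map_def monoid_hom_def)
    ultimately have "\<psi> (symbol_add (map (\<lambda>a. rank_op ?L (std_basis 1) (\<lambda>_. a b)) as, ?L) (map (rank_op ?P F) as, ?P))
        = \<psi> (map (\<lambda>a. rank_op ?L (std_basis 1) (\<lambda>_. a b)) as, ?L) + \<psi> (map (rank_op ?P F) as, ?P)"
      by blast
    thus ?thesis by (simp add: scalar_value_def comp_def del: symbol_add.simps)
  qed
  finally show ?thesis .
qed

text \<open>Each step of the induction passes to the complement of one basis vector, so the space
  and its basis have to vary.\<close>

lemma rank_op_value:
  assumes "finite F" "hilbert_space H" "orthonormal_basis H B" "F \<subseteq> B" "length as = l" "1 \<le> l"
  shows "\<psi> (map (rank_op H F) as, H) = (\<Sum>b\<in>F. scalar_value (map (\<lambda>a. a b) as))"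
  using assms
proof (induction F arbitrary: H B rule: finite_induct)
  case empty
  thus ?case using rank_op_zero[of H B "{}" as 0] by simp
next
  case (insert b F)
  have "b \<in> carrier H" using insert.prems by (auto simp: orthonormal_basis_def)
  moreover have "\<psi> (map (rank_op (perp H b) F) as, perp H b) = (\<Sum>b\<in>F. scalar_value (map (\<lambda>a. a b) as))"
    using insert.prems insert.hyps calculation
    by (intro insert.IH[of _ "B - {b}"] hilbert_space.hilbert_space_perp hilbert_space.orthonormal_basis_perp) auto
  ultimately show ?case
    using split_off_line[OF insert.prems(1,2) insert.hyps(1) insert.prems(3) insert.hyps(2) insert.prems(4)]
      insert.hyps by simp
qed

lemma mat_diag_value:
  assumes "length ds = l" "1 \<le> l"
  shows "\<psi> (map (\<lambda>d. mat_op n (mat_diag n d)) ds, Cn n) = (\<Sum>i<n. scalar_value (map (\<lambda>d. d i) ds))"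
proof -
  have "\<psi> (map (\<lambda>d. mat_op n (mat_diag n d)) ds, Cn n)
    = \<psi> (map (rank_op (Cn n) (std_basis n)) (map (std_coeff n) ds), Cn n)"
    by (simp add: mat_op_diag comp_def)
  also have "\<dots> = (\<Sum>b\<in>(std_basis n :: 'a univ set). scalar_value (map (\<lambda>a. a b) (map (std_coeff n) ds)))"
    using assms by (intro rank_op_value[OF _ hilbert_space_Cn orthonormal_basis_std_basis]) auto
  also have "\<dots> = (\<Sum>i<n. scalar_value (map (\<lambda>d. d i) ds))"
    unfolding std_basis_def sum.reindex[OF inj_std_basis]
    by (intro sum.cong refl) (simp add: std_coeff comp_def)
  finally show ?thesis .
qed

lemma scalar_value_add:
  assumes "length xs = l" "i < l"
  shows "scalar_value (xs[i := x + y]) = scalar_value (xs[i := x]) + scalar_value (xs[i := y])"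
  using rank_op_additive[OF hilbert_space_Cn orthonormal_basis_std_basis finite_std_basis subset_refl,
      where as = "map (\<lambda>x _. x) (xs[i := x])" and i = i and a = "\<lambda>_. y"] assms
  by (simp add: scalar_value_def map_update comp_def)

text \<open>On a line, the trace norm of the difference of two scalars is the distance between them.
  Continuity at 0 is what \<open>additive_eq_zero\<close> asks for.\<close>

lemma scalar_value_continuous:
  assumes xs: "length xs = l" "i < l" and e: "0 < e"
  shows "\<exists>d>0. \<forall>x. \<bar>x\<bar> < d \<longrightarrow> \<bar>scalar_value (xs[i := x])\<bar> < e"
proof -
  let ?R = "\<lambda>x. rank_op (Cn 1 :: 'a univ ip_space) (std_basis 1) (\<lambda>_. x)"
  interpret C: hilbert_space "Cn 1 :: 'a univ ip_space" by (rule hilbert_space_Cn)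
  have fib: "map ?R ys \<in> fibre l (Cn 1)" if "length ys = l" for ys
    using rank_op_in_symbols[OF hilbert_space_Cn orthonormal_basis_std_basis finite_std_basis subset_refl,
        where as = "map (\<lambda>x _. x) ys"] that by (simp add: fibre_def comp_def)
  have norm: "trace_norm (Cn 1) (op_diff (Cn 1) (?R x) (?R y)) = \<bar>x - y\<bar>" for x y
  proof -
    have "std_basis 1 = {Coord (unit_vec 1 0) :: 'a univ}" by (auto simp: std_basis_def)
    thus ?thesis
      using C.trace_norm_rank_op(2)[OF orthonormal_basis_std_basis finite_std_basis subset_refl, of "\<lambda>_. x - y"]
        C.rank_op_diff[OF finite_std_basis, of 1 "\<lambda>_. x" "\<lambda>_. y"] by simp
  qed
  have "scalar_value (xs[i := 0]) = 0"
    using scalar_value_add[OF xs, of 0 0] by simp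
  moreover obtain d where d: "0 < d" "\<And>Bs. Bs \<in> fibre l (Cn 1) \<Longrightarrow>
      (\<forall>j<l. trace_norm (Cn 1) (op_diff (Cn 1) (Bs ! j) (map ?R (xs[i := 0]) ! j)) < d) \<Longrightarrow>
      \<bar>\<psi> (Bs, Cn 1) - \<psi> (map ?R (xs[i := 0]), Cn 1)\<bar> < e"
  proof -
    have "fibre_continuous l \<psi>" using trace_map by (simp add: trace_map_def)
    moreover have "map ?R (xs[i := 0]) \<in> fibre l (Cn 1)" using fib xs by simp
    ultimately show ?thesis using e that unfolding fibre_continuous_def by blast
  qed
  ultimately have "\<bar>scalar_value (xs[i := x])\<bar> < e" if "\<bar>x\<bar> < d" for x
    using d(2)[OF fib[of "xs[i := x]"]] xs that d(1)
    by (auto simp: scalar_value_def norm nth_list_update simp del: One_nat_def)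
  thus ?thesis using d(1) by blast
qed

lemma scalar_value_eq_zero:
  assumes xs: "length xs = l" "i < l" and p: "0 < p" "scalar_value (xs[i := p]) = 0"
  shows "scalar_value (xs[i := x]) = 0"
  using additive_eq_zero[of "\<lambda>x. scalar_value (xs[i := x])" p x] scalar_value_add[OF xs]
    scalar_value_continuous[OF xs] p by blast

text \<open>Using the same path in the first two coordinates makes them commute for every t, and
  scalar matrices commute with everything.\<close>

lemma scalar_value_ln2:
  assumes "length xs + 2 = l"
  shows "scalar_value (ln 2 # ln 2 # xs) = 0"
proof -
  let ?E = "\<lambda>x :: real. mat_diag 2 (\<lambda>_. [:exp x:])"
  define As where "As = homotopy_mat # homotopy_mat # map ?E xs"
  define d :: "nat \<Rightarrow> real" where "d = (\<lambda>i. if i = 0 then 1/2 else 2)"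
  define ds0 ds1 where "ds0 = (\<lambda>_. 0) # (\<lambda>_. 0) # map (\<lambda>x _::nat. x) xs"
    and "ds1 = (\<lambda>i. ln (d i)) # (\<lambda>i. ln (d i)) # map (\<lambda>x _. x) xs"
  have len: "length ds0 = l" "length ds1 = l" "length As = l" using assms by (auto simp: ds0_def ds1_def As_def)
  have d0: "0 < d i" for i by (simp add: d_def)
  have log: "mat_log 2 (mat_eval (?E x) t) = mat_diag 2 (\<lambda>_. x)" for x t
    by (simp add: mat_eval_mat_diag mat_log_diag)
  have log0: "mat_log 2 (mat_eval homotopy_mat 0) = mat_diag 2 (\<lambda>_. 0)"
    unfolding mat_eval_homotopy_mat by (subst mat_log_diag) auto
  have log1: "mat_log 2 (mat_eval homotopy_mat 1) = mat_diag 2 (\<lambda>i. ln (d i))"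
    unfolding mat_eval_homotopy_mat d_def[symmetric] using d0 by (subst mat_log_diag) auto
  have comm: "A * B = B * A" if "A \<in> set As" "B \<in> set As" for A B
    using that mat_diag_const_commute[OF homotopy_mat_carrier]
      mat_diag_const_commute[OF mat_diag_dim, of 2] by (auto simp: As_def mult.commute)
  have pd: "pos_def_symmetric 2 (mat_eval A 0) \<and> pos_def_symmetric 2 (mat_eval A 1)" if "A \<in> set As" for A
    using that d0 unfolding As_def
    by (auto simp: mat_eval_homotopy_mat d_def[symmetric] mat_eval_mat_diag
        simp del: mat_diag_one intro!: pos_def_symmetric_mat_diag)
  have GL: "set As \<subseteq> GL_poly 2" using homotopy_mat_GL const_GL_poly by (auto simp: As_def)
  have "\<psi> (map (\<lambda>A. mat_op 2 (mat_log 2 (mat_eval A 0))) As, Cn 2)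
      = \<psi> (map (\<lambda>A. mat_op 2 (mat_log 2 (mat_eval A 1))) As, Cn 2)"
    using trace_map len(3) GL comm pd unfolding trace_map_def poly_homotopy_invariant_def by auto
  also have "map (\<lambda>A. mat_op 2 (mat_log 2 (mat_eval A 0))) As = map (\<lambda>d. mat_op 2 (mat_diag 2 d)) ds0"
    by (simp add: As_def ds0_def log log0 comp_def)
  also have "map (\<lambda>A. mat_op 2 (mat_log 2 (mat_eval A 1))) As = map (\<lambda>d. mat_op 2 (mat_diag 2 d)) ds1"
    by (simp add: As_def ds1_def log log1 comp_def)
  finally have "(\<Sum>i<2. scalar_value (map (\<lambda>d. d i) ds0)) = (\<Sum>i<2. scalar_value (map (\<lambda>d. d i) ds1))"
    using mat_diag_value[of ds0 2] mat_diag_value[of ds1 2] len assms by simp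
  \<comment> \<open>The left side comes from t = 0, where the path is the identity with logarithm 0,
    and so will vanish. At t = 1 the two diagonal logarithms are opposite, as the constant
    determinant 1 forces.\<close>
  hence eq: "2 * scalar_value (0 # 0 # xs) = scalar_value (- ln 2 # - ln 2 # xs) + scalar_value (ln 2 # ln 2 # xs)"
    by (simp add: ds0_def ds1_def d_def comp_def numeral_2_eq_2 ln_div)
  have add: "scalar_value ((x + y) # z # xs) = scalar_value (x # z # xs) + scalar_value (y # z # xs)"
    "scalar_value (z # (x + y) # xs) = scalar_value (z # x # xs) + scalar_value (z # y # xs)" for x y z
    using scalar_value_add[of "0 # z # xs" 0 x y] scalar_value_add[of "z # 0 # xs" 1 x y] assms by auto
  have "scalar_value (0 # z # xs) = 0" "scalar_value (z # 0 # xs) = 0" for z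
    using add(1)[of 0 0 z] add(2)[of z 0 0] by simp_all
  thus ?thesis using eq add(1)[of "- ln 2" "ln 2" "- ln 2"] add(2)[of "ln 2" "- ln 2" "ln 2"] by simp
qed

text \<open>One coordinate is freed at a time: the value 0 at ln 2 makes the first entry arbitrary,
  then the second. The other entries are already arbitrary in
  \<open>scalar_value_ln2\<close>.\<close>

lemma scalar_value_zero:
  assumes "length xs = l" "2 \<le> l"
  shows "scalar_value xs = 0"
proof -
  obtain x y zs where xs: "xs = x # y # zs"
    using assms by (metis One_nat_def Suc_1 Suc_le_length_iff)
  have "scalar_value (ln 2 # ln 2 # zs) = 0"
    using scalar_value_ln2[of zs] assms xs by simp
  hence "scalar_value (x # ln 2 # zs) = 0"
    using scalar_value_eq_zero[of "x # ln 2 # zs" 0 "ln 2" x] assms xs by simp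
  thus ?thesis
    using scalar_value_eq_zero[of "x # y # zs" 1 "ln 2" y] assms xs by simp
qed

end

theorem theorem3p1:
  fixes l :: nat and \<psi> :: "'a symbol \<Rightarrow> real"
  assumes "l \<ge> 2"
    and "trace_map l \<psi>"
  shows "\<forall>(As, H)\<in>symbols l. \<psi> (As, H) = 0"
proof -
  interpret hilbert_trace_map l \<psi> by unfold_locales fact
  have "\<psi> (As, H) = 0" if s: "(As, H) \<in> symbols l" for As H
  proof (rule ccontr)
    assume "\<psi> (As, H) \<noteq> 0"
    \<comment> \<open>This serves as the tolerance in the continuity condition: the truncation has
      value 0, so its distance from the value at \<open>As\<close> would be smaller than
      itself.\<close>
    hence e: "0 < \<bar>\<psi> (As, H)\<bar>" by simp
    have H: "hilbert_space H" and len: "length As = l"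
      and As: "\<And>A. A \<in> set As \<Longrightarrow> self_adjoint H A \<and> trace_class H A"
      and comm: "\<And>A B. A \<in> set As \<Longrightarrow> B \<in> set As \<Longrightarrow> commuting H A B"
      using s by (auto simp: symbols_def)
    interpret hilbert_space H by (rule H)
    have "fibre_continuous l \<psi>" using trace_map by (simp add: trace_map_def)
    then obtain d where d: "0 < d" "\<And>Bs. Bs \<in> fibre l H \<Longrightarrow>
        (\<forall>i<l. trace_norm H (op_diff H (Bs ! i) (As ! i)) < d) \<Longrightarrow> \<bar>\<psi> (Bs, H) - \<psi> (As, H)\<bar> < \<bar>\<psi> (As, H)\<bar>"
      using s e unfolding fibre_continuous_def fibre_def by blast
    obtain B F as where B: "orthonormal_basis H B" and F: "finite F" "F \<subseteq> B" and as: "length as = length As"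
      and lt: "\<And>i. i < length As \<Longrightarrow> trace_norm H (op_diff H (rank_op H F (as ! i)) (As ! i)) < d"
      using trace_class_truncation[OF As comm d(1)] by blast
    have "\<psi> (map (rank_op H F) as, H) = (\<Sum>b\<in>F. scalar_value (map (\<lambda>a. a b) as))"
      using rank_op_value[OF F(1) H B F(2)] as len assms(1) by simp
    also have "\<dots> = 0" using scalar_value_zero as len assms(1) by simp
    finally have "\<psi> (map (rank_op H F) as, H) = 0" .
    moreover have "map (rank_op H F) as \<in> fibre l H"
      using rank_op_in_symbols[OF H B F, of as] as len by (simp add: fibre_def)
    hence "\<bar>\<psi> (map (rank_op H F) as, H) - \<psi> (As, H)\<bar> < \<bar>\<psi> (As, H)\<bar>"
      using lt as len by (intro d(2)) simp_all
    ultimately show False by simp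
  qed
  thus ?thesis by auto
qed

end
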